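(* Let $a$ be a nonnegative real number and $b$ a real number with $0<b<1$. Let $m=m(N)$ and $l=l(N)$ be integers depending on the positive integer $N$, with $1\le l\le N$, $m\sim aN$ and $l\sim bN$ as $N\to\infty$ (that is, $m/N\to a$ and $l/N\to b$). (i) If $m\ge0$, then the number of rhombus tilings of the hexagon with side lengths $N,2m,N,N,2m,N$ which contain the $l$-th rhombus on the symmetry axis which cuts through the sides of length $2m$, divided by the total number of rhombus tilings of this hexagon, tends as $N\to\infty$ to $$\frac{2}{\pi}\arcsin\left(\frac{\sqrt{b(1-b)}}{\sqrt{(a+b)(a-b+1)}}\right).$$ (ii) If $m\ge1$, then the number of rhombus tilings of the hexagon with side lengths $N+1,2m-1,N+1,N+1,2m-1,N+1$ which contain the $l$-th rhombus on the symmetry axis which cuts through the sides of length $2m-1$, divided by the total number of rhombus tilings of this hexagon, tends as $N\to\infty$ to the same value.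
   Context: For integers $n\ge1$, $M\ge0$, the hexagon with side lengths $n,M,n,n,M,n$ has all angles $120^\circ$ and is placed in the plane so that its vertices are $(0,\pm\frac M2)$, $(\frac{\sqrt3}{2}n,\pm\frac{M+n}{2})$, $(\sqrt3n,\pm\frac M2)$ (it degenerates to a rhombus when $M=0$). The sides of length $M$ are the two vertical ones, and the symmetry axis cutting through them is the line $y=0$. The hexagon is subdivided into unit equilateral triangles by the triangular lattice generated by $(0,1)$ and $(\frac{\sqrt3}{2},\frac12)$, translated so that the vertices of the hexagon are lattice points. A rhombus means the union of two of these unit triangles sharing an edge (side lengths $1$, angles $60^\circ$ and $120^\circ$). A rhombus tiling of the hexagon is a set of rhombi with pairwise disjoint interiors whose union is the hexagon; it contains a given rhombus if that rhombus is one of its tiles. Numbering of rhombi on the axis (from left to right, $1\le l\le N$): for $n=N$, $M=2m$, the $l$-th rhombus has vertices $((l-1)\sqrt3,0)$, $(l\sqrt3,0)$, $((l-\frac12)\sqrt3,\pm\frac12)$; for $n=N+1$, $M=2m-1$, the $l$-th rhombus has vertices $((l-\frac12)\sqrt3,0)$, $((l+\frac12)\sqrt3,0)$, $(l\sqrt3,\pm\frac12)$. *)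

theory Defs
  imports "HOL-Analysis.Analysis"
begin

(* The parameters n and M are integers; only n >= 1 and M >= 0 are meaningful.
   The type real * real carries the Euclidean distance. *)

definition hexagon :: "int \<Rightarrow> int \<Rightarrow> (real \<times> real) set" where
  "hexagon n M = convex hull
     {(0, of_int M / 2), (0, - of_int M / 2),
      (sqrt 3 / 2 * of_int n, of_int (M + n) / 2), (sqrt 3 / 2 * of_int n, - of_int (M + n) / 2),
      (sqrt 3 * of_int n, of_int M / 2), (sqrt 3 * of_int n, - of_int M / 2)}"

(* The translation by (0, M/2) makes the six vertices of the hexagon lattice points. *)
definition tri_lattice :: "int \<Rightarrow> (real \<times> real) set" where
  "tri_lattice M =
     {(0, of_int M / 2) + of_int i *\<^sub>R (0, 1) + of_int j *\<^sub>R (sqrt 3 / 2, 1 / 2) | i j :: int. True}"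

definition unit_triangle ::
  "int \<Rightarrow> int \<Rightarrow> real \<times> real \<Rightarrow> real \<times> real \<Rightarrow> real \<times> real \<Rightarrow> bool" where
  "unit_triangle n M p q r \<longleftrightarrow>
     {p, q, r} \<subseteq> tri_lattice M \<and> dist p q = 1 \<and> dist q r = 1 \<and> dist p r = 1 \<and>
     convex hull {p, q, r} \<subseteq> hexagon n M"

(* The two triangles share the edge from p to q. *)
definition rhombi :: "int \<Rightarrow> int \<Rightarrow> (real \<times> real) set set" where
  "rhombi n M =
     {convex hull {p, q, r} \<union> convex hull {p, q, s} | p q r s.
        unit_triangle n M p q r \<and> unit_triangle n M p q s \<and> r \<noteq> s}"

definition rhombus_tilings :: "int \<Rightarrow> int \<Rightarrow> (real \<times> real) set set set" where
  "rhombus_tilings n M =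
     {T. T \<subseteq> rhombi n M \<and> pairwise (\<lambda>R S. interior R \<inter> interior S = {}) T \<and>
         \<Union>T = hexagon n M}"

definition tiling_proportion :: "int \<Rightarrow> int \<Rightarrow> (real \<times> real) set \<Rightarrow> real" where
  "tiling_proportion n M R =
     real (card {T \<in> rhombus_tilings n M. R \<in> T}) / real (card (rhombus_tilings n M))"

(* The l-th rhombus on the axis y = 0, counted from the left starting at l = 1,
   in the hexagons with parameters (N, 2m) and (N + 1, 2m - 1) respectively. *)

definition axis_rhombus_even :: "int \<Rightarrow> (real \<times> real) set" where
  "axis_rhombus_even l = convex hull
     {((of_int l - 1) * sqrt 3, 0), (of_int l * sqrt 3, 0),
      ((of_int l - 1 / 2) * sqrt 3, 1 / 2), ((of_int l - 1 / 2) * sqrt 3, - 1 / 2)}"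

definition axis_rhombus_odd :: "int \<Rightarrow> (real \<times> real) set" where
  "axis_rhombus_odd l = convex hull
     {((of_int l - 1 / 2) * sqrt 3, 0), ((of_int l + 1 / 2) * sqrt 3, 0),
      (of_int l * sqrt 3, 1 / 2), (of_int l * sqrt 3, - 1 / 2)}"

end

theory Submission
  imports Defs "Jordan_Normal_Form.Determinant"
begin

text \<open>
  Reading a tiling along the vertical lattice lines, the vertical unit edges that are not short
  diagonals of tiles form \<open>M\<close> nonintersecting paths of particles, and the given rhombus
  is a tile iff its short diagonal is not visited. The number of path systems up to a line is a
  Vandermonde product times inverse factorials, so the particles on that line form an orthogonal
  polynomial ensemble for a symmetric Hahn weight, and the probability of a particle at the centre is
  \<open>\<Sum>k<M. \<psi>\<^sub>k(0)\<^sup>2\<close> with the normalised Hahn functions \<open>\<psi>\<^sub>k\<close>.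

  The \<open>\<psi>\<^sub>k\<close> are the eigenfunctions of a tridiagonal operator with eigenvalues decreasing in \<open>k\<close>, so
  the sum is a tail of the spectral measure of this operator at the centre. After division by
  \<open>N\<^sup>2\<close> the operator has asymptotically constant coefficients near the centre, hence the moments of
  the spectral measure converge to those of the free Jacobi operator on the integers: the limit is
  the arcsine law.
\<close>

subsection \<open>Walks\<close>

text \<open>The sum over \<open>k < M\<close> has a growing number of terms, so a direct evaluation
  would ask for asymptotics of the Hahn functions uniform in the degree. The eigenvalue equation
  avoids them: \<open>k < M\<close> becomes a half-line condition on the eigenvalue, and a moment of
  order \<open>r\<close> sees the operator only within distance \<open>r\<close> of the centre.
  There the symmetry axis helps: the diagonal entry at \<open>x\<close> is
  \<open>-(2 * K1 * K2 + 2 * x^2)\<close>, so a shift by \<open>2 * K1 * K2\<close> and division by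
  \<open>N^2\<close> leave only the off-diagonal limit \<open>A1 * A2\<close>. The half-line
  indicator is discontinuous, but the arcsine law has no atoms, so it can be squeezed between
  continuous ramps. Normalising constants are never evaluated: the path counts from either side are
  known up to a positive factor, and the factors cancel in the proportion. With \<open>M / N\<close>
  tending to \<open>2 * a\<close> and the two half-widths growing like \<open>(a + b) * N\<close>
  and \<open>(a + 1 - b) * N\<close>, the tail is \<open>arccos (2 * r - 1) / pi\<close> for
  \<open>r = b * (1 - b) / ((a + b) * (a + 1 - b))\<close>; the complementary probability becomes
  the stated arcsine by a half-angle formula.\<close>

text \<open>Beyond its last step a walk stays constant, which makes it determined by its finite part.\<close>

definition walks :: "('a \<Rightarrow> 'a \<Rightarrow> bool) \<Rightarrow> 'a \<Rightarrow> 'a \<Rightarrow> nat \<Rightarrow> (nat \<Rightarrow> 'a) set" where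
  "walks R a b n = {f. f 0 = a \<and> (\<forall>i<n. R (f i) (f (Suc i))) \<and> (\<forall>i\<ge>n. f i = b)}"

lemma walksI:
  "f 0 = a \<Longrightarrow> (\<And>i. i < n \<Longrightarrow> R (f i) (f (Suc i))) \<Longrightarrow> (\<And>i. n \<le> i \<Longrightarrow> f i = b) \<Longrightarrow> f \<in> walks R a b n"
  by (simp add: walks_def)

lemma walksD:
  assumes "f \<in> walks R a b n"
  shows "f 0 = a" "i < n \<Longrightarrow> R (f i) (f (Suc i))" "n \<le> i \<Longrightarrow> f i = b"
  using assms by (auto simp: walks_def)

lemma walks_last: "f \<in> walks R a b (Suc n) \<Longrightarrow> R (f n) b"
  using walksD(2)[of f R a b "Suc n" n] walksD(3)[of f R a b "Suc n" "Suc n"] by simp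

text \<open>The constant continuation makes the two maps mutually inverse: a walk cut at time
  \<open>s\<close> is frozen at \<open>c\<close>, and the second half starts at the same
  \<open>c\<close>.\<close>

lemma walks_split:
  "bij_betw (\<lambda>(g, h) i. if i \<le> s then g i else h (i - s))
     (walks R a c s \<times> walks R c b t) {f \<in> walks R a b (s + t). f s = c}"
proof (rule bij_betw_byWitness[where f' = "\<lambda>f. (\<lambda>i. f (min i s), \<lambda>i. f (s + i))"])
  show "\<forall>gh\<in>walks R a c s \<times> walks R c b t.
     (\<lambda>f. (\<lambda>i. f (min i s), \<lambda>i. f (s + i))) ((\<lambda>(g, h) i. if i \<le> s then g i else h (i - s)) gh) = gh"
    by (auto simp: walks_def fun_eq_iff min_def)
  show "\<forall>f\<in>{f \<in> walks R a b (s + t). f s = c}.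
     (\<lambda>(g, h) i. if i \<le> s then g i else h (i - s)) ((\<lambda>f. (\<lambda>i. f (min i s), \<lambda>i. f (s + i))) f) = f"
    by (auto simp: fun_eq_iff)
  show "(\<lambda>(g, h) i. if i \<le> s then g i else h (i - s)) ` (walks R a c s \<times> walks R c b t)
     \<subseteq> {f \<in> walks R a b (s + t). f s = c}"
  proof clarify
    fix g h assume g: "g \<in> walks R a c s" and h: "h \<in> walks R c b t"
    let ?f = "\<lambda>i. if i \<le> s then g i else h (i - s)"
    have gs: "g s = h 0" using walksD(3)[OF g order_refl] walksD(1)[OF h] by simp
    have "?f \<in> walks R a b (s + t)"
    proof (rule walksI)
      fix i assume i: "i < s + t"
      show "R (?f i) (?f (Suc i))"
      proof (cases "i < s")
        case True
        then show ?thesis using walksD(2)[OF g] by simp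
      next
        case False
        then have "R (h (i - s)) (h (Suc (i - s)))" using i by (intro walksD(2)[OF h]) auto
        then show ?thesis using False gs by (cases "i = s") (auto simp: Suc_diff_le)
      qed
    next
      fix i assume "s + t \<le> i"
      then show "?f i = b" using walksD(3)[OF h, of "i - s"] gs by (cases "i = s") auto
    qed (use walksD(1)[OF g] in simp)
    then show "?f \<in> walks R a b (s + t) \<and> ?f s = c" using walksD(3)[OF g order_refl] by simp
  qed
  show "(\<lambda>f. (\<lambda>i. f (min i s), \<lambda>i. f (s + i))) ` {f \<in> walks R a b (s + t). f s = c}
     \<subseteq> walks R a c s \<times> walks R c b t"
    by (auto simp: walks_def min_def)
qed

lemma card_walks_through:
  "card {f \<in> walks R a b (s + t). f s = c} = card (walks R a c s) * card (walks R c b t)"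
  using bij_betw_same_card[OF walks_split[of s R a c b t]] by (simp add: card_cartesian_product)

lemma walks_1: "walks R c b (Suc 0) = (if R c b then {\<lambda>i. if i = 0 then c else b} else {})"
  by (auto simp: walks_def fun_eq_iff Suc_le_eq)

lemma walks_0: "walks R a b 0 = (if a = b then {\<lambda>_. b} else {})"
  by (auto simp: walks_def)

lemma finite_walks:
  assumes "\<And>b. finite {c. R c b}"
  shows "finite (walks R a b n)"
proof (induction n arbitrary: b)
  case 0
  show ?case by (simp add: walks_0)
next
  case (Suc n)
  have "walks R a b (n + 1) \<subseteq> (\<Union>c\<in>{c. R c b}. {f \<in> walks R a b (n + 1). f n = c})"
    using walks_last[of _ R a b n] by auto
  moreover have "finite {f \<in> walks R a b (n + 1). f n = c}" for c
    using bij_betw_finite[OF walks_split[of n R a c b 1]] Suc by (simp add: walks_1)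
  ultimately show ?case
    using assms finite_subset by (metis (no_types, lifting) Suc_eq_plus1 finite_UN)
qed

text \<open>\<open>C\<close> may be any finite superset of the states reached at time
  \<open>s\<close>; a state that is not reached contributes a zero product.\<close>

lemma card_walks_sum:
  assumes fin: "\<And>b. finite {c. R c b}" and C: "finite C" "\<And>f. f \<in> walks R a b (s + t) \<Longrightarrow> f s \<in> C"
  shows "card {f \<in> walks R a b (s + t). Q (f s)} = (\<Sum>c | c \<in> C \<and> Q c. card (walks R a c s) * card (walks R c b t))"
proof -
  have "{f \<in> walks R a b (s + t). Q (f s)} = (\<Union>c\<in>{c\<in>C. Q c}. {f \<in> walks R a b (s + t). f s = c})"
    using C by auto
  also have "card \<dots> = (\<Sum>c | c \<in> C \<and> Q c. card {f \<in> walks R a b (s + t). f s = c})"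
    using C finite_walks[OF fin] by (intro card_UN_disjoint) auto
  finally show ?thesis by (simp add: card_walks_through)
qed

lemma card_walks_Suc:
  assumes fin: "\<And>b. finite {c. R c b}"
  shows "card (walks R a b (Suc n)) = (\<Sum>c | R c b. card (walks R a c n))"
proof -
  have "card {f \<in> walks R a b (n + 1). True} = (\<Sum>c | c \<in> {c. R c b} \<and> True. card (walks R a c n) * card (walks R c b 1))"
    by (rule card_walks_sum[OF fin]) (use fin walks_last[of _ R a b n] in auto)
  also have "\<dots> = (\<Sum>c | R c b. card (walks R a c n))"
    by (intro sum.cong) (auto simp: walks_1)
  finally show ?thesis by simp
qed

text \<open>Time reversal followed by the involution \<open>\<phi>\<close>. It will turn counts from
  the right side of the hexagon into counts from the left side.\<close>

lemma card_walks_reverse: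
  assumes inv: "\<And>x. \<phi> (\<phi> x) = x" and R: "\<And>x y. R x y \<Longrightarrow> R (\<phi> y) (\<phi> x)"
  shows "card (walks R a b n) = card (walks R (\<phi> b) (\<phi> a) n)"
proof -
  have *: "(\<lambda>i. \<phi> (f (n - i))) \<in> walks R (\<phi> b) (\<phi> a) n" if f: "f \<in> walks R a b n" for f :: "nat \<Rightarrow> 'a" and a b
  proof -
    have "R (\<phi> (f (n - i))) (\<phi> (f (n - Suc i)))" if i: "i < n" for i
    proof -
      have "R (f (n - Suc i)) (f (Suc (n - Suc i)))"
        using i by (intro walksD(2)[OF f]) auto
      then show ?thesis using i R by (simp add: Suc_diff_Suc)
    qed
    then show ?thesis using f by (auto simp: walks_def)
  qed
  \<comment> \<open>Past \<open>n\<close> the truncated subtraction yields the index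
    \<open>n\<close>, where the walk already has its final value.\<close>
  have **: "(\<lambda>i. \<phi> (\<phi> (f (n - (n - i))))) = f" if f: "f \<in> walks R a b n" for f :: "nat \<Rightarrow> 'a" and a b
  proof
    fix i
    show "\<phi> (\<phi> (f (n - (n - i)))) = f i"
      using walksD(3)[OF f, of i] walksD(3)[OF f, of n] by (cases "i \<le> n") (auto simp: inv)
  qed
  have "bij_betw (\<lambda>f i. \<phi> (f (n - i))) (walks R a b n) (walks R (\<phi> b) (\<phi> a) n)"
  proof (rule bij_betw_byWitness[where f' = "\<lambda>f i. \<phi> (f (n - i))"])
    show "(\<lambda>f i. \<phi> (f (n - i))) ` walks R (\<phi> b) (\<phi> a) n \<subseteq> walks R a b n"
      using *[of _ "\<phi> b" "\<phi> a"] by (auto simp: inv)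
  qed (use * ** in auto)
  then show ?thesis by (rule bij_betw_same_card)
qed

subsection \<open>Alternants and the Vandermonde determinant\<close>

text \<open>Falling factorials are preferred to powers because two operations are simple in this
  basis: the Hahn operator is bidiagonal, and the one-step transfer of the particle weights
  (\<open>bweight_ffact\<close>) is diagonal.\<close>

definition ffact :: "real \<Rightarrow> nat \<Rightarrow> real" where
  "ffact x k = (\<Prod>i<k. x - real i)"

lemma ffact_0 [simp]: "ffact x 0 = 1"
  by (simp add: ffact_def)

lemma ffact_Suc: "ffact x (Suc k) = ffact x k * (x - real k)"
  by (simp add: ffact_def)

lemma ffact_Suc': "ffact x (Suc k) = x * ffact (x - 1) k"
  by (induction k) (simp_all add: ffact_Suc algebra_simps)

text \<open>The determinant of the matrix with entries \<open>f j (y i)\<close>, kept as a Leibniz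
  sum so that summations over \<open>y\<close> can be exchanged with the sum over permutations; the
  matrix form serves for triangular changes of basis.\<close>

definition alternant :: "nat \<Rightarrow> (nat \<Rightarrow> 'a \<Rightarrow> real) \<Rightarrow> (nat \<Rightarrow> 'a) \<Rightarrow> real" where
  "alternant n f y = (\<Sum>p | p permutes {..<n}. of_int (sign p) * (\<Prod>i<n. f (p i) (y i)))"

lemma alternant_det: "alternant n f y = Determinant.det (Matrix.mat n n (\<lambda>(i,j). f j (y i)))"
proof -
  have "Determinant.det (Matrix.mat n n (\<lambda>(i,j). f j (y i))) =
    (\<Sum>p\<in>{p. p permutes {0..<n}}. signof p * (\<Prod>i=0..<n. Matrix.mat n n (\<lambda>(i,j). f j (y i)) $$ (i, p i)))"
    by (rule det_def') auto
  also have "\<dots> = (\<Sum>p\<in>{p. p permutes {0..<n}}. signof p * (\<Prod>i=0..<n. f (p i) (y i)))"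
  proof (intro sum.cong prod.cong arg_cong2[where f="(*)"] refl)
    fix p i assume "p \<in> {p. p permutes {0..<n}}" "i \<in> {0..<n}"
    then show "Matrix.mat n n (\<lambda>(i,j). f j (y i)) $$ (i, p i) = f (p i) (y i)"
      using permutes_in_image[of p "{0..<n}" i] by simp
  qed
  finally show ?thesis
    by (simp add: alternant_def atLeast0LessThan)
qed

text \<open>The change of basis is multiplication on the right by a triangular matrix with unit
  diagonal, whose determinant is 1.\<close>

lemma alternant_unitriangular:
  assumes "\<And>j x. j < n \<Longrightarrow> g j x = (\<Sum>k\<le>j. c j k * f k x)" and "\<And>j. j < n \<Longrightarrow> c j j = 1"
  shows "alternant n g y = alternant n f y"
proof -
  define C where "C = Matrix.mat n n (\<lambda>(k,j). if k \<le> j then c j k else 0 :: real)"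
  define F where "F = Matrix.mat n n (\<lambda>(i,j). f j (y i))"
  have "Matrix.mat n n (\<lambda>(i,j). g j (y i)) = F * C"
  proof (rule eq_matI)
    fix i j assume "i < dim_row (F * C)" "j < dim_col (F * C)"
    then have ij: "i < n" "j < n" by (auto simp: F_def C_def)
    have "(F * C) $$ (i,j) = (\<Sum>k\<in>{0..<n}. f k (y i) * (if k \<le> j then c j k else 0))"
      using ij by (auto simp: F_def C_def scalar_prod_def)
    also have "\<dots> = (\<Sum>k\<le>j. f k (y i) * c j k)"
      using ij by (intro sum.mono_neutral_cong_right) auto
    finally show "Matrix.mat n n (\<lambda>(i,j). g j (y i)) $$ (i,j) = (F * C) $$ (i,j)"
      using ij assms(1) by (simp add: mult.commute)
  qed (auto simp: F_def C_def)
  moreover have "Determinant.det C = 1"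
  proof -
    have "Determinant.det C = prod_list (diag_mat C)"
      by (rule det_upper_triangular) (auto simp: C_def)
    also have "\<dots> = 1"
      by (auto simp: C_def prod_list_diag_prod assms(2))
    finally show ?thesis .
  qed
  moreover have "Determinant.det (F * C) = Determinant.det F * Determinant.det C"
    by (rule det_mult) (auto simp: F_def C_def)
  ultimately show ?thesis
    by (simp add: alternant_det F_def)
qed

lemma newton_expansion:
  "\<exists>c. c j = 1 \<and> (\<forall>x. (\<Prod>i<j. x - y i) = (\<Sum>k\<le>j. c k * ffact x k))"
proof (induction j)
  case 0
  show ?case by (rule exI[of _ "\<lambda>_. 1"]) simp
next
  case (Suc j)
  then obtain c where c: "c j = 1" "\<And>x. (\<Prod>i<j. x - y i) = (\<Sum>k\<le>j. c k * ffact x k)" by blast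
  \<comment> \<open>From \<open>x - y j = (x - k) + (k - y j)\<close>: the first part raises
    \<open>ffact x k\<close> to \<open>ffact x (Suc k)\<close>, the second keeps the degree.\<close>
  define c' where "c' k = (if k = 0 then 0 else c (k - 1)) + (if k \<le> j then c k * (real k - y j) else 0)" for k
  have "(\<Prod>i<Suc j. x - y i) = (\<Sum>k\<le>Suc j. c' k * ffact x k)" for x
  proof -
    have "(\<Prod>i<Suc j. x - y i) = (\<Sum>k\<le>j. c k * ffact x k * (x - y j))"
      by (simp add: c(2) sum_distrib_right)
    also have "\<dots> = (\<Sum>k\<le>j. c k * ffact x (Suc k)) + (\<Sum>k\<le>j. c k * (real k - y j) * ffact x k)"
      by (simp add: ffact_Suc sum.distrib[symmetric] algebra_simps)
    also have "(\<Sum>k\<le>j. c k * ffact x (Suc k)) = (\<Sum>k\<le>Suc j. (if k = 0 then 0 else c (k - 1)) * ffact x k)"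
      by (simp add: sum.atMost_Suc_shift del: sum.atMost_Suc)
    also have "(\<Sum>k\<le>j. c k * (real k - y j) * ffact x k)
             = (\<Sum>k\<le>Suc j. (if k \<le> j then c k * (real k - y j) else 0) * ffact x k)"
      by simp
    finally show ?thesis
      by (simp add: c'_def sum.distrib[symmetric] algebra_simps del: sum.atMost_Suc)
  qed
  moreover have "c' (Suc j) = 1" using c(1) by (simp add: c'_def)
  ultimately show ?case by blast
qed

text \<open>In Newton's basis at the nodes \<open>y\<close> themselves, the entry in row
  \<open>i\<close> and column \<open>j\<close> has the factor \<open>y i - y i\<close> whenever
  \<open>i < j\<close>; the matrix is lower triangular.\<close>

lemma alternant_newton:
  "alternant n (\<lambda>j x. \<Prod>i<j. x - y i) y = (\<Prod>i<n. \<Prod>k<i. y i - (y k :: real))"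
proof -
  have "alternant n (\<lambda>j x. \<Prod>i<j. x - y i) y =
     prod_list (diag_mat (Matrix.mat n n (\<lambda>(i,j). \<Prod>k<j. y i - y k)))"
    unfolding alternant_det by (rule det_lower_triangular[where n = n]) auto
  then show ?thesis
    by (simp add: prod_list_diag_prod atLeast0LessThan)
qed

text \<open>Every monic basis gives the Vandermonde product: it is compared with Newton's basis by
  way of the falling factorials, and both changes of basis are unitriangular.\<close>

lemma alternant_ffact:
  assumes "\<And>j. j < n \<Longrightarrow> c j j = 1"
  shows "alternant n (\<lambda>j x. \<Sum>k\<le>j. c j k * ffact x k) y = (\<Prod>i<n. \<Prod>k<i. y i - y k)"
proof -
  have "\<forall>j. \<exists>c. c j = 1 \<and> (\<forall>x. (\<Prod>i<j. x - y i) = (\<Sum>k\<le>j. c k * ffact x k))"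
    using newton_expansion by blast
  then obtain d where d: "\<And>j. d j j = 1" "\<And>j x. (\<Prod>i<j. x - y i) = (\<Sum>k\<le>j. d j k * ffact x k)"
    by metis
  have "alternant n (\<lambda>j x. \<Sum>k\<le>j. c j k * ffact x k) y = alternant n (\<lambda>k x. ffact x k) y"
    by (rule alternant_unitriangular[where c = c]) (use assms in auto)
  also have "\<dots> = alternant n (\<lambda>j x. \<Prod>i<j. x - y i) y"
    by (rule alternant_unitriangular[where c = d, symmetric]) (use d in auto)
  finally show ?thesis
    by (simp add: alternant_newton)
qed

text \<open>A one-sided inverse of a square matrix is two-sided.\<close>

lemma orthonormal_rows_imp_columns:
  fixes f :: "nat \<Rightarrow> nat \<Rightarrow> real"
  assumes "\<And>j k. j < n \<Longrightarrow> k < n \<Longrightarrow> (\<Sum>i<n. f j i * f k i) = (if j = k then 1 else 0)"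
    and "x < n" "y < n"
  shows "(\<Sum>k<n. f k x * f k y) = (if x = y then 1 else 0)"
proof -
  define A where "A = Matrix.mat n n (\<lambda>(j,i). f j i)"
  define B where "B = Matrix.mat n n (\<lambda>(i,j). f j i)"
  have AB: "A * B = 1\<^sub>m n"
  proof (rule eq_matI)
    fix i j assume "i < dim_row (1\<^sub>m n :: real mat)" "j < dim_col (1\<^sub>m n :: real mat)"
    then show "(A * B) $$ (i,j) = 1\<^sub>m n $$ (i,j)"
      using assms(1)[of i j] by (auto simp: A_def B_def scalar_prod_def atLeast0LessThan)
  qed (auto simp: A_def B_def)
  have "B * A = 1\<^sub>m n"
    by (rule mat_mult_left_right_inverse[OF _ _ AB]) (auto simp: A_def B_def)
  then have "(B * A) $$ (x,y) = 1\<^sub>m n $$ (x,y)" by simp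
  then show ?thesis
    using assms(2,3) by (auto simp: A_def B_def scalar_prod_def atLeast0LessThan)
qed

text \<open>Expanding both determinants, only equal permutations survive the summation over the
  variables, so a product weight on the variables factors over the indices.\<close>

lemma sum_alternant_square:
  fixes f :: "nat \<Rightarrow> 'a \<Rightarrow> real"
  assumes "finite X"
    and orth: "\<And>j k. j < n \<Longrightarrow> k < n \<Longrightarrow> (\<Sum>x\<in>X. f j x * f k x) = (if j = k then 1 else 0)"
  shows "(\<Sum>y\<in>{..<n} \<rightarrow>\<^sub>E X. (alternant n f y)\<^sup>2) = fact n"
    and "c \<in> X \<Longrightarrow> (\<Sum>y\<in>{..<n} \<rightarrow>\<^sub>E X. (alternant n f y)\<^sup>2 * (\<Sum>i<n. if y i = c then 1 else 0))
           = fact n * (\<Sum>k<n. (f k c)\<^sup>2)"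
proof -
  let ?P = "{p. p permutes {..<n}}"
  have finP: "finite ?P" by (simp add: finite_permutations)
  have cardP: "card ?P = fact n" using card_permutations[of "{..<n}" n] by simp
  have gen: "(\<Sum>y\<in>{..<n} \<rightarrow>\<^sub>E X. (alternant n f y)\<^sup>2 * (\<Prod>i<n. u i (y i))) =
    (\<Sum>p\<in>?P. \<Sum>q\<in>?P. of_int (sign p) * of_int (sign q) * (\<Prod>i<n. \<Sum>x\<in>X. f (p i) x * f (q i) x * u i x))"
    for u :: "nat \<Rightarrow> 'a \<Rightarrow> real"
  proof -
    have "(alternant n f y)\<^sup>2 * U = (\<Sum>p\<in>?P. \<Sum>q\<in>?P. (of_int (sign p) * (\<Prod>i<n. f (p i) (y i))) *
        (of_int (sign q) * (\<Prod>i<n. f (q i) (y i))) * U)" for y U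
      unfolding alternant_def power2_eq_square sum_product by (simp add: sum_distrib_right)
    then have "(alternant n f y)\<^sup>2 * (\<Prod>i<n. u i (y i)) = (\<Sum>p\<in>?P. \<Sum>q\<in>?P. of_int (sign p) * of_int (sign q) *
        (\<Prod>i<n. f (p i) (y i) * f (q i) (y i) * u i (y i)))" for y
      by (simp add: prod.distrib mult_ac)
    then have "(\<Sum>y\<in>{..<n} \<rightarrow>\<^sub>E X. (alternant n f y)\<^sup>2 * (\<Prod>i<n. u i (y i))) =
      (\<Sum>y\<in>{..<n} \<rightarrow>\<^sub>E X. \<Sum>p\<in>?P. \<Sum>q\<in>?P. of_int (sign p) * of_int (sign q) *
        (\<Prod>i<n. f (p i) (y i) * f (q i) (y i) * u i (y i)))" by simp
    also have "\<dots> = (\<Sum>p\<in>?P. \<Sum>q\<in>?P. of_int (sign p) * of_int (sign q) *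
       (\<Sum>y\<in>{..<n} \<rightarrow>\<^sub>E X. \<Prod>i<n. f (p i) (y i) * f (q i) (y i) * u i (y i)))"
      by (subst sum.swap, rule sum.cong[OF refl], subst sum.swap, simp add: sum_distrib_left)
    finally show ?thesis
      using \<open>finite X\<close> by (simp add: prod_sum_PiE)
  qed
  have perm_lt: "p i < n" if "p \<in> ?P" "i < n" for p i
    using that permutes_in_image[of p "{..<n}" i] by simp
  have sgn2: "of_int (sign p) * of_int (sign p) = (1::real)" for p :: "nat \<Rightarrow> nat"
    by (simp add: sign_def)
  have perm_eq: "p = q" if "p \<in> ?P" "q \<in> ?P" "\<And>i. i < n \<Longrightarrow> p i = q i" for p q
    using that by (metis lessThan_iff mem_Collect_eq permutes_not_in ext)
  have d: "(\<Sum>q\<in>?P. of_int (sign p) * of_int (sign q) * (\<Prod>i<n. \<Sum>x\<in>X. f (p i) x * f (q i) x)) = 1"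
    if p: "p \<in> ?P" for p
  proof -
    have "(\<Prod>i<n. \<Sum>x\<in>X. f (p i) x * f (q i) x) = (if q = p then 1 else 0)" if q: "q \<in> ?P" for q
    proof -
      have "(\<Prod>i<n. \<Sum>x\<in>X. f (p i) x * f (q i) x) = (\<Prod>i<n. if p i = q i then 1 else 0)"
        using p q by (intro prod.cong refl orth) (auto intro: perm_lt)
      also have "\<dots> = (if q = p then 1 else 0)"
        using perm_eq[OF p q] by auto
      finally show ?thesis .
    qed
    then have "(\<Sum>q\<in>?P. of_int (sign p) * of_int (sign q) * (\<Prod>i<n. \<Sum>x\<in>X. f (p i) x * f (q i) x))
       = (\<Sum>q\<in>?P. of_int (sign p) * of_int (sign q) * (if q = p then 1 else 0))"
      by (intro sum.cong refl) auto
    also have "\<dots> = 1" using p finP by (simp add: sum.delta' sgn2 if_distrib cong: if_cong)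
    finally show ?thesis .
  qed
  show "(\<Sum>y\<in>{..<n} \<rightarrow>\<^sub>E X. (alternant n f y)\<^sup>2) = fact n"
    using gen[of "\<lambda>_ _. 1"] d cardP by simp
  assume c: "c \<in> X"
  have e: "(\<Sum>y\<in>{..<n} \<rightarrow>\<^sub>E X. (alternant n f y)\<^sup>2 * (if y i = c then 1 else 0)) = (\<Sum>p\<in>?P. (f (p i) c)\<^sup>2)"
    if i: "i < n" for i
  proof -
    \<comment> \<open>The indicator of \<open>y i = c\<close> is written as a product of
      one-variable weights, so that \<open>gen\<close> applies to it.\<close>
    define u where "u k x = (if k = i \<and> x \<noteq> c then 0 else 1 :: real)" for k x
    have u: "(\<Prod>k<n. u k (y k)) = (if y i = c then 1 else 0)" for y
    proof (cases "y i = c")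
      case True
      then have "u k (y k) = 1" for k by (auto simp: u_def)
      then show ?thesis using True by simp
    next
      case False
      then have "(\<Prod>k<n. u k (y k)) = 0" using i by (intro prod_zero) (auto simp: u_def)
      then show ?thesis using False by simp
    qed
    have "(\<Sum>q\<in>?P. of_int (sign p) * of_int (sign q) * (\<Prod>k<n. \<Sum>x\<in>X. f (p k) x * f (q k) x * u k x))
      = (f (p i) c)\<^sup>2" if p: "p \<in> ?P" for p
    proof -
      have "(\<Prod>k<n. \<Sum>x\<in>X. f (p k) x * f (q k) x * u k x) = (if q = p then (f (p i) c)\<^sup>2 else 0)" if q: "q \<in> ?P" for q
      proof -
        have i1: "(\<Sum>x\<in>X. f (p i) x * f (q i) x * u i x) = f (p i) c * f (q i) c"
        proof -
          have "(\<Sum>x\<in>X. f (p i) x * f (q i) x * u i x) = (\<Sum>x\<in>X. if x = c then f (p i) x * f (q i) x else 0)"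
            by (intro sum.cong) (auto simp: u_def)
          then show ?thesis using \<open>finite X\<close> c by simp
        qed
        have i2: "(\<Prod>k\<in>{..<n}-{i}. \<Sum>x\<in>X. f (p k) x * f (q k) x * u k x) = (\<Prod>k\<in>{..<n}-{i}. if p k = q k then 1 else 0)"
        proof (intro prod.cong refl)
          fix k assume "k \<in> {..<n}-{i}"
          then show "(\<Sum>x\<in>X. f (p k) x * f (q k) x * u k x) = (if p k = q k then 1 else 0)"
            using orth[of "p k" "q k"] perm_lt p q by (simp add: u_def)
        qed
        have "(\<Prod>k<n. \<Sum>x\<in>X. f (p k) x * f (q k) x * u k x) =
          f (p i) c * f (q i) c * (\<Prod>k\<in>{..<n}-{i}. if p k = q k then 1 else 0)"
          using i by (simp add: prod.remove[of _ i] i1 i2)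
        also have "\<dots> = (if q = p then (f (p i) c)\<^sup>2 else 0)"
        proof (cases "\<forall>k\<in>{..<n}-{i}. p k = q k")
          case True
          \<comment> \<open>A permutation is determined by its values off a single point: the value
            \<open>q i\<close> cannot be taken by \<open>p\<close> anywhere else.\<close>
          have "p i = q i"
          proof (rule ccontr)
            assume ne: "p i \<noteq> q i"
            have "q i \<in> p ` {..<n}" using p q i permutes_image[of p "{..<n}"] perm_lt[of q i] by auto
            then obtain k where k: "k < n" "p k = q i" by auto
            with ne have "k \<noteq> i" by auto
            then have "q k = q i" using True k by auto
            then show False using q \<open>k \<noteq> i\<close> permutes_inj[of q] by (auto dest: injD)
          qed
          then have "p = q" using True p q by (intro perm_eq) auto
          then show ?thesis by (simp add: power2_eq_square)
        next
          case False
          then have "q \<noteq> p" by auto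
          moreover have "(\<Prod>k\<in>{..<n}-{i}. if p k = q k then 1 else (0::real)) = 0"
            using False by (intro prod_zero) auto
          ultimately show ?thesis by simp
        qed
        finally show ?thesis .
      qed
      then have "(\<Sum>q\<in>?P. of_int (sign p) * of_int (sign q) * (\<Prod>k<n. \<Sum>x\<in>X. f (p k) x * f (q k) x * u k x))
        = (\<Sum>q\<in>?P. of_int (sign p) * of_int (sign q) * (if q = p then (f (p i) c)\<^sup>2 else 0))"
        by (intro sum.cong refl) auto
      also have "\<dots> = (\<Sum>q\<in>?P. if q = p then (f (p i) c)\<^sup>2 else 0)"
        by (intro sum.cong refl) (auto simp: sgn2)
      also have "\<dots> = (f (p i) c)\<^sup>2" using p finP by (simp add: sum.delta')
      finally show ?thesis .
    qed
    then show ?thesis using gen[of u] by (simp add: u)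
  qed
  have "(\<Sum>y\<in>{..<n} \<rightarrow>\<^sub>E X. (alternant n f y)\<^sup>2 * (\<Sum>i<n. if y i = c then 1 else 0))
      = (\<Sum>i<n. \<Sum>y\<in>{..<n} \<rightarrow>\<^sub>E X. (alternant n f y)\<^sup>2 * (if y i = c then 1 else 0))"
    by (subst sum.swap) (simp add: sum_distrib_left)
  also have "\<dots> = (\<Sum>i<n. \<Sum>p\<in>?P. (f (p i) c)\<^sup>2)"
    by (intro sum.cong refl e) auto
  also have "\<dots> = (\<Sum>p\<in>?P. \<Sum>i<n. (f (p i) c)\<^sup>2)"
    by (rule sum.swap)
  also have "\<dots> = (\<Sum>p\<in>?P. \<Sum>i<n. (f i c)\<^sup>2)"
  proof (rule sum.cong[OF refl])
    fix p assume "p \<in> ?P"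
    then show "(\<Sum>i<n. (f (p i) c)\<^sup>2) = (\<Sum>i<n. (f i c)\<^sup>2)"
      using sum.permute[of p "{..<n}" "\<lambda>i. (f i c)\<^sup>2"] by (simp add: o_def)
  qed
  finally show "(\<Sum>y\<in>{..<n} \<rightarrow>\<^sub>E X. (alternant n f y)\<^sup>2 * (\<Sum>i<n. if y i = c then 1 else 0))
           = fact n * (\<Sum>k<n. (f k c)\<^sup>2)" using cardP by simp
qed

subsection \<open>The Hahn ensemble\<close>

abbreviation vprod :: "nat \<Rightarrow> (nat \<Rightarrow> int) \<Rightarrow> real" where
  "vprod n y \<equiv> \<Prod>i<n. \<Prod>k<i. real_of_int (y i) - real_of_int (y k)"

text \<open>The two parameters are the half-widths of the supports of the particle weights seen from
  the left and from the right side of the hexagon; with the smaller one first, \<open>X\<close> is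
  the common support.\<close>

locale hahn =
  fixes K1 K2 :: nat
  assumes K12: "K1 \<le> K2"
begin

definition X :: "int set" where "X = {- int K1..int K1}"

text \<open>Outside \<open>X\<close> the truncation by \<open>nat\<close> leaves a positive value
  instead of 0. The cut-off at the ends of \<open>X\<close> comes from the rates instead:
  \<open>up\<close> vanishes at \<open>K1\<close> and \<open>dn\<close> at
  \<open>- K1\<close>.\<close>

definition W :: "int \<Rightarrow> real" where
  "W x = 1 / (fact (nat (int K1 + x)) * fact (nat (int K1 - x)) * fact (nat (int K2 + x)) * fact (nat (int K2 - x)))"

definition up :: "int \<Rightarrow> real" where "up x = (real K1 - x) * (real K2 - x)"
definition dn :: "int \<Rightarrow> real" where "dn x = (real K1 + x) * (real K2 + x)"

definition lam :: "nat \<Rightarrow> real" where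
  "lam k = real k * (real k - 1 - 2 * (real K1 + real K2))"

text \<open>The difference operator \<open>f \<mapsto> up x * (f (x + 1) - f x) + dn x * (f (x - 1) - f x)\<close> is symmetric with
  respect to \<open>W\<close> and bidiagonal in the basis of falling factorials, with diagonal entries \<open>lam\<close> and
  off-diagonal entries \<open>mu\<close>; solving for its eigenvectors gives the coefficients \<open>qc\<close>.\<close>

definition mu :: "nat \<Rightarrow> real" where
  "mu k = real k * ((real k - 1) * (real k - 1 - 2 * (real K1 + real K2)) + 2 * real K1 * (real K1 + real K2)
     + (real K2 - real K1) * (real k - 1))"

definition qc :: "nat \<Rightarrow> nat \<Rightarrow> real" where
  "qc k j = (\<Prod>i=j..<k. mu (Suc i) / (lam k - lam i))"

definition q :: "nat \<Rightarrow> int \<Rightarrow> real" where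
  "q k x = (\<Sum>j\<le>k. qc k j * ffact (real_of_int x + real K1) j)"

definition h :: "nat \<Rightarrow> real" where
  "h k = (\<Sum>x\<in>X. W x * (q k x)\<^sup>2)"

definition psi :: "nat \<Rightarrow> int \<Rightarrow> real" where
  "psi k x = q k x * sqrt (W x) / sqrt (h k)"

text \<open>The off-diagonal entry between \<open>x\<close> and \<open>x + 1\<close> once the
  difference operator has been made symmetric by conjugation with \<open>sqrt (W x)\<close>.\<close>

definition ac :: "int \<Rightarrow> real" where
  "ac x = sqrt (up x * dn (x + 1))"

section \<open>Spectral theory of the Hahn difference operator\<close>

lemma finite_X [simp]: "finite X"
  by (simp add: X_def)

lemma W_pos: "W x > 0"
  by (simp add: W_def)

text \<open>Detailed balance of \<open>W\<close> for the rates \<open>up\<close> and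
  \<open>dn\<close>: moving from \<open>x\<close> to \<open>x + 1\<close> changes each of the four
  factorials by one factor.\<close>

lemma W_step:
  assumes "- int K1 \<le> x" "x < int K1"
  shows "W x * up x = W (x + 1) * dn (x + 1)"
proof -
  have *: "fact (nat (int K + x + 1)) = (real K + x + 1) * (fact (nat (int K + x)) :: real)" 
          "fact (nat (int K - x)) = (real K - x) * (fact (nat (int K - x - 1)) :: real)" if "K1 \<le> K" for K
  proof -
    have "nat (int K + x + 1) = Suc (nat (int K + x))" "nat (int K - x) = Suc (nat (int K - x - 1))"
      using assms that by auto
    moreover have "real (Suc (nat (int K + x))) = real K + x + 1" "real (Suc (nat (int K - x - 1))) = real K - x"
      using assms that by auto
    ultimately show "fact (nat (int K + x + 1)) = (real K + x + 1) * (fact (nat (int K + x)) :: real)" 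
          "fact (nat (int K - x)) = (real K - x) * (fact (nat (int K - x - 1)) :: real)"
      by (simp_all only: fact_Suc)
  qed
  have nz: "real K1 - x \<noteq> 0" "real K2 - x \<noteq> 0" "real K1 + x + 1 \<noteq> 0" "real K2 + x + 1 \<noteq> 0"
    using assms K12 by linarith+
  define F1 F2 G1 G2 :: real where "F1 = fact (nat (int K1 + x))" and "F2 = fact (nat (int K2 + x))"
    and "G1 = fact (nat (int K1 - x - 1))" and "G2 = fact (nat (int K2 - x - 1))"
  have "W x = 1 / (F1 * ((real K1 - x) * G1) * F2 * ((real K2 - x) * G2))"
    using *(2)[of K1] *(2)[of K2] K12 by (simp add: W_def F1_def F2_def G1_def G2_def)
  then have 1: "W x * up x = 1 / (F1 * G1 * F2 * G2)"
    using nz by (simp add: up_def)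
  have "W (x + 1) = 1 / ((real K1 + x + 1) * F1 * G1 * ((real K2 + x + 1) * F2) * G2)"
    using *(1)[of K1] *(1)[of K2] K12 
    by (simp add: W_def F1_def F2_def G1_def G2_def add.assoc[symmetric] diff_diff_eq[symmetric])
  moreover have "dn (x + 1) = (real K1 + x + 1) * (real K2 + x + 1)"
    by (simp add: dn_def add.assoc)
  ultimately have "W (x + 1) * dn (x + 1) = 1 / (F1 * G1 * F2 * G2)"
    using nz by simp
  with 1 show ?thesis by simp
qed

text \<open>A forward difference lowers the degree of a falling factorial. The backward difference
  is evaluated at \<open>z - 1\<close>, but \<open>dn x\<close> contains the factor
  \<open>z\<close>, and \<open>z * ffact (z - 1) i = (z - i) * ffact z i\<close> brings it back to
  \<open>z\<close>. For \<open>j = 0\<close> the truncated index \<open>j - 1\<close> is harmless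
  because \<open>mu 0 = 0\<close>.\<close>

lemma L_ffact:
  fixes x :: int
  defines "z \<equiv> real_of_int x + real K1"
  shows "up x * (ffact (z + 1) j - ffact z j) + dn x * (ffact (z - 1) j - ffact z j)
    = lam j * ffact z j + mu j * ffact z (j - 1)"
proof (cases j)
  case 0
  then show ?thesis by (simp add: lam_def mu_def)
next
  case (Suc i)
  have 1: "ffact (y + 1) (Suc i) - ffact y (Suc i) = (real i + 1) * ffact y i" for y
    unfolding ffact_Suc'[of "y + 1"] ffact_Suc[of y] by (simp add: algebra_simps)
  have 2: "dn x * (ffact (z - 1) (Suc i) - ffact z (Suc i)) = - (real i + 1) * (z + real K2 - real K1) * ((z - real i) * ffact z i)"
  proof -
    have "ffact (z - 1) (Suc i) - ffact z (Suc i) = - (real i + 1) * ffact (z - 1) i"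
      using 1[of "z - 1"] by (simp add: algebra_simps)
    moreover have "z * ffact (z - 1) i = (z - real i) * ffact z i"
      using ffact_Suc[of z i] ffact_Suc'[of z i] by (simp add: mult.commute)
    moreover have "dn x = z * (z + real K2 - real K1)"
      by (simp add: dn_def z_def algebra_simps)
    ultimately have "dn x * (ffact (z - 1) (Suc i) - ffact z (Suc i)) =
      - (real i + 1) * (z + real K2 - real K1) * (z * ffact (z - 1) i)" by simp
    then show ?thesis using \<open>z * ffact (z - 1) i = _\<close> by simp
  qed
  have 3: "up x = (2 * real K1 - z) * (real K1 + real K2 - z)"
    by (simp add: up_def z_def algebra_simps)
  show ?thesis
    unfolding Suc 1 2 3 by (simp add: lam_def mu_def ffact_Suc algebra_simps)
qed

lemma lam_diff: "lam k - lam j = (real k - real j) * (real k + real j - 1 - 2 * (real K1 + real K2))"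
  by (simp add: lam_def algebra_simps)

text \<open>As a function of \<open>k\<close>, \<open>lam\<close> is a parabola with vertex at
  \<open>K1 + K2 + 1/2\<close>, which lies beyond \<open>2 * K1\<close> because
  \<open>K1 \<le> K2\<close>.\<close>

lemma lam_less: 
  assumes "j < k" "k \<le> 2 * K1"
  shows "lam k < lam j"
proof -
  have "real k + real j + 1 \<le> 4 * real K1" "real K1 \<le> real K2" "real k - real j > 0"
    using assms K12 by linarith+
  then have "(real k - real j) * (real k + real j - 1 - 2 * (real K1 + real K2)) < 0"
    by (intro mult_pos_neg) auto
  then show ?thesis using lam_diff[of k j] by simp
qed

lemma qc_rec: "j < k \<Longrightarrow> k \<le> 2 * K1 \<Longrightarrow> qc k (Suc j) * mu (Suc j) = (lam k - lam j) * qc k j"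
  using lam_less[of j k] by (simp add: qc_def prod.atLeast_Suc_lessThan)

lemma qc_diag [simp]: "qc k k = 1"
  by (simp add: qc_def)

text \<open>A polynomial identity, hence free of restrictions on \<open>x\<close>; the bound on
  \<open>k\<close> keeps the denominators in \<open>qc\<close> nonzero.\<close>

lemma q_eigen:
  assumes k: "k \<le> 2 * K1"
  shows "up x * (q k (x + 1) - q k x) + dn x * (q k (x - 1) - q k x) = lam k * q k x"
proof -
  let ?z = "real_of_int x + real K1"
  have z: "real_of_int (x + 1) + real K1 = ?z + 1" "real_of_int (x - 1) + real K1 = ?z - 1" by auto
  have "up x * (q k (x + 1) - q k x) + dn x * (q k (x - 1) - q k x) =
    (\<Sum>j\<le>k. qc k j * (up x * (ffact (?z + 1) j - ffact ?z j) + dn x * (ffact (?z - 1) j - ffact ?z j)))"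
    unfolding q_def z sum_subtractf[symmetric] sum_distrib_left sum.distrib[symmetric]
    by (intro sum.cong refl) (simp add: algebra_simps)
  also have "\<dots> = (\<Sum>j\<le>k. qc k j * lam j * ffact ?z j) + (\<Sum>j\<le>k. qc k j * mu j * ffact ?z (j - 1))"
    unfolding L_ffact by (simp add: algebra_simps sum.distrib)
  \<comment> \<open>The term at \<open>j = 0\<close> drops out since \<open>mu 0 = 0\<close>; the
    others are reindexed so that \<open>qc_rec\<close> applies.\<close>
  also have "(\<Sum>j\<le>k. qc k j * mu j * ffact ?z (j - 1)) = (\<Sum>j<k. qc k (Suc j) * mu (Suc j) * ffact ?z j)"
    by (cases k) (simp_all add: mu_def sum.atMost_Suc_shift lessThan_Suc_atMost del: sum.atMost_Suc)
  also have "\<dots> = (\<Sum>j<k. (lam k - lam j) * qc k j * ffact ?z j)"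
    by (intro sum.cong refl) (simp add: qc_rec k)
  also have "\<dots> = (\<Sum>j\<le>k. (lam k - lam j) * qc k j * ffact ?z j)"
    by (simp add: lessThan_Suc_atMost[symmetric])
  also have "(\<Sum>j\<le>k. qc k j * lam j * ffact ?z j) + \<dots> = lam k * q k x"
    unfolding q_def sum_distrib_left sum.distrib[symmetric]
    by (intro sum.cong refl) (simp add: algebra_simps)
  finally show ?thesis .
qed

text \<open>Summation by parts with detailed balance; no boundary terms arise, as \<open>up\<close>
  and \<open>dn\<close> vanish at the respective ends. The right-hand side is symmetric in
  \<open>f\<close> and \<open>g\<close>, so the operator is self-adjoint for
  \<open>W\<close>.\<close>

lemma dirichlet_form:
  "(\<Sum>x\<in>X. W x * (up x * (f (x + 1) - f x) + dn x * (f (x - 1) - f x)) * g x)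
   = - (\<Sum>x\<in>{- int K1..<int K1}. W x * up x * (f (x + 1) - f x) * (g (x + 1) - g x))"
proof -
  let ?Y = "{- int K1..<int K1}"
  have "(\<Sum>x\<in>X. W x * up x * (f (x + 1) - f x) * g x) = (\<Sum>x\<in>?Y. W x * up x * (f (x + 1) - f x) * g x)"
  proof (rule sum.mono_neutral_right)
    show "\<forall>x\<in>X - ?Y. W x * up x * (f (x + 1) - f x) * g x = 0"
    proof
      fix x assume "x \<in> X - ?Y"
      then have "x = int K1" by (auto simp: X_def)
      then show "W x * up x * (f (x + 1) - f x) * g x = 0" by (simp add: up_def)
    qed
  qed (auto simp: X_def)
  moreover have "(\<Sum>x\<in>X. W x * dn x * (f (x - 1) - f x) * g x) = (\<Sum>x\<in>X - {- int K1}. W x * dn x * (f (x - 1) - f x) * g x)"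
    by (rule sum.mono_neutral_right) (auto simp: X_def dn_def)
  moreover have "\<dots> = (\<Sum>x\<in>?Y. W (x + 1) * dn (x + 1) * (f x - f (x + 1)) * g (x + 1))"
    by (rule sum.reindex_bij_witness[of _ "\<lambda>x. x + 1" "\<lambda>x. x - 1"]) (auto simp: X_def)
  moreover have "\<dots> = (\<Sum>x\<in>?Y. W x * up x * (f x - f (x + 1)) * g (x + 1))"
    by (intro sum.cong refl) (simp add: W_step)
  moreover have "(\<Sum>x\<in>X. W x * (up x * (f (x + 1) - f x) + dn x * (f (x - 1) - f x)) * g x)
    = (\<Sum>x\<in>X. W x * up x * (f (x + 1) - f x) * g x) + (\<Sum>x\<in>X. W x * dn x * (f (x - 1) - f x) * g x)"
    by (simp add: sum.distrib[symmetric] algebra_simps)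
  ultimately have "(\<Sum>x\<in>X. W x * (up x * (f (x + 1) - f x) + dn x * (f (x - 1) - f x)) * g x)
    = (\<Sum>x\<in>?Y. W x * up x * (f (x + 1) - f x) * g x) + (\<Sum>x\<in>?Y. W x * up x * (f x - f (x + 1)) * g (x + 1))"
    by presburger
  also have "\<dots> = (\<Sum>x\<in>?Y. - (W x * up x * (f (x + 1) - f x) * (g (x + 1) - g x)))"
    unfolding sum.distrib[symmetric] by (intro sum.cong refl) (simp add: algebra_simps)
  finally show ?thesis by (simp add: sum_negf)
qed

text \<open>Eigenfunctions of a self-adjoint operator for distinct eigenvalues.\<close>

lemma q_orth:
  assumes "j \<le> 2 * K1" "k \<le> 2 * K1" "j \<noteq> k"
  shows "(\<Sum>x\<in>X. W x * q j x * q k x) = 0"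
proof -
  have *: "(\<Sum>x\<in>X. W x * (lam a * q a x) * q b x) = lam a * (\<Sum>x\<in>X. W x * q a x * q b x)" for a b
    by (simp add: sum_distrib_left mult_ac)
  have "lam j * (\<Sum>x\<in>X. W x * q j x * q k x) = lam k * (\<Sum>x\<in>X. W x * q k x * q j x)"
    unfolding *[symmetric] q_eigen[OF assms(1), symmetric] q_eigen[OF assms(2), symmetric] dirichlet_form
    by (simp add: mult_ac)
  moreover have "(\<Sum>x\<in>X. W x * q k x * q j x) = (\<Sum>x\<in>X. W x * q j x * q k x)"
    by (simp add: mult_ac)
  moreover have "lam j \<noteq> lam k"
    using lam_less[of j k] lam_less[of k j] assms by (cases "j < k") auto
  ultimately show ?thesis by simp
qed

text \<open>\<open>q k\<close> is monic in falling factorials of \<open>x + K1\<close>, and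
  differences of the nodes do not see the shift by \<open>K1\<close>.\<close>

lemma alternant_q: "alternant n q y = vprod n y"
proof -
  have "alternant n q y = alternant n (\<lambda>j x. \<Sum>k\<le>j. qc j k * ffact x k) (\<lambda>i. real_of_int (y i) + real K1)"
    by (simp add: alternant_def q_def)
  also have "\<dots> = vprod n y"
    by (subst alternant_ffact) simp_all
  finally show ?thesis .
qed

text \<open>If \<open>q k\<close> vanished on all of \<open>X\<close>, the determinant of
  \<open>q 0, ..., q (2 * K1)\<close> at the \<open>2 * K1 + 1\<close> points of \<open>X\<close>
  would be zero, yet it is a Vandermonde product of distinct nodes.\<close>

lemma h_pos:
  assumes "k \<le> 2 * K1"
  shows "h k > 0"
proof -
  define y where "y i = int i - int K1" for i
  have "\<exists>x\<in>X. q k x \<noteq> 0"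
  proof (rule ccontr)
    assume *: "\<not> (\<exists>x\<in>X. q k x \<noteq> 0)"
    have "alternant (2 * K1 + 1) q y = 0"
      unfolding alternant_def
    proof (intro sum.neutral ballI)
      fix p assume p: "p \<in> {p. p permutes {..<2 * K1 + 1}}"
      then have "k \<in> p ` {..<2 * K1 + 1}" using assms permutes_image[of p "{..<2 * K1 + 1}"] by auto
      then obtain i where i: "i < 2 * K1 + 1" "p i = k" by auto
      then have "q (p i) (y i) = 0" using * by (auto simp: y_def X_def)
      then have "(\<Prod>i<2 * K1 + 1. q (p i) (y i)) = 0" using i by (intro prod_zero) auto
      then show "real_of_int (sign p) * (\<Prod>i<2 * K1 + 1. q (p i) (y i)) = 0" by simp
    qed
    moreover have "alternant (2 * K1 + 1) q y \<noteq> 0"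
      unfolding alternant_q by (auto simp: y_def)
    ultimately show False by simp
  qed
  then obtain x where x: "x \<in> X" "q k x \<noteq> 0" by auto
  have "0 < W x * (q k x)\<^sup>2" using x W_pos[of x] by simp
  also have "\<dots> \<le> h k"
    unfolding h_def using x W_pos by (intro member_le_sum) (auto simp: less_imp_le)
  finally show ?thesis .
qed

lemma psi_orth:
  assumes "j \<le> 2 * K1" "k \<le> 2 * K1"
  shows "(\<Sum>x\<in>X. psi j x * psi k x) = (if j = k then 1 else 0)"
proof -
  have "psi j x * psi k x = W x * q j x * q k x / (sqrt (h j) * sqrt (h k))" for x
    using W_pos[of x] by (simp add: psi_def)
  then have *: "(\<Sum>x\<in>X. psi j x * psi k x) = (\<Sum>x\<in>X. W x * q j x * q k x) / (sqrt (h j) * sqrt (h k))"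
    by (simp add: sum_divide_distrib)
  show ?thesis
  proof (cases "j = k")
    case True
    then show ?thesis unfolding * using h_pos[of k] assms
      by (simp add: h_def power2_eq_square mult_ac)
  next
    case False
    then show ?thesis unfolding * using q_orth assms by simp
  qed
qed

text \<open>There are as many functions as points in \<open>X\<close>, so orthonormality over the
  points gives orthonormality over the degrees. At \<open>x = 0\<close> this is the moment of order
  0 of the spectral measure.\<close>

lemma psi_complete:
  assumes "x \<in> X" "y \<in> X"
  shows "(\<Sum>k\<le>2 * K1. psi k x * psi k y) = (if x = y then 1 else 0)"
proof -
  let ?n = "2 * K1 + 1"
  have "(\<Sum>k<?n. psi k (int (nat (x + K1)) - K1) * psi k (int (nat (y + K1)) - K1)) = (if nat (x + K1) = nat (y + K1) then 1 else 0)"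
  proof (rule orthonormal_rows_imp_columns[where f = "\<lambda>k i. psi k (int i - int K1)"])
    fix j k assume jk: "j < ?n" "k < ?n"
    have "(\<Sum>i<?n. psi j (int i - int K1) * psi k (int i - int K1)) = (\<Sum>x\<in>X. psi j x * psi k x)"
      by (rule sum.reindex_bij_witness[of _ "\<lambda>x. nat (x + K1)" "\<lambda>i. int i - int K1"]) (auto simp: X_def)
    then show "(\<Sum>i<?n. psi j (int i - int K1) * psi k (int i - int K1)) = (if j = k then 1 else 0)"
      using psi_orth[of j k] jk by simp
  qed (use assms in \<open>auto simp: X_def\<close>)
  then show ?thesis using assms by (auto simp: X_def lessThan_Suc_atMost)
qed

lemma up_nonneg: "x \<in> X \<Longrightarrow> 0 \<le> up x" and dn_nonneg: "x \<in> X \<Longrightarrow> 0 \<le> dn x"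
  using K12 by (auto simp: X_def up_def dn_def)

lemma ac_W:
  assumes "- int K1 \<le> x" "x < int K1"
  shows "up x * sqrt (W x) = ac x * sqrt (W (x + 1))" "dn (x + 1) * sqrt (W (x + 1)) = ac x * sqrt (W x)"
proof -
  have p: "0 \<le> up x" "0 \<le> dn (x + 1)" using assms up_nonneg[of x] dn_nonneg[of "x + 1"] by (auto simp: X_def)
  note w = W_step[OF assms]
  have "up x * sqrt (W x) = sqrt (up x * (W x * up x))"
    using p by (simp add: real_sqrt_mult)
  also have "\<dots> = ac x * sqrt (W (x + 1))"
    unfolding w by (simp add: ac_def real_sqrt_mult)
  finally show "up x * sqrt (W x) = ac x * sqrt (W (x + 1))" .
  have "dn (x + 1) * sqrt (W (x + 1)) = sqrt (dn (x + 1) * (W (x + 1) * dn (x + 1)))"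
    using p by (simp add: real_sqrt_mult)
  also have "\<dots> = ac x * sqrt (W x)"
    unfolding w[symmetric] by (simp add: ac_def real_sqrt_mult)
  finally show "dn (x + 1) * sqrt (W (x + 1)) = ac x * sqrt (W x)" .
qed

text \<open>At the ends of \<open>X\<close> the formula mentions \<open>psi k\<close> outside
  \<open>X\<close>, where its value is meaningless, but there the coefficient \<open>ac\<close> is
  zero.\<close>

lemma psi_eigen:
  assumes k: "k \<le> 2 * K1" and x: "x \<in> X"
  shows "lam k * psi k x = ac x * psi k (x + 1) + ac (x - 1) * psi k (x - 1) - (up x + dn x) * psi k x"
proof -
  have a: "up x * (sqrt (W x) * y) = ac x * (sqrt (W (x + 1)) * y)" for y
  proof (cases "x < int K1")
    case True
    then show ?thesis using ac_W(1)[of x] x by (simp add: X_def mult.assoc[symmetric])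
  next
    case False
    then have "x = int K1" using x by (simp add: X_def)
    then show ?thesis by (simp add: up_def ac_def)
  qed
  have b: "dn x * (sqrt (W x) * y) = ac (x - 1) * (sqrt (W (x - 1)) * y)" for y
  proof (cases "x > - int K1")
    case True
    then show ?thesis using ac_W(2)[of "x - 1"] x by (simp add: X_def mult.assoc[symmetric])
  next
    case False
    then have "x = - int K1" using x by (simp add: X_def)
    then show ?thesis by (simp add: dn_def ac_def)
  qed
  have "lam k * psi k x = (up x * (sqrt (W x) * (q k (x + 1) / sqrt (h k))) + dn x * (sqrt (W x) * (q k (x - 1) / sqrt (h k))))
      - (up x + dn x) * psi k x"
  proof -
    have "lam k * psi k x = (lam k * q k x) * (sqrt (W x) / sqrt (h k))" by (simp add: psi_def)
    also have "\<dots> = (up x * (q k (x + 1) - q k x) + dn x * (q k (x - 1) - q k x)) * (sqrt (W x) / sqrt (h k))"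
      by (simp only: q_eigen[OF k])
    also have "\<dots> = (up x * (sqrt (W x) * (q k (x + 1) / sqrt (h k))) + dn x * (sqrt (W x) * (q k (x - 1) / sqrt (h k))))
      - (up x + dn x) * (q k x * (sqrt (W x) / sqrt (h k)))"
      by (simp add: algebra_simps add_divide_distrib)
    finally show ?thesis by (simp add: psi_def)
  qed
  also have "\<dots> = ac x * psi k (x + 1) + ac (x - 1) * psi k (x - 1) - (up x + dn x) * psi k x"
    unfolding a b by (simp add: psi_def mult_ac)
  finally show ?thesis .
qed

text \<open>The square of \<open>alternant n psi\<close> equals \<open>V\<close> divided by the
  product of the \<open>h k\<close>, so the total mass and the expected occupation of
  \<open>c\<close> come from \<open>sum_alternant_square\<close>.\<close>

lemma ensemble:
  assumes n: "n \<le> 2 * K1 + 1"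
  defines "V y \<equiv> (vprod n y)\<^sup>2 * (\<Prod>i<n. W (y i))"
  shows "(\<Sum>y\<in>{..<n} \<rightarrow>\<^sub>E X. V y) = fact n * (\<Prod>k<n. h k)"
    and "c \<in> X \<Longrightarrow> (\<Sum>y\<in>{..<n} \<rightarrow>\<^sub>E X. V y * (\<Sum>i<n. if y i = c then 1 else 0))
      = fact n * (\<Prod>k<n. h k) * (\<Sum>k<n. (psi k c)\<^sup>2)"
proof -
  have H: "(\<Prod>k<n. h k) > 0" using n h_pos by (intro prod_pos) auto
  have alt: "(alternant n psi y)\<^sup>2 * (\<Prod>k<n. h k) = V y" for y
  proof -
    have "alternant n psi y = alternant n q y * ((\<Prod>i<n. sqrt (W (y i))) / (\<Prod>k<n. sqrt (h k)))"
      unfolding alternant_def sum_distrib_right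
    proof (rule sum.cong[OF refl])
      fix p assume p: "p \<in> {p. p permutes {..<n}}"
      have "(\<Prod>i<n. sqrt (h (p i))) = (\<Prod>k<n. sqrt (h k))"
        using prod.permute[of p "{..<n}" "\<lambda>k. sqrt (h k)"] p by (simp add: o_def)
      then show "real_of_int (sign p) * (\<Prod>i<n. psi (p i) (y i)) =
        real_of_int (sign p) * (\<Prod>i<n. q (p i) (y i)) * ((\<Prod>i<n. sqrt (W (y i))) / (\<Prod>k<n. sqrt (h k)))"
        by (simp add: psi_def prod.distrib prod_dividef)
    qed
    moreover have "(\<Prod>k<n. sqrt (h k))\<^sup>2 = (\<Prod>k<n. h k)"
      unfolding prod_power_distrib using n h_pos by (intro prod.cong real_sqrt_pow2 less_imp_le) auto
    moreover have "(\<Prod>i<n. sqrt (W (y i)))\<^sup>2 = (\<Prod>i<n. W (y i))"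
      unfolding prod_power_distrib using W_pos by (intro prod.cong real_sqrt_pow2 less_imp_le) auto
    ultimately show ?thesis using H
      by (simp add: V_def alternant_q power_mult_distrib power_divide del: prod_pos_nat_iff prod_zero_iff)
  qed
  have orth: "(\<Sum>x\<in>X. psi j x * psi k x) = (if j = k then 1 else 0)" if "j < n" "k < n" for j k
    using psi_orth that n by simp
  show "(\<Sum>y\<in>{..<n} \<rightarrow>\<^sub>E X. V y) = fact n * (\<Prod>k<n. h k)"
    using sum_alternant_square(1)[of X n psi, OF finite_X orth]
    by (simp add: alt[symmetric] sum_distrib_right[symmetric])
  assume c: "c \<in> X"
  have "(\<Sum>y\<in>{..<n} \<rightarrow>\<^sub>E X. V y * (\<Sum>i<n. if y i = c then 1 else 0)) =
    (\<Sum>y\<in>{..<n} \<rightarrow>\<^sub>E X. (alternant n psi y)\<^sup>2 * (\<Sum>i<n. if y i = c then 1 else 0)) * (\<Prod>k<n. h k)"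
    unfolding alt[symmetric] sum_distrib_right by (simp add: mult_ac)
  also have "\<dots> = fact n * (\<Sum>k<n. (psi k c)\<^sup>2) * (\<Prod>k<n. h k)"
    using sum_alternant_square(2)[of X n psi c, OF finite_X orth c] by simp
  finally show "(\<Sum>y\<in>{..<n} \<rightarrow>\<^sub>E X. V y * (\<Sum>i<n. if y i = c then 1 else 0))
      = fact n * (\<Prod>k<n. h k) * (\<Sum>k<n. (psi k c)\<^sup>2)" by (simp add: mult_ac)
qed

end

subsection \<open>Chains of particle configurations\<close>

text \<open>Injectivity of \<open>f\<close> encodes that the paths do not meet; no enumeration of
  the particles is involved.\<close>

definition step :: "int set \<Rightarrow> int set \<Rightarrow> bool" where
  "step P Q \<longleftrightarrow> finite P \<and> (\<exists>f. bij_betw f P Q \<and> (\<forall>z\<in>P. f z = z \<or> f z = z + 1))"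

definition vdm :: "int set \<Rightarrow> real" where
  "vdm P = (\<Prod>a\<in>P. \<Prod>b\<in>{b\<in>P. b < a}. real_of_int (a - b))"

text \<open>The value off the support plays the role of a factorial of a negative number in the denominator.\<close>

definition bweight :: "nat \<Rightarrow> int \<Rightarrow> real" where
  "bweight N z = (if 0 \<le> z \<and> z < int N then 1 / (fact (nat z) * fact (N - 1 - nat z)) else 0)"

lemma step_finite: "step P Q \<Longrightarrow> finite Q"
  unfolding step_def using bij_betw_finite by blast

lemma step_card: "step P Q \<Longrightarrow> card Q = card P"
  unfolding step_def using bij_betw_same_card by metis

lemma finite_steps: "finite {P. step P Q}"
proof (cases "finite Q")
  case True
  have "{P. step P Q} \<subseteq> Pow (Q \<union> (\<lambda>z. z - 1) ` Q)"
  proof safe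
    fix P z assume "step P Q" "z \<in> P" and n: "z \<notin> (\<lambda>z. z - 1) ` Q"
    then obtain f where "f z \<in> Q" "f z = z \<or> f z = z + 1"
      unfolding step_def bij_betw_def by blast
    then show "z \<in> Q" using n by force
  qed
  then show ?thesis by (rule finite_subset) (use True in simp)
next
  case False
  then have "{P. step P Q} = {}" using step_finite by blast
  then show ?thesis by simp
qed

lemma vdm_enum:
  fixes y :: "nat \<Rightarrow> int"
  assumes "\<And>i j. i < j \<Longrightarrow> j < M \<Longrightarrow> y i < y j"
  shows "vdm (y ` {..<M}) = vprod M y"
proof -
  have lt: "y i < y j \<longleftrightarrow> i < j" if "i < M" "j < M" for i j
    using assms that by (metis linorder_neqE_nat order_less_asym)
  have inj: "inj_on y {..<M}"
    using lt by (intro inj_onI) (metis lessThan_iff linorder_neqE_nat order_less_irrefl)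
  have "vdm (y ` {..<M}) = (\<Prod>i<M. \<Prod>b\<in>{b\<in>y ` {..<M}. b < y i}. real_of_int (y i - b))"
    unfolding vdm_def by (subst prod.reindex[OF inj]) simp
  also have "\<dots> = (\<Prod>i<M. \<Prod>k<i. real_of_int (y i - y k))"
  proof (rule prod.cong[OF refl])
    fix i assume i: "i \<in> {..<M}"
    have "b \<in> y ` {..<i} \<longleftrightarrow> b \<in> y ` {..<M} \<and> b < y i" for b
    proof
      assume "b \<in> y ` {..<i}"
      then obtain k where "k < i" "b = y k" by blast
      then show "b \<in> y ` {..<M} \<and> b < y i" using lt[of k i] i by simp
    next
      assume "b \<in> y ` {..<M} \<and> b < y i"
      then obtain k where "k < M" "b = y k" "y k < y i" by blast
      then show "b \<in> y ` {..<i}" using lt[of k i] i by simp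
    qed
    then have "{b\<in>y ` {..<M}. b < y i} = y ` {..<i}" by blast
    moreover have "inj_on y {..<i}" by (rule inj_on_subset[OF inj]) (use i in auto)
    ultimately show "(\<Prod>b\<in>{b\<in>y ` {..<M}. b < y i}. real_of_int (y i - b)) = (\<Prod>k<i. real_of_int (y i - y k))"
      by (simp add: prod.reindex)
  qed
  finally show ?thesis by simp
qed

lemma vdm_pos: "finite P \<Longrightarrow> vdm P > 0"
  unfolding vdm_def by (intro prod_pos) auto

lemma vdm_reflect: "vdm ((\<lambda>z. c - z) ` P) = vdm P"
proof (cases "finite P")
  case True
  have pr: "vdm P = (\<Prod>(a,b)\<in>{(a,b). a \<in> P \<and> b \<in> P \<and> b < a}. real_of_int (a - b))" if "finite P" for P
  proof -
    have "vdm P = (\<Prod>(a,b)\<in>Sigma P (\<lambda>a. {b\<in>P. b < a}). real_of_int (a - b))"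
      unfolding vdm_def using that by (subst prod.Sigma) auto
    moreover have "Sigma P (\<lambda>a. {b\<in>P. b < a}) = {(a,b). a \<in> P \<and> b \<in> P \<and> b < a}" by auto
    ultimately show ?thesis by simp
  qed
  show ?thesis unfolding pr[OF True] pr[OF finite_imageI[OF True]]
    by (rule prod.reindex_bij_witness[where i = "\<lambda>(a,b). (c - b, c - a)" and j = "\<lambda>(a,b). (c - b, c - a)"]) auto
next
  case False
  moreover have "infinite ((\<lambda>z. c - z) ` P)" 
    using False by (subst finite_image_iff) (auto simp: inj_on_def)
  ultimately show ?thesis by (simp add: vdm_def)
qed

text \<open>Inside the support this is one factor of a factorial. At \<open>z = N\<close>,
  respectively \<open>z = 0\<close>, the left-hand weight is off its support and the explicit factor
  on the right is zero.\<close>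

lemma bweight_Suc: "bweight N z = (real N - z) * bweight (Suc N) z" 
  and bweight_Suc': "bweight N (z - 1) = z * bweight (Suc N) z"
proof -
  have "bweight N z = (real N - z) * bweight (Suc N) z" if "0 \<le> z" "z < int N"
  proof -
    have "N - nat z = Suc (N - 1 - nat z)" "real (N - nat z) = real N - z" using that by auto
    then have "fact (N - nat z) = (real N - z) * (fact (N - 1 - nat z) :: real)"
      by (metis fact_Suc of_nat_fact of_nat_mult)
    moreover have "real N - z \<noteq> 0" using that by linarith
    ultimately show ?thesis using that by (simp add: bweight_def)
  qed
  then show "bweight N z = (real N - z) * bweight (Suc N) z"
    by (cases "0 \<le> z \<and> z < int N"; cases "z = int N") (auto simp: bweight_def)
  have "bweight N (z - 1) = z * bweight (Suc N) z" if "0 < z" "z \<le> int N"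
  proof -
    have 1: "nat z = Suc (nat (z - 1))" "real (nat z) = z" using that by auto
    have "fact (nat z) = z * (fact (nat (z - 1)) :: real)"
      using 1 by (metis fact_Suc of_nat_fact of_nat_mult)
    moreover have "N - 1 - nat (z - 1) = N - nat z" using that by auto
    ultimately show ?thesis using that by (simp add: bweight_def)
  qed
  then show "bweight N (z - 1) = z * bweight (Suc N) z"
    by (cases "0 < z \<and> z \<le> int N"; cases "z = 0") (auto simp: bweight_def)
qed

text \<open>The position \<open>z\<close> has the predecessors \<open>z\<close> and
  \<open>z - 1\<close>. Their contributions carry the factors \<open>N - z\<close> and
  \<open>z - j\<close>, whose sum no longer depends on \<open>z\<close>: one step multiplies degree
  \<open>j\<close> by \<open>N - j\<close>.\<close>

lemma bweight_ffact:
  "bweight N z * ffact z j + bweight N (z - 1) * ffact (z - 1) j = (real N - real j) * bweight (Suc N) z * ffact z j"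
proof -
  have "z * ffact (real_of_int z - 1) j = (z - real j) * ffact z j"
    using ffact_Suc[of z j] ffact_Suc'[of z j] by (simp add: mult.commute)
  then have "bweight N (z - 1) * ffact (z - 1) j = bweight (Suc N) z * ((z - real j) * ffact z j)"
    by (simp add: bweight_Suc')
  then show ?thesis by (simp add: bweight_Suc[of N z] algebra_simps)
qed

lemma strict_enum_unique:
  fixes x y :: "nat \<Rightarrow> int"
  assumes "\<And>i j. i < j \<Longrightarrow> j < M \<Longrightarrow> y i < y j" "\<And>i j. i < j \<Longrightarrow> j < M \<Longrightarrow> x i < x j"
    and "y ` {..<M} = x ` {..<M}" and "i < M"
  shows "y i = x i"
proof -
  have "map y [0..<M] = map x [0..<M]"
    by (rule strict_sorted_equal)
       (use assms(1-3) in \<open>auto simp: sorted_wrt_iff_nth_less atLeast0LessThan\<close>)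
  then show ?thesis using assms(4) by simp
qed

lemma enum_exists:
  assumes "finite P"
  obtains y :: "nat \<Rightarrow> int" where "\<And>i j. i < j \<Longrightarrow> j < card P \<Longrightarrow> y i < y j" "y ` {..<card P} = P"
proof
  let ?l = "sorted_list_of_set P"
  show "?l ! i < ?l ! j" if "i < j" "j < card P" for i j
    using that strict_sorted_list_of_set[of P] by (simp add: sorted_wrt_iff_nth_less)
  show "(!) ?l ` {..<card P} = P"
  proof -
    have "(!) ?l ` {..<card P} = set ?l"
      by (auto simp: set_conv_nth image_iff)
    then show ?thesis using assms by simp
  qed
qed

text \<open>Unit moves cannot reverse the order of two integers, and injectivity excludes ties;
  hence a predecessor is the same increasing enumeration lowered by zeros and ones, subject to
  remaining strictly increasing.\<close>

lemma steps_into: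
  fixes y :: "nat \<Rightarrow> int"
  assumes mono: "\<And>i j. i < j \<Longrightarrow> j < M \<Longrightarrow> y i < y j"
  shows "bij_betw (\<lambda>e. (\<lambda>i. y i - e i) ` {..<M})
     {e \<in> {..<M} \<rightarrow>\<^sub>E {0,1}. \<forall>i j. i < j \<longrightarrow> j < M \<longrightarrow> y i - e i < y j - e j} {Q. step Q (y ` {..<M})}"
proof (rule bij_betw_imageI)
  let ?E = "{e \<in> {..<M} \<rightarrow>\<^sub>E {0,1::int}. \<forall>i j. i < j \<longrightarrow> j < M \<longrightarrow> y i - e i < y j - e j}"
  have inj: "inj_on y {..<M}"
    using mono by (intro inj_onI) (metis lessThan_iff linorder_neqE_nat order_less_irrefl)
  show "inj_on (\<lambda>e. (\<lambda>i. y i - e i) ` {..<M}) ?E"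
  proof (rule inj_onI)
    fix d e assume d: "d \<in> ?E" and e: "e \<in> ?E" and eq: "(\<lambda>i. y i - d i) ` {..<M} = (\<lambda>i. y i - e i) ` {..<M}"
    have "y i - d i = y i - e i" if "i < M" for i
      by (rule strict_enum_unique[OF _ _ eq that]) (use d e in auto)
    then have "d i = e i" if "i < M" for i using that by force
    moreover have "d i = e i" if "\<not> i < M" for i using d e that by (auto simp: PiE_iff extensional_def)
    ultimately show "d = e" by blast
  qed
  show "(\<lambda>e. (\<lambda>i. y i - e i) ` {..<M}) ` ?E = {Q. step Q (y ` {..<M})}"
  proof (intro equalityI subsetI)
    fix Q assume "Q \<in> (\<lambda>e. (\<lambda>i. y i - e i) ` {..<M}) ` ?E"
    then obtain e where e: "e \<in> ?E" and Q: "Q = (\<lambda>i. y i - e i) ` {..<M}" by auto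
    have inj': "inj_on (\<lambda>i. y i - e i) {..<M}"
      using e by (intro inj_onI) (metis (no_types, lifting) lessThan_iff linorder_neqE_nat mem_Collect_eq order_less_irrefl)
    define f where "f z = y (the_inv_into {..<M} (\<lambda>i. y i - e i) z)" for z
    have f: "f (y i - e i) = y i" if "i < M" for i
      using that the_inv_into_f_f[OF inj', of i] by (simp add: f_def)
    have "bij_betw f Q (y ` {..<M})"
    proof (rule bij_betw_imageI)
      show "inj_on f Q" unfolding Q using inj f by (auto intro!: inj_onI dest: inj_onD)
      show "f ` Q = y ` {..<M}" unfolding Q image_image using f by auto
    qed
    moreover have "\<forall>z\<in>Q. f z = z \<or> f z = z + 1"
    proof
      fix z assume "z \<in> Q"
      then obtain i where i: "i < M" "z = y i - e i" unfolding Q by auto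
      moreover have "e i \<in> {0,1}" using e i(1) by (auto simp: PiE_iff)
      ultimately show "f z = z \<or> f z = z + 1" using f[of i] by auto
    qed
    ultimately show "Q \<in> {Q. step Q (y ` {..<M})}" unfolding step_def Q by auto
  next
    fix Q assume "Q \<in> {Q. step Q (y ` {..<M})}"
    then obtain f where f: "bij_betw f Q (y ` {..<M})" "\<forall>z\<in>Q. f z = z \<or> f z = z + 1"
      unfolding step_def by auto
    define g where "g = the_inv_into Q f"
    have g: "g (y i) \<in> Q" "f (g (y i)) = y i" if "i < M" for i
      using that f(1) unfolding g_def bij_betw_def 
      by (auto intro!: the_inv_into_into f_the_inv_into_f)
    have gb: "bij_betw g (y ` {..<M}) Q" unfolding g_def by (rule bij_betw_the_inv_into[OF f(1)])
    define e where "e = restrict (\<lambda>i. y i - g (y i)) {..<M}"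
    have e01: "y i - g (y i) \<in> {0, 1}" if "i < M" for i
      using g[OF that] f(2) by force
    have ge: "y i - e i = g (y i)" if "i < M" for i using that by (simp add: e_def)
    have "y i - e i < y j - e j" if "i < j" "j < M" for i j
    proof -
      have "g (y i) \<le> g (y j)" using e01[of i] e01[of j] mono[OF that] that by auto
      moreover have "g (y i) \<noteq> g (y j)"
        using g(2)[of i] g(2)[of j] mono[OF that] that by force
      ultimately show ?thesis using ge[of i] ge[of j] that by auto
    qed
    then have "e \<in> ?E" using e01 by (auto simp: e_def)
    moreover have "Q = (\<lambda>i. y i - e i) ` {..<M}"
    proof -
      have "Q = (\<lambda>i. g (y i)) ` {..<M}" using gb by (simp add: bij_betw_def image_image)
      also have "\<dots> = (\<lambda>i. y i - e i) ` {..<M}" using ge by (intro image_cong) auto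
      finally show ?thesis .
    qed
    ultimately show "Q \<in> (\<lambda>e. (\<lambda>i. y i - e i) ` {..<M}) ` ?E" by blast
  qed
qed

text \<open>With the Vandermonde product expanded in falling factorials, the sum over
  \<open>e\<close> factors over the particles. By \<open>bweight_ffact\<close> particle
  \<open>i\<close> yields \<open>N - p i\<close>, and the product of these is the same for every
  permutation \<open>p\<close>.\<close>

lemma vandermonde_shift_sum:
  fixes y :: "nat \<Rightarrow> int"
  shows "(\<Sum>e\<in>{..<M} \<rightarrow>\<^sub>E {0,1}. vprod M (\<lambda>i. y i - e i) * (\<Prod>i<M. bweight N (y i - e i)))
   = (\<Prod>j<M. real N - real j) * (vprod M y * (\<Prod>i<M. bweight (Suc N) (y i)))"
proof -
  let ?P = "{p. p permutes {..<M}}"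
  have alt: "vprod M u = alternant M (\<lambda>j x. ffact x j) (\<lambda>i. real_of_int (u i))" for u
  proof -
    have "alternant M (\<lambda>j x. \<Sum>k\<le>j. (if k = j then 1 else 0) * ffact x k) (\<lambda>i. real_of_int (u i))
      = vprod M u" by (rule alternant_ffact) simp
    moreover have "(\<Sum>k\<le>j. (if k = j then 1 else 0) * ffact x k) = ffact x j" for j x
    proof -
      have "(\<Sum>k\<le>j. (if k = j then 1 else 0) * ffact x k) = (\<Sum>k\<le>j. if k = j then ffact x k else 0)"
        by (intro sum.cong) auto
      then show ?thesis by simp
    qed
    ultimately show ?thesis by simp
  qed
  have "(\<Sum>e\<in>{..<M} \<rightarrow>\<^sub>E {0,1}. alternant M (\<lambda>j x. ffact x j) (\<lambda>i. real_of_int (y i - e i)) * (\<Prod>i<M. bweight N (y i - e i)))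
    = (\<Sum>p\<in>?P. of_int (sign p) * (\<Sum>e\<in>{..<M} \<rightarrow>\<^sub>E {0,1}. \<Prod>i<M. bweight N (y i - e i) * ffact (y i - e i) (p i)))"
    unfolding alternant_def sum_distrib_right sum_distrib_left
    by (subst sum.swap) (simp add: prod.distrib mult_ac)
  also have "\<dots> = (\<Sum>p\<in>?P. of_int (sign p) * (\<Prod>i<M. \<Sum>e\<in>{0,1}. bweight N (y i - e) * ffact (y i - e) (p i)))"
  proof (intro sum.cong refl arg_cong2[where f = "(*)"])
    fix p
    show "(\<Sum>e\<in>{..<M} \<rightarrow>\<^sub>E {0,1}. \<Prod>i<M. bweight N (y i - e i) * ffact (y i - e i) (p i)) =
      (\<Prod>i<M. \<Sum>e\<in>{0,1}. bweight N (y i - e) * ffact (y i - e) (p i))"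
      by (subst prod_sum_PiE) auto
  qed
  also have "\<dots> = (\<Sum>p\<in>?P. of_int (sign p) * (\<Prod>i<M. (real N - real (p i)) * bweight (Suc N) (y i) * ffact (y i) (p i)))"
    using bweight_ffact[of N] by simp
  also have "\<dots> = (\<Sum>p\<in>?P. (\<Prod>j<M. real N - real j) * (\<Prod>i<M. bweight (Suc N) (y i)) * (of_int (sign p) * (\<Prod>i<M. ffact (y i) (p i))))"
  proof (rule sum.cong[OF refl])
    fix p assume "p \<in> ?P"
    then have "(\<Prod>i<M. real N - real (p i)) = (\<Prod>j<M. real N - real j)"
      using prod.permute[of p "{..<M}" "\<lambda>j. real N - real j"] by (simp add: o_def)
    then show "of_int (sign p) * (\<Prod>i<M. (real N - real (p i)) * bweight (Suc N) (y i) * ffact (y i) (p i)) =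
       (\<Prod>j<M. real N - real j) * (\<Prod>i<M. bweight (Suc N) (y i)) * (of_int (sign p) * (\<Prod>i<M. ffact (y i) (p i)))"
      by (simp add: prod.distrib)
  qed
  finally show ?thesis
    unfolding alt by (simp add: alternant_def sum_distrib_left mult_ac)
qed

text \<open>Each step reproduces the shape of the formula and contributes a positive factor to the
  constant, which is left implicit because it cancels in proportions.\<close>

lemma card_walks_step:
  "\<exists>C>0. \<forall>P. finite P \<longrightarrow> card P = M \<longrightarrow>
     real (card (walks step {0..<int M} P t)) = C * (vdm P * (\<Prod>z\<in>P. bweight (M + t) z))"
proof (induction t)
  case 0
  let ?w = "\<lambda>P. vdm P * (\<Prod>z\<in>P. bweight (M + 0) z)"
  have pos: "?w {0..<int M} > 0"
    by (intro mult_pos_pos vdm_pos prod_pos) (auto simp: bweight_def)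
  have "real (card (walks step {0..<int M} P 0)) = 1 / ?w {0..<int M} * ?w P"
    if P: "finite P" "card P = M" for P
  proof (cases "P = {0..<int M}")
    case True
    have "1 / ?w P * ?w P = 1"
      unfolding True by (rule nonzero_eq_divide_eq[THEN iffD1, OF _ refl]) (use pos in linarith)
    then show ?thesis unfolding True by (simp only: walks_0) simp
  next
    case False
    \<comment> \<open>A set of \<open>M\<close> integers other than \<open>{0..<int M}\<close> has
      an element at which \<open>bweight M\<close> is zero, so the formula gives 0 for it.\<close>
    have "\<not> P \<subseteq> {0..<int M}"
    proof
      assume "P \<subseteq> {0..<int M}"
      then have "P = {0..<int M}" using P by (intro card_subset_eq) auto
      with False show False by simp
    qed
    then obtain z where "z \<in> P" "z \<notin> {0..<int M}" by blast
    then have "z \<in> P" "bweight M z = 0" by (auto simp: bweight_def)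
    then have "(\<Prod>z\<in>P. bweight M z) = 0" using P(1) by (intro prod_zero) auto
    then show ?thesis using False by (simp add: walks_0)
  qed
  then show ?case using pos by (intro exI[of _ "1 / ?w {0..<int M}"]) (simp only: zero_less_divide_1_iff, blast)
next
  case (Suc t)
  then obtain C where C: "C > 0" "\<And>P. finite P \<Longrightarrow> card P = M \<Longrightarrow>
     real (card (walks step {0..<int M} P t)) = C * (vdm P * (\<Prod>z\<in>P. bweight (M + t) z))" by blast
  have "real (card (walks step {0..<int M} P (Suc t))) = (C * (\<Prod>j<M. real (M + t) - real j)) * (vdm P * (\<Prod>z\<in>P. bweight (M + Suc t) z))"
    if P: "finite P" "card P = M" for P
  proof -
    obtain y where y: "\<And>i j. i < j \<Longrightarrow> j < M \<Longrightarrow> y i < (y j :: int)" "y ` {..<M} = P"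
      using enum_exists[OF P(1)] unfolding P(2) by blast
    let ?E = "{e \<in> {..<M} \<rightarrow>\<^sub>E {0,1}. \<forall>i j. i < j \<longrightarrow> j < M \<longrightarrow> y i - e i < y j - e j}"
    have enum: "vdm (z ` {..<M}) * (\<Prod>z\<in>z ` {..<M}. bweight N z) =
       vprod M z * (\<Prod>i<M. bweight N (z i))"
      if z: "\<And>i j. i < j \<Longrightarrow> j < M \<Longrightarrow> z i < z j" for z N
    proof -
      have "inj_on z {..<M}"
        using z by (intro inj_onI) (metis lessThan_iff linorder_neqE_nat order_less_irrefl)
      then show ?thesis by (simp add: vdm_enum[OF z] prod.reindex)
    qed
    have "real (card (walks step {0..<int M} P (Suc t))) = (\<Sum>Q | step Q P. real (card (walks step {0..<int M} Q t)))"
      by (subst card_walks_Suc[OF finite_steps]) simp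
    also have "\<dots> = (\<Sum>Q | step Q P. C * (vdm Q * (\<Prod>z\<in>Q. bweight (M + t) z)))"
    proof (intro sum.cong refl C(2))
      fix Q assume "Q \<in> {Q. step Q P}"
      then show "finite Q" "card Q = M" using P step_card[of Q P] by (simp_all add: step_def)
    qed
    also have "\<dots> = (\<Sum>e\<in>?E. C * (vdm ((\<lambda>i. y i - e i) ` {..<M}) * (\<Prod>z\<in>(\<lambda>i. y i - e i) ` {..<M}. bweight (M + t) z)))"
      using sum.reindex_bij_betw[OF steps_into[of M y, OF y(1)], where g = "\<lambda>Q. C * (vdm Q * (\<Prod>z\<in>Q. bweight (M + t) z))", symmetric]
      by (simp add: y(2))
    also have "\<dots> = (\<Sum>e\<in>?E. C * (vprod M (\<lambda>i. y i - e i) * (\<Prod>i<M. bweight (M + t) (y i - e i))))"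
      by (intro sum.cong refl arg_cong2[where f = "(*)"] enum) auto
    \<comment> \<open>Dropping the monotonicity constraint adds only choices for which two particles
      collide, and these have a zero Vandermonde product.\<close>
    also have "\<dots> = (\<Sum>e\<in>{..<M} \<rightarrow>\<^sub>E {0,1}. C * (vprod M (\<lambda>i. y i - e i) * (\<Prod>i<M. bweight (M + t) (y i - e i))))"
    proof (rule sum.mono_neutral_left)
      show "\<forall>e\<in>({..<M} \<rightarrow>\<^sub>E {0,1}) - ?E. C * (vprod M (\<lambda>i. y i - e i) * (\<Prod>i<M. bweight (M + t) (y i - e i))) = 0"
      proof
        fix e assume "e \<in> ({..<M} \<rightarrow>\<^sub>E {0,1}) - ?E"
        then obtain i j where e: "e \<in> {..<M} \<rightarrow>\<^sub>E {0,1}" and ij: "i < j" "j < M" "\<not> y i - e i < y j - e j" by auto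
        have "e i \<in> {0,1}" "e j \<in> {0,1}" using PiE_mem[OF e, of i] PiE_mem[OF e, of j] ij by simp_all
        then have "y i - e i = y j - e j" using y(1)[OF ij(1,2)] ij(3) by auto
        then have "vprod M (\<lambda>i. y i - e i) = 0"
          using ij by (intro prod_zero[OF finite_lessThan] bexI[of _ j] bexI[of _ i]) auto
        then show "C * (vprod M (\<lambda>i. y i - e i) * (\<Prod>i<M. bweight (M + t) (y i - e i))) = 0"
          by simp
      qed
    qed (auto intro!: finite_PiE)
    also have "\<dots> = C * ((\<Prod>j<M. real (M + t) - real j) * (vprod M y * (\<Prod>i<M. bweight (Suc (M + t)) (y i))))"
      by (subst vandermonde_shift_sum[symmetric]) (simp only: sum_distrib_left)
    also have "\<dots> = (C * (\<Prod>j<M. real (M + t) - real j)) * (vdm P * (\<Prod>z\<in>P. bweight (M + Suc t) z))"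
      using enum[of y "Suc (M + t)"] y by (simp add: mult_ac)
    finally show ?thesis .
  qed
  moreover have "C * (\<Prod>j<M. real (M + t) - real j) > 0"
    using C(1) by (intro mult_pos_pos prod_pos) auto
  ultimately show ?case by blast
qed

section \<open>From sets of particles to tuples\<close>

lemma prod_pairs_square:
  fixes g :: "'a::linorder \<Rightarrow> 'a \<Rightarrow> 'b::comm_semiring_1"
  assumes "finite A" and sym: "\<And>a b. g a b = g b a"
  shows "(\<Prod>a\<in>A. \<Prod>b\<in>{b\<in>A. b < a}. g a b)\<^sup>2 = (\<Prod>a\<in>A. \<Prod>b\<in>A - {a}. g a b)"
proof -
  have "(\<Prod>a\<in>A. \<Prod>b\<in>{b\<in>A. b < a}. g a b) = (\<Prod>(a,b)\<in>Sigma A (\<lambda>a. {b\<in>A. b < a}). g a b)"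
    using assms(1) by (subst prod.Sigma) auto
  also have "\<dots> = (\<Prod>(a,b)\<in>Sigma A (\<lambda>a. {b\<in>A. a < b}). g a b)"
    by (rule prod.reindex_bij_witness[where i = prod.swap and j = prod.swap]) (auto simp: sym)
  also have "\<dots> = (\<Prod>a\<in>A. \<Prod>b\<in>{b\<in>A. a < b}. g a b)"
    using assms(1) by (subst prod.Sigma) auto
  finally have "(\<Prod>a\<in>A. \<Prod>b\<in>{b\<in>A. b < a}. g a b)\<^sup>2 =
     (\<Prod>a\<in>A. (\<Prod>b\<in>{b\<in>A. b < a}. g a b) * (\<Prod>b\<in>{b\<in>A. a < b}. g a b))"
    by (simp add: power2_eq_square prod.distrib)
  also have "\<dots> = (\<Prod>a\<in>A. \<Prod>b\<in>A - {a}. g a b)"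
  proof (rule prod.cong[OF refl])
    fix a
    have "A - {a} = {b\<in>A. b < a} \<union> {b\<in>A. a < b}" by auto
    moreover have "{b\<in>A. b < a} \<inter> {b\<in>A. a < b} = {}" by auto
    ultimately show "(\<Prod>b\<in>{b\<in>A. b < a}. g a b) * (\<Prod>b\<in>{b\<in>A. a < b}. g a b) = (\<Prod>b\<in>A - {a}. g a b)"
      using assms(1) by (simp add: prod.union_disjoint)
  qed
  finally show ?thesis .
qed

text \<open>The square removes the sign that depends on the order of the tuple, and a repeated entry
  makes the product zero. So sums over sets of particles become sums over all tuples.\<close>

lemma vdm_tuple:
  fixes y :: "nat \<Rightarrow> int"
  shows "(vprod M y)\<^sup>2 =
    (if inj_on y {..<M} then (vdm (y ` {..<M}))\<^sup>2 else 0)"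
proof (cases "inj_on y {..<M}")
  case True
  have "(vprod M y)\<^sup>2
    = (\<Prod>i<M. \<Prod>k\<in>{k\<in>{..<M}. k < i}. \<bar>real_of_int (y i - y k)\<bar>)\<^sup>2"
  proof -
    have "{k. k < M \<and> k < i} = {..<i}" if "i < M" for i using that by auto
    then have "(\<Prod>i<M. \<Prod>k\<in>{k\<in>{..<M}. k < i}. \<bar>real_of_int (y i - y k)\<bar>) = \<bar>\<Prod>i<M. \<Prod>k<i. real_of_int (y i) - real_of_int (y k)\<bar>"
      by (simp add: abs_prod)
    then show ?thesis by simp
  qed
  also have "\<dots> = (\<Prod>i<M. \<Prod>k\<in>{..<M} - {i}. \<bar>real_of_int (y i - y k)\<bar>)"
    by (rule prod_pairs_square) auto
  also have "\<dots> = (\<Prod>a\<in>y ` {..<M}. \<Prod>b\<in>y ` {..<M} - {a}. \<bar>real_of_int (a - b)\<bar>)"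
  proof -
    have "(\<Prod>b\<in>y ` {..<M} - {y i}. \<bar>real_of_int (y i - b)\<bar>) = (\<Prod>k\<in>{..<M} - {i}. \<bar>real_of_int (y i - y k)\<bar>)"
      if "i < M" for i
    proof -
      have "y ` {..<M} - {y i} = y ` ({..<M} - {i})" using True that by (auto dest: inj_onD)
      moreover have "inj_on y ({..<M} - {i})" using True by (rule inj_on_subset) auto
      ultimately show ?thesis by (simp add: prod.reindex)
    qed
    then show ?thesis by (simp add: prod.reindex[OF True])
  qed
  also have "\<dots> = (\<Prod>a\<in>y ` {..<M}. \<Prod>b\<in>{b\<in>y ` {..<M}. b < a}. \<bar>real_of_int (a - b)\<bar>)\<^sup>2"
    by (rule prod_pairs_square[symmetric]) auto
  also have "\<dots> = (vdm (y ` {..<M}))\<^sup>2"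
    unfolding vdm_def by (intro arg_cong[where f = "\<lambda>x. x\<^sup>2"] prod.cong refl) auto
  finally show ?thesis using True by simp
next
  case False
  then obtain i k where ik: "i < M" "k < i" "y i = y k"
    unfolding inj_on_def by (metis lessThan_iff linorder_neqE_nat)
  then have "vprod M y = 0"
    by (intro prod_zero[OF finite_lessThan] bexI[of _ i] bexI[of _ k]) auto
  then show ?thesis using False by simp
qed

lemma vdm_shift: "vdm ((\<lambda>z. z + c) ` P) = vdm P"
  using vdm_reflect[of c "(\<lambda>z. 0 - z) ` P"] vdm_reflect[of 0 P] by (simp add: image_image add.commute)

lemma card_inj_tuples:
  assumes "finite P" "card P = M"
  shows "card {y \<in> {..<M} \<rightarrow>\<^sub>E P. inj_on y {..<M}} = fact M"
  using card_inj_on_subset_funcset[of "{..<M}" P "{..<M}"] assms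
  by (simp add: fact_prod_rev atLeast0LessThan)

lemma sum_inj_tuples:
  fixes F :: "'a set \<Rightarrow> real"
  assumes X: "finite X"
  shows "(\<Sum>y\<in>{..<M} \<rightarrow>\<^sub>E X. if inj_on y {..<M} then F (y ` {..<M}) else 0) = fact M * (\<Sum>P | P \<subseteq> X \<and> card P = M. F P)"
proof -
  let ?T = "{y \<in> {..<M} \<rightarrow>\<^sub>E X. inj_on y {..<M}}" and ?S = "{P. P \<subseteq> X \<and> card P = M}"
  have fin: "finite ({..<M} \<rightarrow>\<^sub>E X)" using X by (intro finite_PiE) auto
  have "(\<Sum>y\<in>{..<M} \<rightarrow>\<^sub>E X. if inj_on y {..<M} then F (y ` {..<M}) else 0) = (\<Sum>y\<in>?T. F (y ` {..<M}))"
    using fin by (simp add: sum.inter_filter)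
  also have "\<dots> = (\<Sum>P\<in>?S. \<Sum>y\<in>{y \<in> ?T. y ` {..<M} = P}. F (y ` {..<M}))"
  proof (rule sum.group[symmetric])
    show "finite ?T" using fin by simp
    show "finite ?S" using X by simp
    show "(\<lambda>y. y ` {..<M}) ` ?T \<subseteq> ?S" by (auto simp: card_image PiE_iff)
  qed
  also have "\<dots> = (\<Sum>P\<in>?S. fact M * F P)"
  proof (rule sum.cong[OF refl])
    fix P assume P: "P \<in> ?S"
    then have "finite P" using X finite_subset by auto
    have "{y \<in> ?T. y ` {..<M} = P} = {y \<in> {..<M} \<rightarrow>\<^sub>E P. inj_on y {..<M}}"
    proof (intro equalityI subsetI)
      fix y assume y: "y \<in> {y \<in> {..<M} \<rightarrow>\<^sub>E P. inj_on y {..<M}}"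
      then have "y ` {..<M} \<subseteq> P" "card (y ` {..<M}) = M" by (auto simp: card_image PiE_iff)
      then have "y ` {..<M} = P" using P \<open>finite P\<close> by (intro card_subset_eq) auto
      then show "y \<in> {y \<in> ?T. y ` {..<M} = P}" using y P by (auto simp: PiE_iff)
    qed (auto simp: PiE_iff)
    then have "(\<Sum>y\<in>{y \<in> ?T. y ` {..<M} = P}. F (y ` {..<M})) = (\<Sum>y\<in>{y \<in> {..<M} \<rightarrow>\<^sub>E P. inj_on y {..<M}}. F P)"
      by (intro sum.cong) auto
    also have "\<dots> = fact M * F P"
      using card_inj_tuples[OF \<open>finite P\<close>, of M] P by simp
    finally show "(\<Sum>y\<in>{y \<in> ?T. y ` {..<M} = P}. F (y ` {..<M})) = fact M * F P" .
  qed
  finally show ?thesis by (simp add: sum_distrib_left)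
qed

section \<open>Gluing the two halves of a chain at an intermediate line\<close>

lemma step_reflect: "step P Q \<Longrightarrow> step ((\<lambda>z. c - z) ` Q) ((\<lambda>z. c - z) ` P)"
proof -
  assume s: "step P Q"
  then obtain f where P: "finite P" and f: "bij_betw f P Q" "\<And>z. z \<in> P \<Longrightarrow> f z = z \<or> f z = z + 1"
    unfolding step_def by blast
  let ?r = "\<lambda>z. c - z" and ?g = "the_inv_into P f"
  have g: "bij_betw ?g Q P" by (rule bij_betw_the_inv_into[OF f(1)])
  have r: "bij_betw ?r A (?r ` A)" for A by (auto simp: bij_betw_def inj_on_def)
  have r': "bij_betw ?r (?r ` A) A" for A by (auto simp: bij_betw_def inj_on_def image_image)
  have "bij_betw (?r \<circ> (?g \<circ> ?r)) (?r ` Q) (?r ` P)"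
    by (rule bij_betw_trans[OF bij_betw_trans[OF r' g] r])
  moreover have "(?r \<circ> (?g \<circ> ?r)) z = z \<or> (?r \<circ> (?g \<circ> ?r)) z = z + 1" if "z \<in> ?r ` Q" for z
  proof -
    have "c - z \<in> Q" using that by auto
    then have "f (?g (c - z)) = c - z" "?g (c - z) \<in> P"
      using f(1) g by (auto simp: bij_betw_def f_the_inv_into_f)
    then show ?thesis using f(2)[of "?g (c - z)"] by auto
  qed
  ultimately show ?thesis unfolding step_def using step_finite[OF s] by blast
qed

lemma bweight_centred:
  "bweight (2 * K + 1) (int K + x) =
     (if \<bar>x\<bar> \<le> int K then 1 / (fact (nat (int K + x)) * fact (nat (int K - x))) else 0)"
proof -
  have "2 * K - nat (int K + x) = nat (int K - x)" if "\<bar>x\<bar> \<le> int K" using that by auto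
  then show ?thesis by (auto simp: bweight_def)
qed

text \<open>The reflected weight of the right half is centred where the left one is, since
  \<open>int (n + M) - 1 - z = int K' - (z - int K)\<close>; the product lives on the shorter of the
  two supports.\<close>

lemma bweight_product:
  assumes "2 * K + 1 = M + t" "2 * K' + 1 = M + s" "s + t = 2 * n"
  shows "bweight (M + t) z * bweight (M + s) (int (n + M) - 1 - z) =
    (if z - int K \<in> hahn.X (min K K') then hahn.W (min K K') (max K K') (z - int K) else 0)"
proof -
  interpret hahn "min K K'" "max K K'" by unfold_locales simp
  define x where "x = z - int K"
  have 1: "bweight (M + t) z = bweight (2 * K + 1) (int K + x)"
    using assms by (simp add: x_def)
  have "int (n + M) - 1 - z = int K' + (- x)" using assms by (auto simp: x_def)
  then have 2: "bweight (M + s) (int (n + M) - 1 - z) = bweight (2 * K' + 1) (int K' + (- x))"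
    using assms by simp
  show ?thesis
    unfolding 1 2 bweight_centred x_def[symmetric] X_def W_def
    by (cases "K \<le> K'") (auto simp: min_def max_def mult_ac)
qed

abbreviation occupation :: "nat \<Rightarrow> nat \<Rightarrow> nat \<Rightarrow> real" where
  "occupation K K' M \<equiv> \<Sum>k<M. (hahn.psi (min K K') (max K K') k 0)\<^sup>2"

text \<open>By \<open>2 * K + 1 = M + t\<close>, \<open>K\<close> is the middle one of the
  \<open>M + t\<close> positions carrying weight on line \<open>t\<close>. Each half of the chain
  contributes one Vandermonde factor, hence the square in the ensemble.\<close>

lemma occupation_probability:
  fixes M s t n K K' :: nat
  assumes K: "2 * K + 1 = M + t" and K': "2 * K' + 1 = M + s" and st: "s + t = 2 * n" "0 < s" "0 < t"
  defines "S \<equiv> walks step {0..<int M} {int n..<int n + int M} (2 * n)"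
  shows "real (card {f \<in> S. int K \<notin> f t}) / real (card S) = 1 - occupation K K' M"
proof -
  interpret hahn "min K K'" "max K K'" by unfold_locales simp
  let ?a = "{0..<int M}" and ?b = "{int n..<int n + int M}"
  let ?r = "\<lambda>P. (\<lambda>z. (int (n + M) - 1) - z) ` P"
  let ?s = "\<lambda>P. (\<lambda>z. z + int K) ` P"
  have rr: "?r (?r P) = P" for P by (simp add: image_image)
  have rb: "?r ?b = ?a"
  proof
    show "?a \<subseteq> ?r ?b"
    proof
      fix z assume "z \<in> ?a"
      then have "z = (int (n + M) - 1) - ((int (n + M) - 1) - z)" "(int (n + M) - 1) - z \<in> ?b" by auto
      then show "z \<in> ?r ?b" by blast
    qed
  qed auto
  have rev: "card (walks step P ?b s) = card (walks step ?a (?r P) s)" for P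
    using card_walks_reverse[of ?r step P ?b s, OF rr step_reflect] unfolding rb .
  obtain C where C: "C > 0" "\<And>P. finite P \<Longrightarrow> card P = M \<Longrightarrow>
     real (card (walks step ?a P t)) = C * (vdm P * (\<Prod>z\<in>P. bweight (M + t) z))"
    using card_walks_step[of M t] by blast
  obtain D where D: "D > 0" "\<And>P. finite P \<Longrightarrow> card P = M \<Longrightarrow>
     real (card (walks step ?a P s)) = D * (vdm P * (\<Prod>z\<in>P. bweight (M + s) z))"
    using card_walks_step[of M s] by blast
  have S: "S = walks step ?a ?b (t + s)" using st by (simp add: S_def add.commute)
  define wt where "wt P = (\<Prod>z\<in>P. if z - int K \<in> X then W (z - int K) else 0)" for P
  have through: "real (card (walks step ?a P t) * card (walks step P ?b s)) = C * D * ((vdm P)\<^sup>2 * wt P)"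
    if P: "finite P" "card P = M" for P
  proof -
    have inj: "inj_on (\<lambda>z. (int (n + M) - 1) - z) P" by (auto simp: inj_on_def)
    have "real (card (walks step P ?b s)) = D * (vdm P * (\<Prod>z\<in>P. bweight (M + s) (int (n + M) - 1 - z)))"
      unfolding rev using D(2)[of "?r P"] P inj by (simp add: card_image vdm_reflect prod.reindex)
    moreover have "wt P = (\<Prod>z\<in>P. bweight (M + t) z) * (\<Prod>z\<in>P. bweight (M + s) (int (n + M) - 1 - z))"
      unfolding wt_def prod.distrib[symmetric] bweight_product[OF K K' st(1)] ..
    ultimately show ?thesis using C(2)[OF P] by (simp add: power2_eq_square)
  qed
  define T where "T = {P. P \<subseteq> ?s X \<and> card P = M}"
  have finT: "finite T" unfolding T_def by (rule finite_subset[of _ "Pow (?s X)"]) auto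
  have finS: "finite S" unfolding S by (rule finite_walks[OF finite_steps])
  have walk_card: "finite (f i) \<and> card (f i) = M" if f: "f \<in> S" and i: "i \<le> t + s" for f i
    using i
  proof (induction i)
    case 0
    then show ?case using walksD(1)[OF f[unfolded S]] by simp
  next
    case (Suc i)
    then have "step (f i) (f (Suc i))" using walksD(2)[OF f[unfolded S], of i] by simp
    then show ?case using Suc step_card step_finite by simp
  qed
  \<comment> \<open>\<open>card_walks_sum\<close> requires all configurations reached on line
    \<open>t\<close>; those outside \<open>T\<close> are discarded afterwards, because
    \<open>wt\<close> vanishes on them.\<close>
  define U where "U = (\<lambda>f. f t) ` S \<union> T"
  have finU: "finite U" using finT finS by (simp add: U_def)
  have U: "finite P \<and> card P = M" if "P \<in> U" for P
  proof -
    have "finite P" if "P \<in> T" for P using that finite_subset[of P "?s X"] by (auto simp: T_def)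
    then show ?thesis using that walk_card[of _ t] by (auto simp: U_def T_def)
  qed
  have count: "real (card {f \<in> S. Q (f t)}) = C * D / fact M * (\<Sum>y\<in>{..<M} \<rightarrow>\<^sub>E X.
      (vprod M y)\<^sup>2 * (\<Prod>i<M. W (y i)) * (if Q (?s (y ` {..<M})) then 1 else 0))" for Q
  proof -
    have "real (card {f \<in> S. Q (f t)}) = (\<Sum>P | P \<in> U \<and> Q P. real (card (walks step ?a P t) * card (walks step P ?b s)))"
      unfolding S using finU by (subst card_walks_sum[OF finite_steps, where C = U]) (auto simp: U_def S)
    also have "\<dots> = (\<Sum>P | P \<in> U \<and> Q P. C * D * ((vdm P)\<^sup>2 * wt P))"
      using U by (intro sum.cong refl through) auto
    also have "\<dots> = (\<Sum>P | P \<in> T \<and> Q P. C * D * ((vdm P)\<^sup>2 * wt P))"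
    proof (rule sum.mono_neutral_right)
      show "\<forall>P\<in>{P \<in> U. Q P} - {P \<in> T. Q P}. C * D * ((vdm P)\<^sup>2 * wt P) = 0"
      proof
        fix P assume P: "P \<in> {P \<in> U. Q P} - {P \<in> T. Q P}"
        then have "\<not> P \<subseteq> ?s X" "finite P" using U by (auto simp: T_def)
        then obtain z where z: "z \<in> P" "z \<notin> ?s X" by auto
        then have "z - int K \<notin> X" by force
        then have "wt P = 0" unfolding wt_def using z \<open>finite P\<close> by (intro prod_zero) auto
        then show "C * D * ((vdm P)\<^sup>2 * wt P) = 0" by simp
      qed
    qed (use finU in \<open>auto simp: U_def\<close>)
    also have "\<dots> = (\<Sum>P\<in>T. C * D * ((vdm P)\<^sup>2 * wt P) * (if Q P then 1 else 0))"
      using finT by (simp add: sum.inter_filter if_distrib cong: if_cong)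
    also have "\<dots> = (\<Sum>P | P \<subseteq> X \<and> card P = M. C * D * ((vdm (?s P))\<^sup>2 * wt (?s P)) * (if Q (?s P) then 1 else 0))"
    proof (rule sum.reindex_bij_witness[where i = ?s and j = "\<lambda>P. (\<lambda>z. z - int K) ` P"])
      fix P assume "P \<in> T"
      then show "(\<lambda>z. z - int K) ` P \<in> {P. P \<subseteq> X \<and> card P = M}"
        by (auto simp: T_def card_image inj_on_def)
    next
      fix P assume "P \<in> {P. P \<subseteq> X \<and> card P = M}"
      then show "?s P \<in> T" by (auto simp: T_def card_image inj_on_def)
    qed (simp_all add: image_image)
    also have "\<dots> = C * D * (\<Sum>P | P \<subseteq> X \<and> card P = M. (vdm P)\<^sup>2 * (\<Prod>z\<in>P. W z) * (if Q (?s P) then 1 else 0))"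
      unfolding sum_distrib_left
    proof (intro sum.cong refl)
      fix P assume P: "P \<in> {P. P \<subseteq> X \<and> card P = M}"
      have "wt (?s P) = (\<Prod>z\<in>P. if z \<in> X then W z else 0)"
        unfolding wt_def by (subst prod.reindex) (auto simp: inj_on_def intro!: prod.cong)
      also have "\<dots> = (\<Prod>z\<in>P. W z)" using P by (intro prod.cong) auto
      finally show "C * D * ((vdm (?s P))\<^sup>2 * wt (?s P)) * (if Q (?s P) then 1 else 0) =
         C * D * ((vdm P)\<^sup>2 * (\<Prod>z\<in>P. W z) * (if Q (?s P) then 1 else 0))" by (simp add: vdm_shift)
    qed
    also have "\<dots> = C * D / fact M * (\<Sum>y\<in>{..<M} \<rightarrow>\<^sub>E X. if inj_on y {..<M} then
        (vdm (y ` {..<M}))\<^sup>2 * (\<Prod>z\<in>y ` {..<M}. W z) * (if Q (?s (y ` {..<M})) then 1 else 0) else 0)"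
      by (subst sum_inj_tuples) auto
    also have "\<dots> = C * D / fact M * (\<Sum>y\<in>{..<M} \<rightarrow>\<^sub>E X.
      (vprod M y)\<^sup>2 * (\<Prod>i<M. W (y i)) * (if Q (?s (y ` {..<M})) then 1 else 0))"
      unfolding vdm_tuple
      by (intro arg_cong2[where f = "(*)"] sum.cong refl) (simp add: prod.reindex)
    finally show ?thesis .
  qed
  \<comment> \<open>Since \<open>s\<close> and \<open>t\<close> are positive, there are no more
    particles than points in \<open>X\<close>, as \<open>ensemble\<close> requires.\<close>
  have M: "M \<le> 2 * min K K' + 1" using K K' st by auto
  have H: "(\<Prod>k<M. h k) > 0" using M h_pos by (intro prod_pos) auto
  have total: "real (card S) = C * D * (\<Prod>k<M. h k)"
    using count[of "\<lambda>_. True"] ensemble(1)[OF M] by simp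
  have occ: "real (card {f \<in> S. int K \<in> f t}) = C * D * (\<Prod>k<M. h k) * (\<Sum>k<M. (psi k 0)\<^sup>2)"
  proof -
    have eq: "(vprod M y)\<^sup>2 * (\<Prod>i<M. W (y i)) * (if int K \<in> ?s (y ` {..<M}) then 1 else 0)
      = (vprod M y)\<^sup>2 * (\<Prod>i<M. W (y i)) * (\<Sum>i<M. if y i = 0 then 1 else 0)" for y
    proof (cases "inj_on y {..<M}")
      case False
      then show ?thesis using vdm_tuple[of y M] by simp
    next
      case True
      have "(\<Sum>i<M. if y i = 0 then 1 else 0) = (\<Sum>z\<in>y ` {..<M}. if z = 0 then 1 else (0::real))"
        by (simp add: sum.reindex[OF True])
      also have "\<dots> = (if int K \<in> ?s (y ` {..<M}) then 1 else 0)"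
        by (auto simp: image_image)
      finally show ?thesis by simp
    qed
    have "0 \<in> X" by (simp add: X_def)
    then show ?thesis
      unfolding count[of "\<lambda>P. int K \<in> P"] eq by (subst ensemble(2)[OF M]) simp_all
  qed
  have "card {f \<in> S. int K \<notin> f t} + card {f \<in> S. int K \<in> f t} = card S"
    using finS by (subst card_Un_disjoint[symmetric]) (auto intro!: arg_cong[where f = card])
  then have "real (card {f \<in> S. int K \<notin> f t}) = real (card S) - real (card {f \<in> S. int K \<in> f t})" by linarith
  also have "\<dots> = real (card S) * (1 - (\<Sum>k<M. (psi k 0)\<^sup>2))"
    unfolding occ by (simp add: total algebra_simps)
  finally have eq: "real (card {f \<in> S. int K \<notin> f t}) = real (card S) * (1 - (\<Sum>k<M. (psi k 0)\<^sup>2))" .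
  have "real (card S) > 0" unfolding total using H C(1) D(1) by (intro mult_pos_pos)
  then show ?thesis unfolding eq by simp
qed

subsection \<open>Convergence to the arcsine law\<close>

text \<open>The entries at \<open>(0, x)\<close> of the powers of the free Jacobi operator on the integers.\<close>

fun walks_to :: "nat \<Rightarrow> int \<Rightarrow> real" where
  "walks_to 0 x = (if x = 0 then 1 else 0)"
| "walks_to (Suc r) x = walks_to r (x + 1) + walks_to r (x - 1)"

text \<open>The identity \<open>2 * cos t * cos (x * t) = cos ((x + 1) * t) + cos ((x - 1) *
  t)\<close> is the recursion of \<open>walks_to\<close>; the factor \<open>cos (x * t)\<close>
  makes the induction possible.\<close>

lemma has_integral_cos_power:
  "((\<lambda>t. (2 * cos t) ^ r * cos (real_of_int x * t)) has_integral pi * walks_to r x) {0..pi}"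
proof (induction r arbitrary: x)
  case 0
  show ?case
  proof (cases "x = 0")
    case True
    then show ?thesis using has_integral_const_real[of "1::real" 0 pi] by simp
  next
    case False
    have "((\<lambda>t. cos (real_of_int x * t)) has_integral (sin (real_of_int x * pi) / x - sin (real_of_int x * 0) / x)) {0..pi}"
      using False by (intro fundamental_theorem_of_calculus)
        (auto intro!: derivative_eq_intros simp: has_real_derivative_iff_has_vector_derivative[symmetric])
    moreover have "sin (real_of_int x * pi) = 0"
      using sin_integer_2pi[of "x"] by (metis Ints_of_int mult.commute sin_times_pi_eq_0)
    ultimately show ?thesis using False by simp
  qed
next
  case (Suc r)
  have *: "(2 * cos t) ^ Suc r * cos (real_of_int x * t) =
    (2 * cos t) ^ r * cos (real_of_int (x + 1) * t) + (2 * cos t) ^ r * cos (real_of_int (x - 1) * t)" for t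
  proof -
    have "2 * cos t * cos (real_of_int x * t) = cos (real_of_int (x + 1) * t) + cos (real_of_int (x - 1) * t)"
      by (simp add: algebra_simps cos_add cos_diff)
    then have "(2 * cos t) ^ r * (2 * cos t * cos (real_of_int x * t)) =
      (2 * cos t) ^ r * (cos (real_of_int (x + 1) * t) + cos (real_of_int (x - 1) * t))" by (rule arg_cong)
    then show ?thesis by (simp only: power_Suc distrib_left mult_ac)
  qed
  show ?case
    unfolding * walks_to.simps distrib_left by (intro has_integral_add Suc)
qed

lemma arcsine_moment:
  "integral {0..pi} (\<lambda>t. (2 * \<kappa> * cos t) ^ r) = pi * (\<kappa> ^ r * walks_to r 0)"
proof -
  have "((\<lambda>t. \<kappa> ^ r * ((2 * cos t) ^ r * cos (real_of_int 0 * t))) has_integral \<kappa> ^ r * (pi * walks_to r 0)) {0..pi}"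
    by (intro has_integral_mult_right has_integral_cos_power)
  then show ?thesis
    by (simp add: has_integral_iff power_mult_distrib mult_ac)
qed

text \<open>The weights \<open>w N k\<close> at the points \<open>t N k\<close> need not have total
  mass 1; the moment of order 0 makes the masses converge to 1. The uniform bound on the points
  allows polynomial approximation on one fixed compact interval.\<close>

locale arcsine_limit =
  fixes n :: "nat \<Rightarrow> nat" and w t :: "nat \<Rightarrow> nat \<Rightarrow> real" and R \<kappa> :: real
  assumes w_nonneg: "\<And>N k. 0 \<le> w N k"
    and bound: "eventually (\<lambda>N. \<forall>k\<le>n N. \<bar>t N k\<bar> \<le> R) sequentially"
    and kappa_pos: "0 < \<kappa>"
    and moments: "\<And>r. (\<lambda>N. \<Sum>k\<le>n N. w N k * t N k ^ r) \<longlonglongrightarrow> \<kappa> ^ r * walks_to r 0"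
begin

lemma tendsto_polynomial:
  assumes "real_polynomial_function g"
  shows "(\<lambda>N. \<Sum>k\<le>n N. w N k * g (t N k)) \<longlonglongrightarrow> integral {0..pi} (\<lambda>s. g (2 * \<kappa> * cos s)) / pi"
proof -
  obtain a m where g: "g = (\<lambda>x. \<Sum>i\<le>m. a i * x ^ i)"
    using assms by (auto simp: real_polynomial_function_iff_sum)
  have "(\<lambda>N. \<Sum>i\<le>m. a i * (\<Sum>k\<le>n N. w N k * t N k ^ i)) \<longlonglongrightarrow> (\<Sum>i\<le>m. a i * (\<kappa> ^ i * walks_to i 0))"
    by (intro tendsto_intros moments)
  moreover have "(\<Sum>i\<le>m. a i * (\<Sum>k\<le>n N. w N k * t N k ^ i)) = (\<Sum>k\<le>n N. w N k * g (t N k))" for N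
    unfolding g sum_distrib_left by (subst sum.swap) (simp add: mult_ac)
  moreover have "integral {0..pi} (\<lambda>s. g (2 * \<kappa> * cos s)) = (\<Sum>i\<le>m. a i * (pi * (\<kappa> ^ i * walks_to i 0)))"
    unfolding g arcsine_moment[symmetric]
    by (subst integral_sum) (auto intro!: integrable_continuous_real continuous_intros)
  moreover have "(\<Sum>i\<le>m. a i * (pi * (\<kappa> ^ i * walks_to i 0))) / pi = (\<Sum>i\<le>m. a i * (\<kappa> ^ i * walks_to i 0))"
    by (simp add: sum_divide_distrib)
  ultimately show ?thesis by simp
qed

lemma tendsto_continuous:
  assumes f: "continuous_on UNIV f"
  shows "(\<lambda>N. \<Sum>k\<le>n N. w N k * f (t N k)) \<longlonglongrightarrow> integral {0..pi} (\<lambda>s. f (2 * \<kappa> * cos s)) / pi"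
proof (rule LIMSEQ_I)
  fix e :: real assume e: "e > 0"
  \<comment> \<open>The interval must contain both the points \<open>t N k\<close> and the range of
    \<open>2 * \<kappa> * cos s\<close>.\<close>
  define S where "S = {- max R (2 * \<kappa>)..max R (2 * \<kappa>)}"
  have "continuous_on S f" using f continuous_on_subset by blast
  then obtain g where g: "real_polynomial_function g" "\<And>x. x \<in> S \<Longrightarrow> \<bar>f x - g x\<bar> < e / 4"
    using Stone_Weierstrass_real_polynomial_function[of S f "e / 4"] e by (auto simp: S_def)
  have gc: "continuous_on UNIV g"
    using continuous_real_polymonial_function[OF g(1)] by (intro continuous_at_imp_continuous_on) blast
  let ?If = "integral {0..pi} (\<lambda>s. f (2 * \<kappa> * cos s)) / pi"
  let ?Ig = "integral {0..pi} (\<lambda>s. g (2 * \<kappa> * cos s)) / pi"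
  have int: "(\<lambda>s. u (2 * \<kappa> * cos s)) integrable_on {0..pi}" if "continuous_on UNIV u" for u :: "real \<Rightarrow> real"
    using that by (intro integrable_continuous_real continuous_on_compose2[OF that]) (auto intro!: continuous_intros)
  have "\<bar>integral {0..pi} (\<lambda>s. f (2 * \<kappa> * cos s)) - integral {0..pi} (\<lambda>s. g (2 * \<kappa> * cos s))\<bar> \<le> e / 4 * pi"
  proof -
    have "norm (integral {0..pi} (\<lambda>s. f (2 * \<kappa> * cos s) - g (2 * \<kappa> * cos s))) \<le> integral {0..pi} (\<lambda>s. e / 4)"
    proof (rule integral_norm_bound_integral)
      fix s
      have "\<bar>2 * \<kappa> * cos s\<bar> \<le> 2 * \<kappa>"
        using kappa_pos abs_cos_le_one[of s] by (simp add: abs_mult)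
      then have "2 * \<kappa> * cos s \<in> S" by (auto simp: S_def)
      then show "norm (f (2 * \<kappa> * cos s) - g (2 * \<kappa> * cos s)) \<le> e / 4" using g(2) by (simp add: less_imp_le)
    qed (intro integrable_diff int f gc integrable_const_ivl)+
    then show ?thesis using integral_diff[OF int[OF f] int[OF gc]] by (simp add: mult.commute)
  qed
  then have 1: "\<bar>?If - ?Ig\<bar> \<le> e / 4"
    by (simp add: diff_divide_distrib[symmetric] pos_divide_le_eq)
  have "(\<lambda>N. \<Sum>k\<le>n N. w N k * t N k ^ 0) \<longlonglongrightarrow> \<kappa> ^ 0 * walks_to 0 0" by (rule moments)
  then have "(\<lambda>N. \<Sum>k\<le>n N. w N k) \<longlonglongrightarrow> 1" by simp
  \<comment> \<open>The constants fit together by \<open>3/2 * e/4 + e/4 + e/4 < e\<close>.\<close>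
  then have ev1: "\<forall>\<^sub>F N in sequentially. (\<Sum>k\<le>n N. w N k) < 3 / 2" by (rule order_tendstoD) simp
  have ev2: "\<forall>\<^sub>F N in sequentially. \<bar>(\<Sum>k\<le>n N. w N k * g (t N k)) - ?Ig\<bar> < e / 4"
    using tendstoD[OF tendsto_polynomial[OF g(1)], of "e / 4"] e by (simp add: dist_real_def)
  have "\<forall>\<^sub>F N in sequentially. norm ((\<Sum>k\<le>n N. w N k * f (t N k)) - ?If) < e"
    using ev1 ev2 bound
  proof eventually_elim
    case (elim N)
    have "\<bar>(\<Sum>k\<le>n N. w N k * f (t N k)) - (\<Sum>k\<le>n N. w N k * g (t N k))\<bar> \<le> (\<Sum>k\<le>n N. w N k * (e / 4))"
      unfolding sum_subtractf[symmetric]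
    proof (rule order_trans[OF sum_abs sum_mono])
      fix k assume "k \<in> {..n N}"
      then have "t N k \<in> S" using elim(3) by (auto simp: S_def abs_le_iff)
      then have "\<bar>f (t N k) - g (t N k)\<bar> \<le> e / 4" using g(2) less_imp_le by blast
      then show "\<bar>w N k * f (t N k) - w N k * g (t N k)\<bar> \<le> w N k * (e / 4)"
        unfolding right_diff_distrib[symmetric] abs_mult
        unfolding abs_of_nonneg[OF w_nonneg] using w_nonneg[of N k] by (rule mult_left_mono)
    qed
    also have "\<dots> = (\<Sum>k\<le>n N. w N k) * (e / 4)" by (simp add: sum_distrib_right)
    also have "\<dots> \<le> 3 / 2 * (e / 4)" using elim(1) e by (intro mult_right_mono) auto
    finally show ?case using elim(2) 1 e unfolding real_norm_def by linarith
  qed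
  then show "\<exists>no. \<forall>N\<ge>no. norm ((\<Sum>k\<le>n N. w N k * f (t N k)) - ?If) < e"
    by (simp add: eventually_sequentially)
qed

text \<open>The indicator of the half-line is squeezed between two continuous ramps. Their integrals
  are close to each other because the limit law has no atoms, which enters as the continuity of
  \<open>A\<close>.\<close>

lemma tendsto_tail:
  assumes \<tau>: "\<tau>N \<longlonglongrightarrow> \<tau>" and r: "\<bar>\<tau>\<bar> \<le> 2 * \<kappa>"
  shows "(\<lambda>N. \<Sum>k | k \<le> n N \<and> \<tau>N N < t N k. w N k) \<longlonglongrightarrow> arccos (\<tau> / (2 * \<kappa>)) / pi"
proof (rule LIMSEQ_I)
  fix e :: real assume e: "e > 0"
  \<comment> \<open>\<open>pi\<close> times the mass of the limit law above \<open>x\<close>;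
    clamping extends it to thresholds outside the support.\<close>
  define A where "A x = arccos (max (- 1) (min 1 (x / (2 * \<kappa>))))" for x
  have "continuous_on UNIV A"
    unfolding A_def by (intro continuous_on_arccos continuous_intros) (use kappa_pos in auto)
  then have "isCont A \<tau>" by (simp add: continuous_on_eq_continuous_at)
  moreover have e': "e * pi / 2 > 0" using e by simp
  ultimately obtain d where d: "d > 0" "\<And>x. \<bar>x - \<tau>\<bar> < d \<Longrightarrow> \<bar>A x - A \<tau>\<bar> < e * pi / 2"
    unfolding continuous_at_eps_delta dist_real_def by blast
  \<comment> \<open>The ramps of width \<open>c\<close> start at \<open>\<tau> - 2 * c\<close> and
    \<open>\<tau> + c\<close>, which leaves a margin \<open>c\<close> on either side for the moving
    threshold. The values of \<open>A\<close> to be compared with \<open>A \<tau>\<close> are taken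
    at distance \<open>2 * c < d\<close>.\<close>
  define c where "c = d / 3"
  have c: "c > 0" using d by (simp add: c_def)
  have A\<tau>: "A \<tau> = arccos (\<tau> / (2 * \<kappa>))"
  proof -
    have "- 1 \<le> \<tau> / (2 * \<kappa>)" "\<tau> / (2 * \<kappa>) \<le> 1" using r kappa_pos by (auto simp: field_simps abs_le_iff)
    then show ?thesis by (simp add: A_def)
  qed
  define ramp where "ramp u x = max 0 (min 1 ((x - u) / c))" for u x :: real
  have ramp_cont: "continuous_on UNIV (ramp u)" for u
    unfolding ramp_def by (intro continuous_intros) (use c in auto)
  have ramp01: "0 \<le> ramp u x" "ramp u x \<le> 1" for u x by (auto simp: ramp_def)
  have ramp0: "ramp u x = 0" if "x \<le> u" for u x using that c by (auto simp: ramp_def divide_nonpos_pos)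
  have ramp1: "ramp u x = 1" if "u + c \<le> x" for u x
  proof -
    have "1 \<le> (x - u) / c" using that c by (simp add: pos_le_divide_eq)
    then show ?thesis by (simp add: ramp_def)
  qed
  have int: "(\<lambda>s. ramp u (2 * \<kappa> * cos s)) integrable_on {a..b}" for u a b
    by (intro integrable_continuous_real continuous_on_compose2[OF ramp_cont]) (auto intro!: continuous_intros)
  have Abd: "0 \<le> A x" "A x \<le> pi" for x
    unfolding A_def by (intro arccos_lbound arccos_ubound; simp)+
  have cosA: "cos (A x) = max (- 1) (min 1 (x / (2 * \<kappa>)))" for x
    unfolding A_def by (intro cos_arccos) auto
  let ?r = "\<lambda>u s. ramp u (2 * \<kappa> * cos s)"
  let ?I = "\<lambda>u. integral {0..pi} (?r u)"
  have split: "?I u =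
     integral {0..A v} (?r u) + integral {A v..pi} (?r u)" for u v
    using Abd[of v] int by (intro Henstock_Kurzweil_Integration.integral_combine[symmetric]) auto
  have upper: "?I u \<le> A u" for u
  proof (cases "- 1 \<le> u / (2 * \<kappa>)")
    case False
    have "?I u \<le> integral {0..pi} (\<lambda>s. 1)"
      by (intro integral_le int ramp01) auto
    moreover have "A u = pi" using False by (simp add: A_def)
    ultimately show ?thesis by simp
  next
    case True
    have "integral {0..A u} (?r u) \<le> integral {0..A u} (\<lambda>s. 1)"
      by (intro integral_le int ramp01) auto
    moreover have "integral {A u..pi} (?r u) \<le> integral {A u..pi} (\<lambda>s. 0)"
    proof (intro integral_le int)
      fix s assume s: "s \<in> {A u..pi}"
      then have "cos s \<le> cos (A u)" using Abd[of u] by (intro cos_monotone_0_pi_le) auto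
      then have "cos s \<le> u / (2 * \<kappa>)" using True unfolding cosA by auto
      then have "2 * \<kappa> * cos s \<le> u" using kappa_pos by (simp add: field_simps)
      then show "ramp u (2 * \<kappa> * cos s) \<le> 0" by (simp add: ramp0)
    qed auto
    ultimately show ?thesis using split[of u u] Abd[of u] by simp
  qed
  have lower: "A (u + c) \<le> ?I u" for u
  proof (cases "(u + c) / (2 * \<kappa>) \<le> 1")
    case False
    have "integral {0..pi} (\<lambda>s. 0) \<le> ?I u"
      by (intro integral_le int ramp01) auto
    moreover have "A (u + c) = 0" using False by (simp add: A_def)
    ultimately show ?thesis by simp
  next
    case True
    have "integral {0..A (u + c)} (\<lambda>s. 1) \<le> integral {0..A (u + c)} (?r u)"
    proof (intro integral_le int)
      fix s assume s: "s \<in> {0..A (u + c)}"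
      then have "cos (A (u + c)) \<le> cos s" using Abd[of "u + c"] by (intro cos_monotone_0_pi_le) auto
      then have "(u + c) / (2 * \<kappa>) \<le> cos s" using True unfolding cosA by auto
      then have "u + c \<le> 2 * \<kappa> * cos s" using kappa_pos by (simp add: field_simps)
      then show "1 \<le> ramp u (2 * \<kappa> * cos s)" by (simp add: ramp1)
    qed auto
    moreover have "integral {A (u + c)..pi} (\<lambda>s. 0) \<le> integral {A (u + c)..pi} (?r u)"
      by (intro integral_le int ramp01) auto
    ultimately show ?thesis using split[of u "u + c"] Abd[of "u + c"] by simp
  qed
  let ?S = "\<lambda>N. \<Sum>k | k \<le> n N \<and> \<tau>N N < t N k. w N k"
  have S: "?S N = (\<Sum>k\<le>n N. w N k * (if \<tau>N N < t N k then 1 else 0))" for N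
    by (simp add: sum.inter_filter[symmetric] if_distrib cong: if_cong)
  have "\<forall>\<^sub>F N in sequentially. \<bar>\<tau>N N - \<tau>\<bar> < c"
    using tendstoD[OF \<tau> c] by (simp add: dist_real_def)
  moreover have "\<forall>\<^sub>F N in sequentially. \<bar>(\<Sum>k\<le>n N. w N k * ramp u (t N k)) -
      ?I u / pi\<bar> < e / 2" for u
    using tendstoD[OF tendsto_continuous[OF ramp_cont], of "e / 2" u] e by (simp add: dist_real_def)
  note this[of "\<tau> - 2 * c"] this[of "\<tau> + c"]
  ultimately have "\<forall>\<^sub>F N in sequentially. norm (?S N - arccos (\<tau> / (2 * \<kappa>)) / pi) < e"
  proof eventually_elim
    case (elim N)
    have "?S N \<le> (\<Sum>k\<le>n N. w N k * ramp (\<tau> - 2 * c) (t N k))"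
      unfolding S using elim(1) ramp01 w_nonneg by (intro sum_mono mult_left_mono) (auto simp: ramp1)
    moreover have "(\<Sum>k\<le>n N. w N k * ramp (\<tau> + c) (t N k)) \<le> ?S N"
      unfolding S using elim(1) ramp01 w_nonneg by (intro sum_mono mult_left_mono) (auto simp: ramp0)
    moreover have "?I (\<tau> - 2 * c) / pi < A \<tau> / pi + e / 2"
    proof -
      have "?I (\<tau> - 2 * c) < A \<tau> + e * pi / 2"
        using upper[of "\<tau> - 2 * c"] d(2)[of "\<tau> - 2 * c"] d(1) unfolding c_def by argo
      then show ?thesis by (simp add: field_simps)
    qed
    moreover have "A \<tau> / pi - e / 2 < ?I (\<tau> + c) / pi"
    proof -
      have "A \<tau> - e * pi / 2 < ?I (\<tau> + c)"
        using lower[of "\<tau> + c"] d(2)[of "\<tau> + c + c"] d(1) unfolding c_def by argo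
      from divide_strict_right_mono[OF this pi_gt_zero] show ?thesis by (simp add: diff_divide_distrib)
    qed
    ultimately show ?case
      using elim(2,3) unfolding real_norm_def A\<tau>[symmetric] by linarith
  qed
  then show "\<exists>no. \<forall>N\<ge>no. norm (?S N - arccos (\<tau> / (2 * \<kappa>)) / pi) < e"
    by (simp add: eventually_sequentially)
qed

end

text \<open>The threshold \<open>t N (M N)\<close> tends to
  \<open>\<mu> * (\<mu> - 2 * (A1 + A2)) + 2 * A1 * A2\<close>; the assumption \<open>range\<close>
  places this limit in the support \<open>[- 2 * A1 * A2, 2 * A1 * A2]\<close> of the arcsine
  law.\<close>

lemma hahn_occupation_tendsto:
  fixes K1 K2 M :: "nat \<Rightarrow> nat" and A1 A2 \<mu> :: real
  assumes K12: "\<And>N. K1 N \<le> K2 N"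
    and K1: "(\<lambda>N. real (K1 N) / real N) \<longlonglongrightarrow> A1"
    and K2: "(\<lambda>N. real (K2 N) / real N) \<longlonglongrightarrow> A2"
    and M: "(\<lambda>N. real (M N) / real N) \<longlonglongrightarrow> \<mu>"
    and M_le: "eventually (\<lambda>N. M N \<le> 2 * K1 N) sequentially"
    and pos: "0 < A1" "0 < A2"
    and range: "0 \<le> \<mu> * (2 * (A1 + A2) - \<mu>)" "\<mu> * (2 * (A1 + A2) - \<mu>) \<le> 4 * A1 * A2"
  shows "(\<lambda>N. \<Sum>k<M N. (hahn.psi (K1 N) (K2 N) k 0)\<^sup>2) \<longlonglongrightarrow>
     arccos (1 - \<mu> * (2 * (A1 + A2) - \<mu>) / (2 * A1 * A2)) / pi"
proof -
  interpret hahn "K1 N" "K2 N" for N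
    by unfold_locales (rule K12)
  define \<kappa> where "\<kappa> = A1 * A2"
  define w where "w N k = (psi N k 0)\<^sup>2" for N k
  \<comment> \<open>The shift cancels the diagonal entry \<open>up x + dn x\<close> up to
    \<open>2 * x^2\<close>, and that remainder disappears after division by
    \<open>N^2\<close>.\<close>
  define t where "t N k = (lam N k + 2 * real (K1 N) * real (K2 N)) / (real N)\<^sup>2" for N k
  have \<kappa>: "\<kappa> > 0" using pos by (simp add: \<kappa>_def)
  have inv: "(\<lambda>N. c / real N) \<longlonglongrightarrow> 0" for c by (rule lim_const_over_n)
  have mult_lim: "(\<lambda>N. (u N * v N) / (real N)\<^sup>2) \<longlonglongrightarrow> a * b"
    if "(\<lambda>N. u N / real N) \<longlonglongrightarrow> a" "(\<lambda>N. v N / real N) \<longlonglongrightarrow> b" for u v a b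
    using tendsto_mult[OF that] by (simp add: power2_eq_square)
  have shift: "(\<lambda>N. (real (K1 N) + c) / real N) \<longlonglongrightarrow> A1" "(\<lambda>N. (real (K2 N) + c) / real N) \<longlonglongrightarrow> A2" for c
    using tendsto_add[OF K1 inv[of c]] tendsto_add[OF K2 inv[of c]] by (simp_all add: add_divide_distrib)
  have ac_lim: "(\<lambda>N. ac N x / (real N)\<^sup>2) \<longlonglongrightarrow> \<kappa>" for x
  proof -
    have "(\<lambda>N. up N x / (real N)\<^sup>2) \<longlonglongrightarrow> A1 * A2"
      using mult_lim[OF shift(1)[of "- x"] shift(2)[of "- x"]] by (simp add: up_def)
    moreover have "(\<lambda>N. dn N (x + 1) / (real N)\<^sup>2) \<longlonglongrightarrow> A1 * A2"
      using mult_lim[OF shift(1)[of "x + 1"] shift(2)[of "x + 1"]] by (simp add: dn_def)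
    ultimately have "(\<lambda>N. sqrt ((up N x / (real N)\<^sup>2) * (dn N (x + 1) / (real N)\<^sup>2))) \<longlonglongrightarrow> sqrt ((A1 * A2) * (A1 * A2))"
      by (intro tendsto_intros)
    moreover have "sqrt ((A1 * A2) * (A1 * A2)) = \<kappa>" using \<kappa> by (simp add: \<kappa>_def)
    moreover have "sqrt ((up N x / (real N)\<^sup>2) * (dn N (x + 1) / (real N)\<^sup>2)) = ac N x / (real N)\<^sup>2" for N
      unfolding times_divide_times_eq real_sqrt_divide ac_def real_sqrt_abs2 by simp
    ultimately show ?thesis by simp
  qed
  have K1_top: "filterlim K1 at_top sequentially"
  proof -
    have "filterlim (\<lambda>N. real (K1 N) / real N * real N) at_top sequentially"
      by (rule filterlim_tendsto_pos_mult_at_top[OF K1 pos(1) filterlim_real_sequentially])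
    moreover have "\<forall>\<^sub>F N in sequentially. real (K1 N) / real N * real N = real (K1 N)"
      using eventually_gt_at_top[of 0] by eventually_elim simp
    ultimately have "filterlim (\<lambda>N. real (K1 N)) at_top sequentially"
      by (subst (asm) filterlim_cong[OF refl refl]) auto
    then show ?thesis by (simp add: filterlim_sequentially_iff_filterlim_real)
  qed
  have ev_X: "\<forall>\<^sub>F N in sequentially. x \<in> X N" for x
  proof -
    have "\<forall>\<^sub>F N in sequentially. nat \<bar>x\<bar> \<le> K1 N"
      using K1_top by (simp add: filterlim_at_top)
    then show ?thesis by eventually_elim (auto simp: X_def)
  qed
  \<comment> \<open>The entry \<open>(0, x)\<close> of the power \<open>r\<close> of the rescaled
    operator, in the eigenbasis. All \<open>x\<close> are needed for the induction on
    \<open>r\<close>, as each application of the operator involves both neighbours.\<close>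
  define m where "m N r x = (\<Sum>k\<le>2 * K1 N. t N k ^ r * (psi N k 0 * psi N k x))" for N r x
  have m_lim: "(\<lambda>N. m N r x) \<longlonglongrightarrow> \<kappa> ^ r * walks_to r x" for r x
  proof (induction r arbitrary: x)
    case 0
    have "\<forall>\<^sub>F N in sequentially. m N 0 x = walks_to 0 x"
      using ev_X[of x] ev_X[of 0] by eventually_elim (auto simp: m_def psi_complete)
    then show ?case by (simp add: tendsto_eventually)
  next
    case (Suc r)
    have "(\<lambda>N. real_of_int (2 * x\<^sup>2) / real N / real N) \<longlonglongrightarrow> 0"
      using tendsto_mult[OF inv[of "real_of_int (2 * x\<^sup>2)"] inv[of 1]] by simp
    then have x0: "(\<lambda>N. real_of_int (2 * x\<^sup>2) / (real N)\<^sup>2) \<longlonglongrightarrow> 0" by (simp add: power2_eq_square)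
    have "(\<lambda>N. ac N x / (real N)\<^sup>2 * m N r (x + 1) + ac N (x - 1) / (real N)\<^sup>2 * m N r (x - 1)
        - real_of_int (2 * x\<^sup>2) / (real N)\<^sup>2 * m N r x) \<longlonglongrightarrow>
        \<kappa> * (\<kappa> ^ r * walks_to r (x + 1)) + \<kappa> * (\<kappa> ^ r * walks_to r (x - 1)) - 0 * (\<kappa> ^ r * walks_to r x)"
      by (intro tendsto_intros ac_lim Suc x0)
    moreover have "\<forall>\<^sub>F N in sequentially. ac N x / (real N)\<^sup>2 * m N r (x + 1) + ac N (x - 1) / (real N)\<^sup>2 * m N r (x - 1)
        - real_of_int (2 * x\<^sup>2) / (real N)\<^sup>2 * m N r x = m N (Suc r) x"
      using ev_X[of x] eventually_gt_at_top[of 0]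
    proof eventually_elim
      case (elim N)
      have "t N k * psi N k x = ac N x / (real N)\<^sup>2 * psi N k (x + 1) + ac N (x - 1) / (real N)\<^sup>2 * psi N k (x - 1)
        - real_of_int (2 * x\<^sup>2) / (real N)\<^sup>2 * psi N k x" if "k \<le> 2 * K1 N" for k
      proof -
        have "up N x + dn N x = real_of_int (2 * x\<^sup>2) + 2 * real (K1 N) * real (K2 N)"
          by (simp add: up_def dn_def algebra_simps power2_eq_square)
        then have "(lam N k + 2 * real (K1 N) * real (K2 N)) * psi N k x =
          ac N x * psi N k (x + 1) + ac N (x - 1) * psi N k (x - 1) - real_of_int (2 * x\<^sup>2) * psi N k x"
          using psi_eigen[OF that elim(1)] by (simp add: algebra_simps)
        then show ?thesis
          by (simp add: t_def diff_divide_distrib[symmetric] add_divide_distrib[symmetric])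
      qed
      then have "m N (Suc r) x = (\<Sum>k\<le>2 * K1 N. t N k ^ r * (psi N k 0 *
         (ac N x / (real N)\<^sup>2 * psi N k (x + 1) + ac N (x - 1) / (real N)\<^sup>2 * psi N k (x - 1)
        - real_of_int (2 * x\<^sup>2) / (real N)\<^sup>2 * psi N k x)))"
        unfolding m_def by (intro sum.cong refl) (simp add: mult_ac)
      also have "\<dots> = ac N x / (real N)\<^sup>2 * m N r (x + 1) + ac N (x - 1) / (real N)\<^sup>2 * m N r (x - 1)
        - real_of_int (2 * x\<^sup>2) / (real N)\<^sup>2 * m N r x"
        unfolding m_def sum_distrib_left sum.distrib[symmetric] sum_subtractf[symmetric]
        by (intro sum.cong refl) (simp add: algebra_simps)
      finally show ?case by simp
    qed
    ultimately have "(\<lambda>N. m N (Suc r) x) \<longlonglongrightarrow>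
        \<kappa> * (\<kappa> ^ r * walks_to r (x + 1)) + \<kappa> * (\<kappa> ^ r * walks_to r (x - 1)) - 0 * (\<kappa> ^ r * walks_to r x)"
      by (rule Lim_transform_eventually)
    then show ?case by (simp add: algebra_simps)
  qed
  \<comment> \<open>An upper bound for the modulus of every \<open>t N k\<close>, obtained by
    estimating the two factors of \<open>lam\<close> separately for
    \<open>k \<le> 2 * K1\<close>.\<close>
  let ?b = "\<lambda>N. (2 * real (K1 N)) * (2 * real (K1 N) + 2 * real (K2 N) + 1) / (real N)\<^sup>2
     + 2 * (real (K1 N) * real (K2 N) / (real N)\<^sup>2)"
  have "?b \<longlonglongrightarrow> (2 * A1) * (2 * A1 + 2 * A2) + 2 * (A1 * A2)"
  proof (intro tendsto_add mult_lim tendsto_mult_left K1 K2)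
    show "(\<lambda>N. 2 * real (K1 N) / real N) \<longlonglongrightarrow> 2 * A1"
      using tendsto_mult_left[OF K1, of 2] by simp
    show "(\<lambda>N. (2 * real (K1 N) + 2 * real (K2 N) + 1) / real N) \<longlonglongrightarrow> 2 * A1 + 2 * A2"
      using tendsto_add[OF tendsto_mult_left[OF K1, of 2] tendsto_add[OF tendsto_mult_left[OF K2, of 2] inv[of 1]]]
      by (simp add: add_divide_distrib add.assoc)
  qed
  then have ev_b: "\<forall>\<^sub>F N in sequentially. ?b N < (2 * A1) * (2 * A1 + 2 * A2) + 2 * (A1 * A2) + 1"
    by (rule order_tendstoD) simp
  define R where "R = (2 * A1) * (2 * A1 + 2 * A2) + 2 * (A1 * A2) + 1"
  interpret arcsine_limit "\<lambda>N. 2 * K1 N" w t R \<kappa>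
  proof
    show "0 \<le> w N k" for N k by (simp add: w_def)
    show "\<forall>\<^sub>F N in sequentially. \<forall>k\<le>2 * K1 N. \<bar>t N k\<bar> \<le> R"
      using ev_b
    proof (eventually_elim, intro allI impI)
      fix N k assume N: "?b N < (2 * A1) * (2 * A1 + 2 * A2) + 2 * (A1 * A2) + 1" and k: "k \<le> 2 * K1 N"
      have "\<bar>lam N k\<bar> = real k * \<bar>real k - 1 - 2 * (real (K1 N) + real (K2 N))\<bar>"
        by (simp add: lam_def abs_mult)
      also have "\<dots> \<le> (2 * real (K1 N)) * (2 * real (K1 N) + 2 * real (K2 N) + 1)"
        using k by (intro mult_mono) auto
      finally have "\<bar>lam N k\<bar> \<le> (2 * real (K1 N)) * (2 * real (K1 N) + 2 * real (K2 N) + 1)" .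
      moreover have "\<bar>2 * real (K1 N) * real (K2 N)\<bar> = 2 * (real (K1 N) * real (K2 N))" by simp
      ultimately have "\<bar>lam N k + 2 * real (K1 N) * real (K2 N)\<bar> \<le> 
         (2 * real (K1 N)) * (2 * real (K1 N) + 2 * real (K2 N) + 1) + 2 * (real (K1 N) * real (K2 N))"
        using abs_triangle_ineq[of "lam N k" "2 * real (K1 N) * real (K2 N)"] by linarith
      then have "\<bar>t N k\<bar> \<le> ?b N"
        by (simp add: t_def add_divide_distrib[symmetric] divide_right_mono)
      then show "\<bar>t N k\<bar> \<le> R" using N by (simp add: R_def)
    qed
    show "0 < \<kappa>" by (rule \<kappa>)
    show "(\<lambda>N. \<Sum>k\<le>2 * K1 N. w N k * t N k ^ r) \<longlonglongrightarrow> \<kappa> ^ r * walks_to r 0" for r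
      using m_lim[of r 0] by (simp add: m_def w_def power2_eq_square mult_ac)
  qed
  define \<tau> where "\<tau> = \<mu> * (\<mu> - 2 * (A1 + A2)) + 2 * \<kappa>"
  have "(\<lambda>N. t N (M N)) \<longlonglongrightarrow> \<tau>"
  proof -
    have "(\<lambda>N. (real (M N) - 1 - 2 * (real (K1 N) + real (K2 N))) / real N) \<longlonglongrightarrow> \<mu> - 0 - 2 * (A1 + A2)"
      using tendsto_diff[OF tendsto_diff[OF M inv[of 1]] tendsto_mult_left[OF tendsto_add[OF K1 K2], of 2]]
      by (simp add: diff_divide_distrib add_divide_distrib)
    from mult_lim[OF M this] mult_lim[OF K1 K2] have
      "(\<lambda>N. real (M N) * (real (M N) - 1 - 2 * (real (K1 N) + real (K2 N))) / (real N)\<^sup>2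
         + 2 * (real (K1 N) * real (K2 N) / (real N)\<^sup>2)) \<longlonglongrightarrow> \<mu> * (\<mu> - 0 - 2 * (A1 + A2)) + 2 * (A1 * A2)"
      by (intro tendsto_add tendsto_mult_left)
    then show ?thesis
      by (simp add: t_def lam_def \<tau>_def \<kappa>_def add_divide_distrib mult.assoc)
  qed
  moreover have "\<bar>\<tau>\<bar> \<le> 2 * \<kappa>"
    using range unfolding \<tau>_def \<kappa>_def by (simp add: abs_le_iff algebra_simps)
  ultimately have lim: "(\<lambda>N. \<Sum>k | k \<le> 2 * K1 N \<and> t N (M N) < t N k. w N k) \<longlonglongrightarrow> arccos (\<tau> / (2 * \<kappa>)) / pi"
    by (rule tendsto_tail)
  \<comment> \<open>As \<open>lam\<close> is strictly decreasing, the degrees below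
    \<open>M N\<close> are exactly those whose point lies above the one of degree
    \<open>M N\<close>.\<close>
  have "\<forall>\<^sub>F N in sequentially. (\<Sum>k | k \<le> 2 * K1 N \<and> t N (M N) < t N k. w N k) = (\<Sum>k<M N. (psi N k 0)\<^sup>2)"
    using M_le eventually_gt_at_top[of 0]
  proof eventually_elim
    case (elim N)
    have "t N (M N) < t N k \<longleftrightarrow> lam N (M N) < lam N k" for k
      using elim(2) by (simp add: t_def divide_less_cancel)
    moreover have "lam N (M N) < lam N k \<longleftrightarrow> k < M N" if "k \<le> 2 * K1 N" for k
      using lam_less[where N = N and j = k and k = "M N"] lam_less[where N = N and j = "M N" and k = k] elim(1) that
      by (cases k "M N" rule: linorder_cases) auto
    ultimately have "{k. k \<le> 2 * K1 N \<and> t N (M N) < t N k} = {..<M N}" using elim(1) by auto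
    then show ?case by (simp add: w_def)
  qed
  from Lim_transform_eventually[OF lim this]
  have "(\<lambda>N. \<Sum>k<M N. (psi N k 0)\<^sup>2) \<longlonglongrightarrow> arccos (\<tau> / (2 * \<kappa>)) / pi" .
  moreover have "\<tau> / (2 * \<kappa>) = 1 - \<mu> * (2 * (A1 + A2) - \<mu>) / (2 * A1 * A2)"
    using pos by (simp add: \<tau>_def \<kappa>_def field_simps)
  ultimately show ?thesis by simp
qed

subsection \<open>Geometry of the hexagon\<close>

text \<open>Coordinates that are both integral exactly on the lattice; the three families of lattice lines are
  given by integral values of \<^term>\<open>ucoord p\<close>, \<^term>\<open>vcoord M p\<close> and \<^term>\<open>vcoord M p - ucoord p\<close>.\<close>

definition ucoord :: "real \<times> real \<Rightarrow> real" where "ucoord p = 2 * fst p / sqrt 3"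
definition vcoord :: "int \<Rightarrow> real \<times> real \<Rightarrow> real" where "vcoord M p = M / 2 + fst p / sqrt 3 - snd p"

text \<open>Real arguments are allowed because points of segments and centroids of triangles are
  described in these coordinates as well.\<close>

definition pt :: "int \<Rightarrow> real \<Rightarrow> real \<Rightarrow> real \<times> real" where
  "pt M z j = (sqrt 3 / 2 * j, M / 2 - z + j / 2)"

lemma ucoord_pt [simp]: "ucoord (pt M z j) = j" and vcoord_pt [simp]: "vcoord M (pt M z j) = z"
  by (simp_all add: ucoord_def vcoord_def pt_def)

lemma pt_coords [simp]: "pt M (vcoord M p) (ucoord p) = p"
  by (simp add: ucoord_def vcoord_def pt_def field_simps prod_eq_iff)

lemma pt_eq_iff [simp]: "pt M z j = pt M z' j' \<longleftrightarrow> z = z' \<and> j = j'"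
  by (metis ucoord_pt vcoord_pt)

lemma ucoord_linear: "ucoord (x *\<^sub>R p + y *\<^sub>R q) = x * ucoord p + y * ucoord q"
  by (simp add: ucoord_def algebra_simps add_divide_distrib)

lemma vcoord_affine: "x + y = 1 \<Longrightarrow> vcoord M (x *\<^sub>R p + y *\<^sub>R q) = x * vcoord M p + y * vcoord M q"
proof -
  assume "x + y = 1"
  then have "real_of_int M / 2 = x * (M / 2) + y * (M / 2)" by (metis distrib_right mult_1)
  then show ?thesis by (simp add: vcoord_def algebra_simps add_divide_distrib)
qed

lemma pt_affine: "x + y = 1 \<Longrightarrow> x *\<^sub>R pt M z j + y *\<^sub>R pt M z' j' = pt M (x * z + y * z') (x * j + y * j')"
  by (metis ucoord_linear ucoord_pt vcoord_affine vcoord_pt pt_coords)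

lemma tri_lattice_eq: "tri_lattice M = {pt M (of_int z) (of_int j) | z j :: int. True}"
proof -
  have e: "(0, of_int M / 2) + of_int i *\<^sub>R (0, 1) + of_int j *\<^sub>R (sqrt 3 / 2, 1 / 2) = pt M (of_int (- i)) (of_int j)" for i j :: int
    by (simp add: pt_def)
  show ?thesis
    unfolding tri_lattice_def e
  proof (intro equalityI subsetI)
    fix p assume "p \<in> {pt M (of_int z) (of_int j) | z j :: int. True}"
    then obtain z j :: int where "p = pt M (of_int (- (- z))) (of_int j)" by auto
    then show "p \<in> {pt M (of_int (- i)) (of_int j) | i j :: int. True}" by blast
  qed blast
qed

lemma dist_pt: "dist (pt M z j) (pt M z' j') = sqrt ((z - z')\<^sup>2 - (z - z') * (j - j') + (j - j')\<^sup>2)"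
proof -
  have "sqrt 3 / 2 * j - sqrt 3 / 2 * j' = sqrt 3 / 2 * (j - j')" by (simp add: algebra_simps)
  then have "(sqrt 3 / 2 * j - sqrt 3 / 2 * j')\<^sup>2 = 3 / 4 * (j - j')\<^sup>2"
    by (simp only: power_mult_distrib power_divide) simp
  then show ?thesis
    unfolding pt_def dist_Pair_Pair dist_real_def power2_abs
    by (intro arg_cong[where f = sqrt]) (simp add: field_simps power2_eq_square)
qed

text \<open>Completing the square gives \<open>(2 * a - b)^2 + 3 * b^2 = 4\<close> and the same with
  \<open>a\<close> and \<open>b\<close> exchanged, which leaves only -1, 0 and 1 for both.\<close>

lemma norm_form_eq_1:
  fixes a b :: int
  shows "a\<^sup>2 - a * b + b\<^sup>2 = 1 \<longleftrightarrow> (a, b) \<in> {(1,0), (-1,0), (0,1), (0,-1), (1,1), (-1,-1)}"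
proof
  assume e: "a\<^sup>2 - a * b + b\<^sup>2 = 1"
  have "(2 * a - b)\<^sup>2 + 3 * b\<^sup>2 = 4" "(2 * b - a)\<^sup>2 + 3 * a\<^sup>2 = 4" using e by (simp_all add: power2_eq_square algebra_simps)
  then have "3 * b\<^sup>2 \<le> 4" "3 * a\<^sup>2 \<le> 4" by (smt (verit) zero_le_power2)+
  then have "\<bar>b\<bar> < 2" "\<bar>a\<bar> < 2"
    using abs_le_square_iff[of 2 b] abs_le_square_iff[of 2 a] by simp_all
  then have "a \<in> {-1,0,1}" "b \<in> {-1,0,1}" by auto
  then show "(a, b) \<in> {(1,0), (-1,0), (0,1), (0,-1), (1,1), (-1,-1)}" using e by auto
qed auto

lemma dist_pt_eq_1:
  "dist (pt M (of_int z) (of_int j)) (pt M (of_int z') (of_int j')) = 1 \<longleftrightarrow>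
   (z' - z, j' - j) \<in> {(1,0), (-1,0), (0,1), (0,-1), (1,1), (-1,-1)}"
proof -
  have "dist (pt M (of_int z) (of_int j)) (pt M (of_int z') (of_int j')) = 1 \<longleftrightarrow>
    real_of_int ((z' - z)\<^sup>2 - (z' - z) * (j' - j) + (j' - j)\<^sup>2) = real_of_int 1"
    unfolding dist_pt by (simp add: algebra_simps power2_eq_square)
  then show ?thesis unfolding of_int_eq_iff norm_form_eq_1 .
qed

text \<open>The two triangles to the right and to the left of the vertical unit edge \<open>(z, j)\<close>, which runs
  on line \<open>j\<close> from the lattice point \<open>(z, j)\<close> down to \<open>(z + 1, j)\<close>.\<close>

definition rtri :: "int \<Rightarrow> int \<times> int \<Rightarrow> (real \<times> real) set" where
  "rtri M a = {p. of_int (snd a) \<le> ucoord p \<and> vcoord M p \<le> of_int (fst a) + 1 \<and> real_of_int (fst a) - of_int (snd a) \<le> vcoord M p - ucoord p}"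

definition ltri :: "int \<Rightarrow> int \<times> int \<Rightarrow> (real \<times> real) set" where
  "ltri M b = {p. ucoord p \<le> of_int (snd b) \<and> of_int (fst b) \<le> vcoord M p \<and> vcoord M p - ucoord p \<le> real_of_int (fst b) + 1 - of_int (snd b)}"

definition lpt :: "int \<Rightarrow> int \<times> int \<Rightarrow> real \<times> real" where
  "lpt M a = pt M (of_int (fst a)) (of_int (snd a))"

fun rtri_corners :: "int \<times> int \<Rightarrow> (int \<times> int) set" where
  "rtri_corners (z, j) = {(z, j), (z + 1, j), (z + 1, j + 1)}"

fun ltri_corners :: "int \<times> int \<Rightarrow> (int \<times> int) set" where
  "ltri_corners (z, j) = {(z, j), (z + 1, j), (z, j - 1)}"

lemma pt_affine3: "x + y + w = 1 \<Longrightarrow> x *\<^sub>R pt M z j + y *\<^sub>R pt M z' j' + w *\<^sub>R pt M z'' j'' =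
  pt M (x * z + y * z' + w * z'') (x * j + y * j' + w * j'')"
proof -
  assume "x + y + w = 1"
  then have "real_of_int M = x * M + y * M + w * M" by (metis distrib_right mult_1)
  then show ?thesis by (simp add: pt_def algebra_simps add_divide_distrib)
qed

lemma convex_le_affine:
  assumes "\<And>x y p q. x + y = 1 \<Longrightarrow> f (x *\<^sub>R p + y *\<^sub>R q) = x * f p + y * (f q :: real)"
  shows "convex {p. c \<le> f p}" "convex {p. f p \<le> c}"
proof -
  have c: "x * c + y * c = c" if "x + y = 1" for x y :: real using that by (metis distrib_right mult_1)
  show "convex {p. c \<le> f p}"
  proof (rule convexI)
    fix p q and x y :: real
    assume "p \<in> {p. c \<le> f p}" "q \<in> {p. c \<le> f p}" "0 \<le> x" "0 \<le> y" "x + y = 1"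
    then show "x *\<^sub>R p + y *\<^sub>R q \<in> {p. c \<le> f p}"
      using assms[of x y p q] c[of x y] add_mono[of "x * c" "x * f p" "y * c" "y * f q"] by (simp add: mult_left_mono)
  qed
  show "convex {p. f p \<le> c}"
  proof (rule convexI)
    fix p q and x y :: real
    assume "p \<in> {p. f p \<le> c}" "q \<in> {p. f p \<le> c}" "0 \<le> x" "0 \<le> y" "x + y = 1"
    then show "x *\<^sub>R p + y *\<^sub>R q \<in> {p. f p \<le> c}"
      using assms[of x y p q] c[of x y] add_mono[of "x * f p" "x * c" "y * f q" "y * c"] by (simp add: mult_left_mono)
  qed
qed

lemma convex_ucoord: "convex {p. c \<le> ucoord p}" "convex {p. ucoord p \<le> c}"
  by (rule convex_le_affine; simp add: ucoord_linear)+

lemma convex_vcoord: "convex {p. c \<le> vcoord M p}" "convex {p. vcoord M p \<le> c}"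
  by (rule convex_le_affine; simp add: vcoord_affine)+

lemma convex_vcoord_ucoord: "convex {p. c \<le> vcoord M p - ucoord p}" "convex {p. vcoord M p - ucoord p \<le> c}"
  by (rule convex_le_affine; simp add: vcoord_affine ucoord_linear algebra_simps)+

lemma convex_rtri: "convex (rtri M a)" and convex_ltri: "convex (ltri M a)"
  unfolding rtri_def ltri_def Collect_conj_eq by (intro convex_Int convex_ucoord convex_vcoord convex_vcoord_ucoord)+

text \<open>The slacks in the three defining inequalities are the barycentric coordinates of the
  point.\<close>

lemma rtri_hull: "convex hull (lpt M ` rtri_corners a) = rtri M a"
proof
  obtain z j where a: "a = (z, j)" by (cases a)
  show "convex hull (lpt M ` rtri_corners a) \<subseteq> rtri M a"
    by (rule hull_minimal[where S = convex, OF _ convex_rtri]) (auto simp: a rtri_def lpt_def)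
  show "rtri M a \<subseteq> convex hull (lpt M ` rtri_corners a)"
  proof
    fix p assume p: "p \<in> rtri M a"
    define x y w where "x = z + 1 - vcoord M p" and "y = vcoord M p - ucoord p - (real_of_int z - j)" and "w = ucoord p - j"
    have "p = x *\<^sub>R lpt M (z, j) + y *\<^sub>R lpt M (z + 1, j) + w *\<^sub>R lpt M (z + 1, j + 1)"
      unfolding lpt_def by (subst pt_affine3) (auto simp: x_def y_def w_def algebra_simps)
    moreover have "0 \<le> x" "0 \<le> y" "0 \<le> w" "x + y + w = 1" using p by (auto simp: a x_def y_def w_def rtri_def)
    ultimately show "p \<in> convex hull (lpt M ` rtri_corners a)"
      unfolding a by (simp add: convex_hull_3) blast
  qed
qed

lemma ltri_hull: "convex hull (lpt M ` ltri_corners a) = ltri M a"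
proof
  obtain z j where a: "a = (z, j)" by (cases a)
  show "convex hull (lpt M ` ltri_corners a) \<subseteq> ltri M a"
    by (rule hull_minimal[where S = convex, OF _ convex_ltri]) (auto simp: a ltri_def lpt_def)
  show "ltri M a \<subseteq> convex hull (lpt M ` ltri_corners a)"
  proof
    fix p assume p: "p \<in> ltri M a"
    define x y w where "x = real_of_int z + 1 - j - (vcoord M p - ucoord p)" and "y = vcoord M p - z" and "w = j - ucoord p"
    have "p = x *\<^sub>R lpt M (z, j) + y *\<^sub>R lpt M (z + 1, j) + w *\<^sub>R lpt M (z, j - 1)"
      unfolding lpt_def by (subst pt_affine3) (auto simp: x_def y_def w_def algebra_simps)
    moreover have "0 \<le> x" "0 \<le> y" "0 \<le> w" "x + y + w = 1" using p by (auto simp: a x_def y_def w_def ltri_def)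
    ultimately show "p \<in> convex hull (lpt M ` ltri_corners a)"
      unfolding a by (simp add: convex_hull_3) blast
  qed
qed

definition hexagon_ineq :: "int \<Rightarrow> int \<Rightarrow> (real \<times> real) set" where
  "hexagon_ineq n M = {p. 0 \<le> ucoord p \<and> ucoord p \<le> 2 * n \<and> 0 \<le> vcoord M p \<and> vcoord M p \<le> real_of_int M + n \<and> - n \<le> vcoord M p - ucoord p \<and> vcoord M p - ucoord p \<le> M}"

lemma convex_hexagon_ineq: "convex (hexagon_ineq n M)"
  unfolding hexagon_ineq_def Collect_conj_eq by (intro convex_Int convex_ucoord convex_vcoord convex_vcoord_ucoord)

lemma pt_segment:
  assumes "convex S" "pt M v1 u1 \<in> S" "pt M v2 u2 \<in> S" "0 \<le> a" "a \<le> 1"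
  shows "pt M ((1 - a) * v1 + a * v2) ((1 - a) * u1 + a * u2) \<in> S"
  using convexD[OF assms(1-3), of "1 - a" a] assms(4,5) by (simp add: pt_affine)

text \<open>For the harder inclusion, a point is placed on the vertical chord through it. The ends
  of the chord lie on sides of the hexagon, and the sides change at \<open>u = n\<close>, hence the
  case distinction.\<close>

lemma hexagon_eq:
  assumes "1 \<le> n" "0 \<le> M"
  shows "hexagon n M = hexagon_ineq n M"
proof
  let ?S = "{pt M 0 0, pt M M 0, pt M 0 n, pt M (M + n) n, pt M n (2 * n), pt M (n + M) (2 * n)}"
  have hex: "hexagon n M = convex hull ?S"
    unfolding hexagon_def by (rule arg_cong[where f = "\<lambda>S. convex hull S"]) (simp add: pt_def insert_commute field_simps)
  show "hexagon n M \<subseteq> hexagon_ineq n M"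
    unfolding hex by (rule hull_minimal[where S = convex, OF _ convex_hexagon_ineq]) (use assms in \<open>auto simp: hexagon_ineq_def\<close>)
  show "hexagon_ineq n M \<subseteq> hexagon n M"
  proof
    fix p assume p: "p \<in> hexagon_ineq n M"
    define u v where "u = ucoord p" and "v = vcoord M p"
    have uv: "0 \<le> u" "u \<le> 2 * n" "0 \<le> v" "v \<le> real_of_int M + n" "- n \<le> v - u" "v - u \<le> M"
      using p by (auto simp: hexagon_ineq_def u_def v_def)
    have n0: "real_of_int n > 0" and M0: "real_of_int M \<ge> 0" using assms by auto
    have vert: "q \<in> hexagon n M" if "q \<in> ?S" for q
      unfolding hex using that by (rule hull_inc)
    have conv: "convex (hexagon n M)" unfolding hex by simp
    have "pt M v u \<in> hexagon n M"
    proof (cases "u \<le> n")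
      case True
      define a where "a = u / n"
      have a: "0 \<le> a" "a \<le> 1" "a * n = u" using uv n0 True by (auto simp: a_def)
      have 1: "pt M 0 u \<in> hexagon n M"
        using pt_segment[OF conv vert vert a(1,2), of M 0 0 0 n] a(3) by simp
      have 2: "pt M (M + u) u \<in> hexagon n M"
        using pt_segment[OF conv vert vert a(1,2), of M M 0 "M + n" n] a(3) by (simp add: algebra_simps)
      have b: "0 \<le> v / (M + u)" "v / (M + u) \<le> 1" using uv M0 by (auto simp: divide_le_eq_1)
      \<comment> \<open>If \<open>M + u = 0\<close>, the chord shrinks to the left vertex of a
        rhombus; then \<open>v = 0\<close>, which agrees with the default value of division by
        zero.\<close>
      have "v / (M + u) * (M + u) = v" using uv M0 by (cases "M + u = 0") auto
      then show ?thesis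
        using pt_segment[OF conv 1 2 b] by (simp add: algebra_simps)
    next
      case False
      define a where "a = (u - n) / n"
      have a: "0 \<le> a" "a \<le> 1" "a * n = u - n" using uv n0 False by (auto simp: a_def)
      have eqs: "(1 - a) * 0 + a * n = u - n" "(1 - a) * n + a * (2 * n) = u" "(1 - a) * (M + n) + a * (n + M) = M + n"
        using a(3) by (simp_all add: algebra_simps)
      have 1: "pt M (u - n) u \<in> hexagon n M"
        using pt_segment[OF conv vert vert a(1,2), of M 0 n n "2 * n"] unfolding eqs by simp
      have 2: "pt M (M + n) u \<in> hexagon n M"
        using pt_segment[OF conv vert vert a(1,2), of M "M + n" n "n + M" "2 * n"] unfolding eqs by simp
      let ?d = "M + n - (u - n)"
      define b where "b = (v - (u - n)) / ?d"
      have b: "0 \<le> b" "b \<le> 1" using uv M0 n0 by (auto simp: b_def divide_le_eq_1)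
      have "b * ?d = v - (u - n)" using uv M0 n0 unfolding b_def by (cases "?d = 0") auto
      then show ?thesis
        using pt_segment[OF conv 1 2 b] by (simp add: algebra_simps)
    qed
    then show "p \<in> hexagon n M" by (simp add: u_def v_def)
  qed
qed

section \<open>Unit triangles of the hexagon and their adjacency\<close>

definition edges :: "int \<Rightarrow> int \<Rightarrow> (int \<times> int) set" where
  "edges n M = {(z, j). 0 \<le> j \<and> j \<le> 2 * n \<and> 0 \<le> z \<and> z + 1 \<le> M + n \<and> - n \<le> z - j \<and> z + 1 - j \<le> M}"

text \<open>A triangle with its vertical edge in the hexagon lies in the hexagon itself, except to
  the right of the last line; \<open>lts\<close> excludes the left of the first line in the same
  way.\<close>

definition rts :: "int \<Rightarrow> int \<Rightarrow> (int \<times> int) set" where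
  "rts n M = {a \<in> edges n M. snd a < 2 * n}"

definition lts :: "int \<Rightarrow> int \<Rightarrow> (int \<times> int) set" where
  "lts n M = {b \<in> edges n M. 1 \<le> snd b}"

lemma lpt_hexagon: "lpt M (z, j) \<in> hexagon_ineq n M \<longleftrightarrow>
    0 \<le> j \<and> j \<le> 2 * n \<and> 0 \<le> z \<and> z \<le> M + n \<and> - n \<le> z - j \<and> z - j \<le> M"
  unfolding of_int_le_iff[symmetric, where 'a = real] by (simp add: hexagon_ineq_def lpt_def)

lemma rtri_subset_hexagon: 
  assumes "1 \<le> n" "0 \<le> M"
  shows "rtri M a \<subseteq> hexagon n M \<longleftrightarrow> a \<in> rts n M"
proof -
  have "rtri M a \<subseteq> hexagon n M \<longleftrightarrow> lpt M ` rtri_corners a \<subseteq> hexagon_ineq n M"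
    unfolding rtri_hull[symmetric] hexagon_eq[OF assms] by (rule subset_hull[where S = convex, OF convex_hexagon_ineq])
  then show ?thesis by (cases a) (simp add: lpt_hexagon rts_def edges_def, arith)
qed

lemma ltri_subset_hexagon: 
  assumes "1 \<le> n" "0 \<le> M"
  shows "ltri M a \<subseteq> hexagon n M \<longleftrightarrow> a \<in> lts n M"
proof -
  have "ltri M a \<subseteq> hexagon n M \<longleftrightarrow> lpt M ` ltri_corners a \<subseteq> hexagon_ineq n M"
    unfolding ltri_hull[symmetric] hexagon_eq[OF assms] by (rule subset_hull[where S = convex, OF convex_hexagon_ineq])
  then show ?thesis by (cases a) (simp add: lpt_hexagon lts_def edges_def, arith)
qed

text \<open>The neighbours of a right triangle across its vertical side, its upper side and its
  lower side, in this order.\<close>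

fun adj :: "int \<times> int \<Rightarrow> int \<times> int \<Rightarrow> bool" where
  "adj (z, j) b \<longleftrightarrow> b = (z, j) \<or> b = (z, j + 1) \<or> b = (z + 1, j + 1)"

definition unit_dirs :: "(int \<times> int) set" where
  "unit_dirs = {(1,0), (-1,0), (0,1), (0,-1), (1,1), (-1,-1)}"

lemma dist_lpt: "dist (lpt M a) (lpt M b) = 1 \<longleftrightarrow> b - a \<in> unit_dirs"
  unfolding lpt_def dist_pt_eq_1 unit_dirs_def by (simp add: minus_prod_def)

lemma lpt_lattice: "tri_lattice M = range (lpt M)"
proof -
  have "pt M (of_int z) (of_int j) = lpt M (z, j)" for z j by (simp add: lpt_def)
  then have "tri_lattice M = {lpt M (z, j) | z j. True}" by (simp add: tri_lattice_eq)
  also have "\<dots> = range (lpt M)" by auto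
  finally show ?thesis .
qed

lemma lpt_inj: "lpt M a = lpt M b \<longleftrightarrow> a = b"
  unfolding lpt_def pt_eq_iff of_int_eq_iff by (simp add: prod_eq_iff)

lemma triangle_corners:
  assumes "b - a \<in> unit_dirs" "c - a \<in> unit_dirs" "c - b \<in> unit_dirs"
  shows "\<exists>d. {a, b, c} = rtri_corners d \<or> {a, b, c} = ltri_corners d"
proof -
  obtain z j z' j' z'' j'' where abc: "a = (z, j)" "b = (z + z', j + j')" "c = (z + z'', j + j'')"
    by (metis add_diff_cancel_left' add.commute diff_add_cancel surj_pair)
  \<comment> \<open>The twelve ordered pairs of unit directions that differ by a unit
    direction.\<close>
  have "((z', j'), (z'', j'')) \<in> {((1, 0), (1, 1)), ((1, 1), (1, 0)), ((1, 1), (0, 1)), ((0, 1), (1, 1)), ((0, 1), (- 1, 0)), ((- 1, 0), (0, 1)), ((- 1, 0), (- 1, - 1)), ((- 1, - 1), (- 1, 0)), ((- 1, - 1), (0, - 1)), ((0, - 1), (- 1, - 1)), ((0, - 1), (1, 0)), ((1, 0), (0, - 1))}"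
    using assms unfolding abc unit_dirs_def by (simp add: minus_prod_def) (elim disjE conjE; simp)
  \<comment> \<open>The label of a right triangle has the smallest \<open>z\<close> and the smallest
    \<open>j\<close> among the corners, that of a left triangle the smallest \<open>z\<close> and
    the largest \<open>j\<close>.\<close>
  then have "{a, b, c} = rtri_corners (z + min 0 (min z' z''), j + min 0 (min j' j'')) \<or>
    {a, b, c} = ltri_corners (z + min 0 (min z' z''), j + max 0 (max j' j''))"
    unfolding abc by (elim insertE emptyE; simp; blast?)
  then show ?thesis by blast
qed

lemma rtri_corners_eqI: "a \<noteq> b \<Longrightarrow> {a, b} \<subseteq> rtri_corners c \<Longrightarrow> {a, b} \<subseteq> rtri_corners d \<Longrightarrow> c = d"
  by (cases c; cases d) auto

lemma ltri_corners_eqI: "a \<noteq> b \<Longrightarrow> {a, b} \<subseteq> ltri_corners c \<Longrightarrow> {a, b} \<subseteq> ltri_corners d \<Longrightarrow> c = d"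
  by (cases c; cases d) auto

lemma corners_adj: "a \<noteq> b \<Longrightarrow> {a, b} \<subseteq> rtri_corners c \<Longrightarrow> {a, b} \<subseteq> ltri_corners d \<Longrightarrow> adj c d"
  by (cases c; cases d) auto

definition adjs :: "int \<Rightarrow> int \<Rightarrow> ((int \<times> int) \<times> (int \<times> int)) set" where
  "adjs n M = {(a, b). a \<in> rts n M \<and> b \<in> lts n M \<and> adj a b}"

definition rhomb :: "int \<Rightarrow> (int \<times> int) \<times> (int \<times> int) \<Rightarrow> (real \<times> real) set" where
  "rhomb M x = rtri M (fst x) \<union> ltri M (snd x)"

lemma unit_triangle_corners:
  assumes "unit_triangle n M (lpt M a) (lpt M b) (lpt M c)" and nM: "1 \<le> n" "0 \<le> M"
  shows "\<exists>d. {a, b, c} = rtri_corners d \<and> convex hull {lpt M a, lpt M b, lpt M c} = rtri M d \<and> d \<in> rts n M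
    \<or> {a, b, c} = ltri_corners d \<and> convex hull {lpt M a, lpt M b, lpt M c} = ltri M d \<and> d \<in> lts n M"
proof -
  have "b - a \<in> unit_dirs" "c - a \<in> unit_dirs" "c - b \<in> unit_dirs" and sub: "convex hull {lpt M a, lpt M b, lpt M c} \<subseteq> hexagon n M"
    using assms(1) by (auto simp: unit_triangle_def dist_lpt)
  then obtain d where d: "{a, b, c} = rtri_corners d \<or> {a, b, c} = ltri_corners d"
    using triangle_corners by blast
  have im: "{lpt M a, lpt M b, lpt M c} = lpt M ` {a, b, c}" by simp
  from d show ?thesis
  proof
    assume "{a, b, c} = rtri_corners d"
    moreover from this have "convex hull {lpt M a, lpt M b, lpt M c} = rtri M d" unfolding im by (simp only: rtri_hull)
    ultimately show ?thesis using sub rtri_subset_hexagon[OF nM] by metis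
  next
    assume "{a, b, c} = ltri_corners d"
    moreover from this have "convex hull {lpt M a, lpt M b, lpt M c} = ltri M d" unfolding im by (simp only: ltri_hull)
    ultimately show ?thesis using sub ltri_subset_hexagon[OF nM] by metis
  qed
qed

lemma unit_triangle_rtri:
  assumes "1 \<le> n" "0 \<le> M" "d \<in> rts n M" "{a, b, c} = rtri_corners d" "b - a \<in> unit_dirs" "c - a \<in> unit_dirs" "c - b \<in> unit_dirs"
  shows "unit_triangle n M (lpt M a) (lpt M b) (lpt M c)" "convex hull {lpt M a, lpt M b, lpt M c} = rtri M d"
proof -
  have im: "{lpt M a, lpt M b, lpt M c} = lpt M ` {a, b, c}" by simp
  show "convex hull {lpt M a, lpt M b, lpt M c} = rtri M d" unfolding im assms(4) by (rule rtri_hull)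
  then show "unit_triangle n M (lpt M a) (lpt M b) (lpt M c)"
    using rtri_subset_hexagon[OF assms(1,2)] assms by (auto simp: unit_triangle_def dist_lpt lpt_lattice)
qed

lemma unit_triangle_ltri:
  assumes "1 \<le> n" "0 \<le> M" "d \<in> lts n M" "{a, b, c} = ltri_corners d" "b - a \<in> unit_dirs" "c - a \<in> unit_dirs" "c - b \<in> unit_dirs"
  shows "unit_triangle n M (lpt M a) (lpt M b) (lpt M c)" "convex hull {lpt M a, lpt M b, lpt M c} = ltri M d"
proof -
  have im: "{lpt M a, lpt M b, lpt M c} = lpt M ` {a, b, c}" by simp
  show "convex hull {lpt M a, lpt M b, lpt M c} = ltri M d" unfolding im assms(4) by (rule ltri_hull)
  then show "unit_triangle n M (lpt M a) (lpt M b) (lpt M c)"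
    using ltri_subset_hexagon[OF assms(1,2)] assms by (auto simp: unit_triangle_def dist_lpt lpt_lattice)
qed

text \<open>Two different triangles of the same orientation share at most one corner, so a rhombus
  consists of one triangle of each orientation.\<close>

lemma rhombi_eq:
  assumes nM: "1 \<le> n" "0 \<le> M"
  shows "rhombi n M = rhomb M ` adjs n M"
proof (intro equalityI subsetI)
  fix R assume "R \<in> rhombi n M"
  then obtain p q r s where R: "R = convex hull {p, q, r} \<union> convex hull {p, q, s}"
    and pqr: "unit_triangle n M p q r" and pqs: "unit_triangle n M p q s" and "r \<noteq> s"
    unfolding rhombi_def by blast
  have "p \<in> range (lpt M)" "q \<in> range (lpt M)" "r \<in> range (lpt M)" "s \<in> range (lpt M)"
    using pqr pqs by (simp_all add: unit_triangle_def lpt_lattice)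
  then obtain a b c d where abcd: "p = lpt M a" "q = lpt M b" "r = lpt M c" "s = lpt M d"
    by (elim rangeE)
  have cd: "c \<noteq> d" using \<open>r \<noteq> s\<close> abcd by auto
  have ab: "a \<noteq> b" using pqr by (auto simp: unit_triangle_def abcd)
  obtain e where e: "{a, b, c} = rtri_corners e \<and> convex hull {lpt M a, lpt M b, lpt M c} = rtri M e \<and> e \<in> rts n M
    \<or> {a, b, c} = ltri_corners e \<and> convex hull {lpt M a, lpt M b, lpt M c} = ltri M e \<and> e \<in> lts n M"
    using unit_triangle_corners[OF pqr[unfolded abcd] nM] by (elim exE)
  obtain f where f: "{a, b, d} = rtri_corners f \<and> convex hull {lpt M a, lpt M b, lpt M d} = rtri M f \<and> f \<in> rts n M
    \<or> {a, b, d} = ltri_corners f \<and> convex hull {lpt M a, lpt M b, lpt M d} = ltri M f \<and> f \<in> lts n M"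
    using unit_triangle_corners[OF pqs[unfolded abcd] nM] by (elim exE)
  have ne: "{a, b, c} \<noteq> {a, b, d}"
  proof
    assume eq: "{a, b, c} = {a, b, d}"
    have "c \<noteq> a" "c \<noteq> b" using pqr by (auto simp: unit_triangle_def abcd)
    then show False using eq cd by auto
  qed
  have rr: "\<not> ({a, b, c} = rtri_corners e \<and> {a, b, d} = rtri_corners f)"
    and ll: "\<not> ({a, b, c} = ltri_corners e \<and> {a, b, d} = ltri_corners f)"
    using ne rtri_corners_eqI[OF ab, of e f] ltri_corners_eqI[OF ab, of e f] by (metis insert_mono subset_refl empty_subsetI insert_subset insertCI)+
  consider "{a, b, c} = rtri_corners e" "{a, b, d} = ltri_corners f" "R = rhomb M (e, f)" "e \<in> rts n M" "f \<in> lts n M"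
    | "{a, b, c} = ltri_corners e" "{a, b, d} = rtri_corners f" "R = rhomb M (f, e)" "e \<in> lts n M" "f \<in> rts n M"
    using e f rr ll unfolding R rhomb_def abcd by (metis Un_commute fst_conv snd_conv)
  then show "R \<in> rhomb M ` adjs n M"
  proof cases
    case 1
    then have "adj e f" using corners_adj[OF ab, of e f] by blast
    then show ?thesis using 1 by (auto simp: adjs_def)
  next
    case 2
    then have "adj f e" using corners_adj[OF ab, of f e] by blast
    then show ?thesis using 2 by (auto simp: adjs_def)
  qed
next
  fix R assume "R \<in> rhomb M ` adjs n M"
  then obtain z j b where a: "(z, j) \<in> rts n M" "b \<in> lts n M" "adj (z, j) b" and R: "R = rtri M (z, j) \<union> ltri M b"
    by (auto simp: adjs_def rhomb_def)
  have main: "R \<in> rhombi n M"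
    if "{p, q, r} = rtri_corners (z, j)" "{p, q, s} = ltri_corners b" "r \<noteq> s" "q - p \<in> unit_dirs" "r - p \<in> unit_dirs" "r - q \<in> unit_dirs"
      "s - p \<in> unit_dirs" "s - q \<in> unit_dirs" for p q r s
  proof -
    note r = unit_triangle_rtri[OF nM a(1) that(1,4,5,6)] and l = unit_triangle_ltri[OF nM a(2) that(2,4,7,8)]
    have "R = convex hull {lpt M p, lpt M q, lpt M r} \<union> convex hull {lpt M p, lpt M q, lpt M s}"
      unfolding r(2) l(2) R ..
    moreover have "lpt M r \<noteq> lpt M s" using that(3) by (simp add: lpt_inj)
    ultimately show ?thesis unfolding rhombi_def using r(1) l(1) by blast
  qed
  from a(3) consider "b = (z, j)" | "b = (z, j + 1)" | "b = (z + 1, j + 1)" by auto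
  then show "R \<in> rhombi n M"
  proof cases
    case 1
    show ?thesis by (rule main[of "(z, j)" "(z + 1, j)" "(z + 1, j + 1)" "(z, j - 1)"]) (auto simp: 1 unit_dirs_def)
  next
    case 2
    show ?thesis by (rule main[of "(z, j)" "(z + 1, j + 1)" "(z + 1, j)" "(z, j + 1)"]) (auto simp: 2 unit_dirs_def)
  next
    case 3
    show ?thesis by (rule main[of "(z + 1, j)" "(z + 1, j + 1)" "(z, j)" "(z + 2, j + 1)"]) (auto simp: 3 unit_dirs_def)
  qed
qed

text \<open>The centroids serve as test points: each lies in no other unit triangle, so it
  identifies the triangle, and later the tile, to which it belongs.\<close>

definition rcentre :: "int \<Rightarrow> int \<times> int \<Rightarrow> real \<times> real" where "rcentre M a = pt M (of_int (fst a) + 2 / 3) (of_int (snd a) + 1 / 3)"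
definition lcentre :: "int \<Rightarrow> int \<times> int \<Rightarrow> real \<times> real" where "lcentre M b = pt M (of_int (fst b) + 1 / 3) (of_int (snd b) - 1 / 3)"

lemma rcentre_rtri: "rcentre M a \<in> rtri M a' \<longleftrightarrow> a = a'" and rcentre_ltri: "rcentre M a \<notin> ltri M b"
  and lcentre_ltri: "lcentre M b \<in> ltri M b' \<longleftrightarrow> b = b'" and lcentre_rtri: "lcentre M b \<notin> rtri M a"
proof -
  have le: "i \<le> k" if "real_of_int i < real_of_int k + 1" for i k using that by linarith
  have "snd a' \<le> snd a \<and> fst a \<le> fst a' \<and> fst a' - snd a' \<le> fst a - snd a" if "rcentre M a \<in> rtri M a'"
    using that by (intro conjI le) (auto simp: rcentre_def rtri_def)
  then show "rcentre M a \<in> rtri M a' \<longleftrightarrow> a = a'" by (auto simp: rcentre_def rtri_def prod_eq_iff)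
  have "snd b \<le> snd b' \<and> fst b' \<le> fst b \<and> fst b - snd b \<le> fst b' - snd b'" if "lcentre M b \<in> ltri M b'"
    using that by (intro conjI le) (auto simp: lcentre_def ltri_def)
  then show "lcentre M b \<in> ltri M b' \<longleftrightarrow> b = b'" by (auto simp: lcentre_def ltri_def prod_eq_iff)
  have "snd a + 1 \<le> snd b \<and> fst b \<le> fst a \<and> fst a - snd a \<le> fst b - snd b" if "rcentre M a \<in> ltri M b"
    using that by (intro conjI le) (auto simp: rcentre_def ltri_def)
  then show "rcentre M a \<notin> ltri M b" by auto
  have "snd a + 1 \<le> snd b \<and> fst b \<le> fst a \<and> fst a - snd a \<le> fst b - snd b" if "lcentre M b \<in> rtri M a"
    using that by (intro conjI le) (auto simp: lcentre_def rtri_def)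
  then show "lcentre M b \<notin> rtri M a" by auto
qed

section \<open>Interiors of triangles and rhombi\<close>

lemma continuous_ucoord [continuous_intros]: "continuous_on S ucoord" and continuous_vcoord [continuous_intros]: "continuous_on S (vcoord M)"
  unfolding ucoord_def vcoord_def by (intro continuous_intros; simp)+

lemma closed_rtri: "closed (rtri M a)" and closed_ltri: "closed (ltri M a)"
  unfolding rtri_def ltri_def by (intro closed_Collect_conj closed_Collect_le continuous_intros)+

lemma rcentre_interior: "rcentre M a \<in> interior (rtri M a)"
proof (rule interiorI)
  show "open {p. of_int (snd a) < ucoord p \<and> vcoord M p < of_int (fst a) + 1 \<and> real_of_int (fst a) - of_int (snd a) < vcoord M p - ucoord p}"
    by (intro open_Collect_conj open_Collect_less continuous_intros)
qed (auto simp: rcentre_def rtri_def)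

lemma lcentre_interior: "lcentre M b \<in> interior (ltri M b)"
proof (rule interiorI)
  show "open {p. ucoord p < of_int (snd b) \<and> of_int (fst b) < vcoord M p \<and> vcoord M p - ucoord p < real_of_int (fst b) + 1 - of_int (snd b)}"
    by (intro open_Collect_conj open_Collect_less continuous_intros)
qed (auto simp: lcentre_def ltri_def)

lemma interior_lines: "interior {p. ucoord p = c} = {}" "interior {p. vcoord M p = c} = {}" "interior {p. vcoord M p - ucoord p = c} = {}"
proof -
  have "{p. ucoord p = c} = {p. (2 / sqrt 3, 0) \<bullet> p = c}" by (auto simp: ucoord_def inner_prod_def)
  then show "interior {p. ucoord p = c} = {}" using interior_hyperplane[of "(2 / sqrt 3, 0)" c] by (simp add: zero_prod_def)
  have "{p. vcoord M p = c} = {p. (1 / sqrt 3, - 1) \<bullet> p = c - M / 2}" by (auto simp: vcoord_def inner_prod_def)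
  then show "interior {p. vcoord M p = c} = {}" using interior_hyperplane[of "(1 / sqrt 3, - 1)" "c - M / 2"] by (simp add: zero_prod_def)
  have "{p. vcoord M p - ucoord p = c} = {p. (- 1 / sqrt 3, - 1) \<bullet> p = c - M / 2}" by (auto simp: ucoord_def vcoord_def inner_prod_def algebra_simps)
  then show "interior {p. vcoord M p - ucoord p = c} = {}" using interior_hyperplane[of "(- 1 / sqrt 3, - 1)" "c - M / 2"] by (simp add: zero_prod_def)
qed

text \<open>Two different unit slabs of the same direction meet in at most a line, and a line has
  empty interior. Each of the three lattice directions will be used for \<open>f\<close>.\<close>

lemma interior_slabs:
  fixes f :: "real \<times> real \<Rightarrow> real" and i i' :: int
  assumes "\<And>c. interior {p. f p = c} = {}" and "i \<noteq> i'"
    and "\<And>p. p \<in> S \<Longrightarrow> i \<le> f p \<and> f p \<le> i + 1" "\<And>p. p \<in> S' \<Longrightarrow> i' \<le> f p \<and> f p \<le> i' + 1"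
  shows "interior (S \<inter> S') = {}"
proof -
  have "S \<inter> S' \<subseteq> {p. f p = max i i'}"
  proof
    fix p assume "p \<in> S \<inter> S'"
    then have "i \<le> f p" "f p \<le> i + 1" "i' \<le> f p" "f p \<le> i' + 1" using assms(3,4) by auto
    moreover have "i + 1 \<le> i' \<or> i' + 1 \<le> i" using assms(2) by linarith
    then have "real_of_int i + 1 \<le> i' \<or> real_of_int i' + 1 \<le> i" by linarith
    ultimately show "p \<in> {p. f p = max i i'}" by auto
  qed
  then have "interior (S \<inter> S') \<subseteq> interior {p. f p = max i i'}" by (rule interior_mono)
  then show ?thesis using assms(1) by simp
qed

lemma rtri_slabs: "p \<in> rtri M a \<Longrightarrow> of_int (snd a) \<le> ucoord p \<and> ucoord p \<le> of_int (snd a) + 1 \<and> of_int (fst a) \<le> vcoord M p \<and> vcoord M p \<le> of_int (fst a) + 1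
    \<and> real_of_int (fst a - snd a) \<le> vcoord M p - ucoord p \<and> vcoord M p - ucoord p \<le> real_of_int (fst a - snd a) + 1"
  and ltri_slabs: "p \<in> ltri M a \<Longrightarrow> real_of_int (snd a - 1) \<le> ucoord p \<and> ucoord p \<le> real_of_int (snd a - 1) + 1 \<and> of_int (fst a) \<le> vcoord M p \<and> vcoord M p \<le> of_int (fst a) + 1
    \<and> real_of_int (fst a - snd a) \<le> vcoord M p - ucoord p \<and> vcoord M p - ucoord p \<le> real_of_int (fst a - snd a) + 1"
  by (auto simp: rtri_def ltri_def)

lemma interior_rtri_rtri: "a \<noteq> a' \<Longrightarrow> interior (rtri M a \<inter> rtri M a') = {}"
proof (cases "snd a = snd a'")
  case False
  show ?thesis by (rule interior_slabs[OF interior_lines(1) False]) (auto dest!: rtri_slabs)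
next
  case True
  moreover assume "a \<noteq> a'"
  ultimately have "fst a \<noteq> fst a'" by (auto simp: prod_eq_iff)
  then show ?thesis by (rule interior_slabs[OF interior_lines(2)[of M]]) (auto dest!: rtri_slabs)
qed

lemma interior_ltri_ltri: "a \<noteq> a' \<Longrightarrow> interior (ltri M a \<inter> ltri M a') = {}"
proof (cases "snd a = snd a'")
  case False
  then have "snd a - 1 \<noteq> snd a' - 1" by simp
  then show ?thesis by (rule interior_slabs[OF interior_lines(1)]) (auto dest!: ltri_slabs)
next
  case True
  moreover assume "a \<noteq> a'"
  ultimately have "fst a \<noteq> fst a'" by (auto simp: prod_eq_iff)
  then show ?thesis by (rule interior_slabs[OF interior_lines(2)[of M]]) (auto dest!: ltri_slabs)
qed

lemma interior_rtri_ltri: "interior (rtri M a \<inter> ltri M b) = {}"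
proof -
  \<comment> \<open>A left and a right triangle cannot lie in the same slab for all three
    directions: equality in the first two forces the third labels to differ by 1.\<close>
  consider "snd a \<noteq> snd b - 1" | "fst a \<noteq> fst b" | "fst a - snd a \<noteq> fst b - snd b" by linarith
  then show ?thesis
  proof cases
    case 1
    then show ?thesis by (rule interior_slabs[OF interior_lines(1)]) (auto dest!: rtri_slabs ltri_slabs)
  next
    case 2
    then show ?thesis by (rule interior_slabs[OF interior_lines(2)[of M]]) (auto dest!: rtri_slabs ltri_slabs)
  next
    case 3
    then show ?thesis
      by (rule interior_slabs[OF interior_lines(3)[of M]]) (auto dest!: rtri_slabs ltri_slabs)
  qed
qed

lemma interior_Un_empty:
  "closed S \<Longrightarrow> interior S = {} \<Longrightarrow> interior T = {} \<Longrightarrow> interior (S \<union> T) = {}"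
  by (simp add: interior_closed_Un_empty_interior)

lemma interior_rhomb_disjoint:
  assumes "a \<noteq> a'" "b \<noteq> b'"
  shows "interior (rhomb M (a, b)) \<inter> interior (rhomb M (a', b')) = {}"
proof -
  have "rhomb M (a, b) \<inter> rhomb M (a', b') = (rtri M a \<inter> rtri M a') \<union> ((rtri M a \<inter> ltri M b') \<union> ((rtri M a' \<inter> ltri M b) \<union> (ltri M b \<inter> ltri M b')))"
    by (auto simp: rhomb_def)
  also have "interior \<dots> = {}"
    by (intro interior_Un_empty closed_Int closed_rtri closed_ltri interior_rtri_rtri interior_ltri_ltri interior_rtri_ltri assms)
  finally show ?thesis by (simp add: interior_Int)
qed

text \<open>The perfect matchings of the adjacency graph between right and left triangles.\<close>

definition matchings :: "int \<Rightarrow> int \<Rightarrow> ((int \<times> int) \<times> (int \<times> int)) set set" where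
  "matchings n M = {E. E \<subseteq> adjs n M \<and> (\<forall>a\<in>rts n M. \<exists>!b. (a, b) \<in> E) \<and> (\<forall>b\<in>lts n M. \<exists>!a. (a, b) \<in> E)}"

lemma rcentre_rhomb: "rcentre M a \<in> rhomb M (a', b) \<longleftrightarrow> a = a'" and lcentre_rhomb: "lcentre M b \<in> rhomb M (a, b') \<longleftrightarrow> b = b'"
  by (simp_all add: rhomb_def rcentre_rtri rcentre_ltri lcentre_rtri lcentre_ltri)

lemma rcentre_interior_rhomb: "rcentre M a \<in> interior (rhomb M (a, b))" and lcentre_interior_rhomb: "lcentre M b \<in> interior (rhomb M (a, b))"
  using rcentre_interior[of M a] lcentre_interior[of M b] interior_mono[of "rtri M a" "rhomb M (a, b)"] interior_mono[of "ltri M b" "rhomb M (a, b)"]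
  by (auto simp: rhomb_def)

lemma inj_rhomb: "inj (rhomb M)"
proof (rule injI)
  fix x y assume eq: "rhomb M x = rhomb M y"
  have "rcentre M (fst x) \<in> rhomb M y" "lcentre M (snd x) \<in> rhomb M y"
    unfolding eq[symmetric] by (cases x, simp add: rcentre_rhomb lcentre_rhomb)+
  then show "x = y" by (cases x; cases y) (simp add: rcentre_rhomb lcentre_rhomb)
qed

text \<open>The integer parts of the coordinates select a lattice cell, which its diagonal divides
  into a right and a left triangle; points on the boundary need a neighbouring cell.\<close>

lemma hexagon_covered:
  assumes nM: "1 \<le> n" "0 \<le> M" and p: "p \<in> hexagon n M"
  shows "(\<exists>a\<in>rts n M. p \<in> rtri M a) \<or> (\<exists>b\<in>lts n M. p \<in> ltri M b)"
proof -
  define u v where "u = ucoord p" and "v = vcoord M p"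
  have uv: "0 \<le> u" "u \<le> 2 * n" "0 \<le> v" "v \<le> real_of_int M + n" "- n \<le> v - u" "v - u \<le> M"
    using p unfolding hexagon_eq[OF nM] by (auto simp: hexagon_ineq_def u_def v_def)
  define j z where "j = \<lfloor>u\<rfloor>" and "z = \<lfloor>v\<rfloor>"
  have jz: "j \<le> u" "u < j + 1" "z \<le> v" "v < z + 1" by (auto simp: j_def z_def)
  have rtI: "?thesis" if "(z', j') \<in> rts n M" "j' \<le> u" "v \<le> z' + 1" "real_of_int z' - j' \<le> v - u" for z' j'
    using that by (intro disjI1 bexI[of _ "(z', j')"]) (auto simp: rtri_def u_def v_def)
  have ltI: "?thesis" if "(z', j') \<in> lts n M" "u \<le> j'" "z' \<le> v" "v - u \<le> real_of_int z' + 1 - j'" for z' j'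
    using that by (intro disjI2 bexI[of _ "(z', j')"]) (auto simp: ltri_def u_def v_def)
  \<comment> \<open>On the sides \<open>u = 2 * n\<close> and \<open>v = M + n\<close> the integer
    parts would select a cell outside. For \<open>M = 0\<close> the line \<open>u = 2 * n\<close>
    meets the hexagon in a single vertex and carries no vertical edge.\<close>
  consider "u = 2 * n" "1 \<le> M" | "u = 2 * n" "M = 0" | "u < 2 * n" "v = real_of_int M + n" | "u < 2 * n" "v < real_of_int M + n"
    using uv nM by linarith
  then show ?thesis
  proof cases
    case 1
    define z' where "z' = min z (n + M - 1)"
    have "real_of_int n \<le> v" using uv 1 by simp
    then have "n \<le> z" by (simp add: z_def le_floor_iff)
    then have "(z', 2 * n) \<in> lts n M" using 1 nM by (auto simp: lts_def edges_def z'_def)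
    moreover have "z' \<le> v" using jz by (auto simp: z'_def min_def)
    moreover have "v \<le> z' + 1" using jz uv by (auto simp: z'_def min_def)
    ultimately show ?thesis using 1 by (intro ltI) auto
  next
    case 2
    then have "v = n" using uv by simp
    then show ?thesis using 2 nM by (intro rtI[of "n - 1" "2 * n - 1"]) (auto simp: rts_def edges_def)
  next
    case 3
    have "j < 2 * n" using 3 by (simp add: j_def floor_less_iff)
    moreover have "real_of_int n \<le> u" using uv 3 by simp
    then have "n \<le> j" by (simp add: j_def le_floor_iff)
    ultimately have "(M + n - 1, j) \<in> rts n M" using nM by (auto simp: rts_def edges_def)
    then show ?thesis using 3 jz by (intro rtI) auto
  next
    case 4
    have j: "0 \<le> j" "j < 2 * n" using uv 4 by (auto simp: j_def floor_less_iff)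
    have z: "0 \<le> z" "z < M + n" using uv 4 by (auto simp: z_def floor_less_iff)
    have "real_of_int (- n) < z - j + 1" "real_of_int (z - j) < M + 1" using uv jz by simp_all
    then have d: "- n \<le> z - j" "z - j \<le> M" by linarith+
    show ?thesis
    proof (cases "real_of_int z - j \<le> v - u")
      case True
      show ?thesis
      proof (cases "z - j < M")
        case True
        then have "(z, j) \<in> rts n M" using j z d by (auto simp: rts_def edges_def)
        then show ?thesis using jz \<open>real_of_int z - j \<le> v - u\<close> by (intro rtI) auto
      next
        case False
        \<comment> \<open>The point is on the side \<open>v - u = M\<close> and belongs to a left
          triangle along this side.\<close>
        then have "z - j = M" using d by simp
        then have "v - u = real_of_int z - j" using True uv by simp
        moreover have "(z, j + 1) \<in> lts n M" using j z d nM \<open>z - j = M\<close> by (auto simp: lts_def edges_def)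
        ultimately show ?thesis using jz by (intro ltI) auto
      qed
    next
      case False
      then have "real_of_int (- n) < z - j" using uv by simp
      then have "- n < z - j" by linarith
      then have "(z, j + 1) \<in> lts n M" using j z d by (auto simp: lts_def edges_def)
      then show ?thesis using jz False by (intro ltI) auto
    qed
  qed
qed

text \<open>A centroid is an interior point of every rhombus containing its triangle: the covering
  property yields a partner for the triangle, and disjointness of interiors makes the partner
  unique.\<close>

lemma tilings_eq:
  assumes nM: "1 \<le> n" "0 \<le> M"
  shows "rhombus_tilings n M = (\<lambda>E. rhomb M ` E) ` matchings n M"
proof (intro equalityI subsetI)
  fix T assume "T \<in> rhombus_tilings n M"
  then have T: "T \<subseteq> rhomb M ` adjs n M" "pairwise (\<lambda>R S. interior R \<inter> interior S = {}) T" "\<Union>T = hexagon n M"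
    by (auto simp: rhombus_tilings_def rhombi_eq[OF nM])
  define E where "E = {x \<in> adjs n M. rhomb M x \<in> T}"
  have TE: "T = rhomb M ` E" using T(1) by (auto simp: E_def)
  have dis: "x = y" if "x \<in> E" "y \<in> E" "q \<in> interior (rhomb M x)" "q \<in> interior (rhomb M y)" for x y q
  proof (rule ccontr)
    assume "x \<noteq> y"
    then have "rhomb M x \<noteq> rhomb M y" using inj_rhomb by (auto dest: injD)
    then have "interior (rhomb M x) \<inter> interior (rhomb M y) = {}"
      using T(2) that(1,2) unfolding TE pairwise_def by blast
    then show False using that by blast
  qed
  have "E \<in> matchings n M"
    unfolding matchings_def mem_Collect_eq
  proof (intro conjI ballI)
    show "E \<subseteq> adjs n M" by (auto simp: E_def)
    fix a assume a: "a \<in> rts n M"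
    have "rcentre M a \<in> rtri M a" by (simp add: rcentre_rtri)
    then have "rcentre M a \<in> hexagon n M" using rtri_subset_hexagon[OF nM] a by blast
    then have "rcentre M a \<in> \<Union>(rhomb M ` E)" using T(3) TE by simp
    then obtain x where "x \<in> E" "rcentre M a \<in> rhomb M x" by blast
    then have "(a, snd x) \<in> E" by (cases x) (auto simp: rcentre_rhomb)
    then show "\<exists>!b. (a, b) \<in> E" using dis[OF _ _ rcentre_interior_rhomb rcentre_interior_rhomb] by blast
  next
    fix b assume b: "b \<in> lts n M"
    have "lcentre M b \<in> ltri M b" by (simp add: lcentre_ltri)
    then have "lcentre M b \<in> hexagon n M" using ltri_subset_hexagon[OF nM] b by blast
    then have "lcentre M b \<in> \<Union>(rhomb M ` E)" using T(3) TE by simp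
    then obtain x where "x \<in> E" "lcentre M b \<in> rhomb M x" by blast
    then have "(fst x, b) \<in> E" by (cases x) (auto simp: lcentre_rhomb)
    then show "\<exists>!a. (a, b) \<in> E" using dis[OF _ _ lcentre_interior_rhomb lcentre_interior_rhomb] by blast
  qed
  then show "T \<in> (\<lambda>E. rhomb M ` E) ` matchings n M" using TE by blast
next
  fix T assume "T \<in> (\<lambda>E. rhomb M ` E) ` matchings n M"
  then obtain E where T: "T = rhomb M ` E" and E: "E \<subseteq> adjs n M" "\<And>a. a \<in> rts n M \<Longrightarrow> \<exists>!b. (a, b) \<in> E" "\<And>b. b \<in> lts n M \<Longrightarrow> \<exists>!a. (a, b) \<in> E"
    by (auto simp: matchings_def)
  have in_sets: "a \<in> rts n M" "b \<in> lts n M" if "(a, b) \<in> E" for a b using that E(1) by (auto simp: adjs_def)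
  have "T \<subseteq> rhombi n M" using E(1) by (auto simp: T rhombi_eq[OF nM])
  moreover have "pairwise (\<lambda>R S. interior R \<inter> interior S = {}) T"
    unfolding pairwise_def T
  proof (clarify)
    fix a b a' b' assume x: "(a, b) \<in> E" "(a', b') \<in> E" "rhomb M (a, b) \<noteq> rhomb M (a', b')"
    then have "(a, b) \<noteq> (a', b')" by auto
    then have "a \<noteq> a'" "b \<noteq> b'" using x(1,2) E(2)[OF in_sets(1)[OF x(1)]] E(3)[OF in_sets(2)[OF x(1)]] by blast+
    then show "interior (rhomb M (a, b)) \<inter> interior (rhomb M (a', b')) = {}" by (rule interior_rhomb_disjoint)
  qed
  moreover have "\<Union>T = hexagon n M"
  proof
    show "\<Union>T \<subseteq> hexagon n M"
    proof
      fix p assume "p \<in> \<Union>T"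
      then obtain a b where "(a, b) \<in> E" "p \<in> rtri M a \<or> p \<in> ltri M b" by (auto simp: T rhomb_def)
      then show "p \<in> hexagon n M"
        using in_sets rtri_subset_hexagon[OF nM, of a] ltri_subset_hexagon[OF nM, of b] by blast
    qed
    show "hexagon n M \<subseteq> \<Union>T"
    proof
      fix p assume "p \<in> hexagon n M"
      from hexagon_covered[OF nM this] show "p \<in> \<Union>T"
      proof
        assume "\<exists>a\<in>rts n M. p \<in> rtri M a"
        then obtain a b where "(a, b) \<in> E" "p \<in> rtri M a" using E(2) by blast
        then show ?thesis unfolding T by (auto simp: rhomb_def intro!: bexI[of _ "(a, b)"])
      next
        assume "\<exists>b\<in>lts n M. p \<in> ltri M b"
        then obtain a b where "(a, b) \<in> E" "p \<in> ltri M b" using E(3) by blast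
        then show ?thesis unfolding T by (auto simp: rhomb_def intro!: bexI[of _ "(a, b)"])
      qed
    qed
  qed
  ultimately show "T \<in> rhombus_tilings n M" by (simp add: rhombus_tilings_def)
qed

lemma card_tilings:
  assumes nM: "1 \<le> n" "0 \<le> M"
  shows "card (rhombus_tilings n M) = card (matchings n M)"
    and "card {T \<in> rhombus_tilings n M. rhomb M x \<in> T} = card {E \<in> matchings n M. x \<in> E}"
proof -
  have inj: "inj_on (\<lambda>E. rhomb M ` E) A" for A
    using inj_image_eq_iff[OF inj_rhomb[of M]] by (auto intro: inj_onI)
  show "card (rhombus_tilings n M) = card (matchings n M)"
    unfolding tilings_eq[OF nM] by (rule card_image[OF inj])
  have "{T \<in> rhombus_tilings n M. rhomb M x \<in> T} = (\<lambda>E. rhomb M ` E) ` {E \<in> matchings n M. x \<in> E}"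
    unfolding tilings_eq[OF nM] using inj_image_mem_iff[OF inj_rhomb[of M], of x] by auto
  then show "card {T \<in> rhombus_tilings n M. rhomb M x \<in> T} = card {E \<in> matchings n M. x \<in> E}"
    by (simp add: card_image[OF inj])
qed

subsection \<open>Tilings as chains of particle configurations\<close>

text \<open>At the least point \<open>x\<close> of disagreement one map fixes \<open>x\<close>, and
  the other must reach \<open>x\<close> from some smaller \<open>w\<close>. There the maps agree, so
  the first one would send both \<open>w\<close> and \<open>x\<close> to \<open>x\<close>.\<close>

lemma unit_shift_bij_unique:
  assumes "finite P" and f: "bij_betw f P Q" "\<And>z. z \<in> P \<Longrightarrow> f z = z \<or> f z = z + 1"
    and g: "bij_betw g P Q" "\<And>z. z \<in> P \<Longrightarrow> g z = z \<or> g z = z + (1::int)"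
    and "z \<in> P"
  shows "f z = g z"
proof (rule ccontr)
  assume "f z \<noteq> g z"
  define D where "D = {z \<in> P. f z \<noteq> g z}"
  have D: "finite D" "D \<noteq> {}" using assms \<open>f z \<noteq> g z\<close> by (auto simp: D_def)
  define x where "x = Min D"
  have x: "x \<in> P" "f x \<noteq> g x" using Min_in[OF D] by (auto simp: D_def x_def)
  have least: "f y = g y" if "y \<in> P" "y < x" for y
    using Min_le[OF D(1), of y] that by (auto simp: D_def x_def)
  have aux: False
    if f: "bij_betw f P Q" "f x = x" and g: "bij_betw g P Q" "\<And>z. z \<in> P \<Longrightarrow> g z = z \<or> g z = z + 1"
      and "g x \<noteq> x" and eq: "\<And>y. y \<in> P \<Longrightarrow> y < x \<Longrightarrow> f y = g y" for f g
  proof -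
    have "x \<in> Q" using bij_betwE[OF f(1)] f(2) x(1) by metis
    then obtain w where w: "w \<in> P" "g w = x" using g(1) by (auto simp: bij_betw_def)
    then have "w < x" using g(2)[of w] \<open>g x \<noteq> x\<close> by (cases "w = x") auto
    then have "f w = f x" using eq w f(2) by simp
    then show False using f(1) w(1) x(1) \<open>w < x\<close> by (auto simp: bij_betw_def dest: inj_onD)
  qed
  show False
  proof (cases "f x = x")
    case True
    then show ?thesis using aux[OF f(1) _ g] least x by auto
  next
    case False
    then have "g x = x" using f(2)[OF x(1)] g(2)[OF x(1)] x(2) by auto
    then show ?thesis using aux[OF g(1) _ f] least x by auto
  qed
qed

text \<open>The particles on line \<open>i\<close>; beyond the last line the slices are constant, as walks are.\<close>

definition slice :: "nat \<Rightarrow> nat \<Rightarrow> ((int \<times> int) \<times> (int \<times> int)) set \<Rightarrow> nat \<Rightarrow> int set" where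
  "slice n M E i = (let j = int (min i (2 * n)) in
     {z. (z, j) \<in> edges (int n) (int M) \<and> ((z, j), (z, j)) \<notin> E})"

text \<open>The right triangle at a particle is not matched across its vertical side, so its partner
  belongs to the next line. Likewise the left triangle at a particle on the next line has its
  partner on line \<open>i\<close>, which gives surjectivity.\<close>

lemma slice_bij:
  assumes E: "E \<in> matchings (int n) (int M)" and i: "i < 2 * n"
  shows "\<exists>f. bij_betw f (slice n M E i) (slice n M E (Suc i)) \<and>
    (\<forall>z\<in>slice n M E i. (f z = z \<or> f z = z + 1) \<and> (\<forall>b. ((z, int i), b) \<in> E \<longleftrightarrow> b = (f z, int i + 1)))"
proof -
  have EE: "E \<subseteq> adjs (int n) (int M)" "\<And>a. a \<in> rts (int n) (int M) \<Longrightarrow> \<exists>!b. (a, b) \<in> E"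
     "\<And>b. b \<in> lts (int n) (int M) \<Longrightarrow> \<exists>!a. (a, b) \<in> E"
    using E by (auto simp: matchings_def)
  have ul: "a = a'" if "(a, b) \<in> E" "(a', b) \<in> E" for a a' b
  proof -
    have "b \<in> lts (int n) (int M)" using that(1) EE(1) by (auto simp: adjs_def)
    then show ?thesis using EE(3) that by blast
  qed
  have ur: "b = b'" if "(a, b) \<in> E" "(a, b') \<in> E" for a b b'
  proof -
    have "a \<in> rts (int n) (int M)" using that(1) EE(1) by (auto simp: adjs_def)
    then show ?thesis using EE(2) that by blast
  qed
  have sl: "slice n M E i = {z. (z, int i) \<in> edges (int n) (int M) \<and> ((z, int i), (z, int i)) \<notin> E}"
    "slice n M E (Suc i) = {z. (z, int i + 1) \<in> edges (int n) (int M) \<and> ((z, int i + 1), (z, int i + 1)) \<notin> E}"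
    using i by (auto simp: slice_def min_def Let_def add.commute)
  have ex: "\<exists>z'. (z' = z \<or> z' = z + 1) \<and> (\<forall>b. ((z, int i), b) \<in> E \<longleftrightarrow> b = (z', int i + 1))"
    if z: "z \<in> slice n M E i" for z
  proof -
    have "(z, int i) \<in> rts (int n) (int M)" using z i by (auto simp: sl rts_def)
    then obtain b where b: "((z, int i), b) \<in> E" "\<And>b'. ((z, int i), b') \<in> E \<Longrightarrow> b' = b" using EE(2) by blast
    have "adj (z, int i) b" "b \<noteq> (z, int i)" using b(1) EE(1) z by (auto simp: adjs_def sl)
    then obtain z' where z': "b = (z', int i + 1)" "z' = z \<or> z' = z + 1" by auto
    show ?thesis
    proof (intro exI[of _ z'] conjI allI iffI)
      fix b' assume "((z, int i), b') \<in> E"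
      then show "b' = (z', int i + 1)" using b(2) z'(1) by simp
    qed (use b(1) z' in simp_all)
  qed
  then obtain f where f: "\<And>z. z \<in> slice n M E i \<Longrightarrow> (f z = z \<or> f z = z + 1) \<and> (\<forall>b. ((z, int i), b) \<in> E \<longleftrightarrow> b = (f z, int i + 1))"
    by metis
  have fE: "((z, int i), (f z, int i + 1)) \<in> E" "(f z, int i + 1) \<in> lts (int n) (int M)" if "z \<in> slice n M E i" for z
    using f[OF that] EE(1) by (auto simp: adjs_def)
  have "bij_betw f (slice n M E i) (slice n M E (Suc i))"
  proof (rule bij_betw_imageI)
    show "inj_on f (slice n M E i)"
    proof (rule inj_onI)
      fix z w assume zw: "z \<in> slice n M E i" "w \<in> slice n M E i" "f z = f w"
      then have "(z, int i) = (w, int i)"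
        using ul[OF fE(1)[OF zw(1)]] fE(1)[OF zw(2)] by simp
      then show "z = w" by simp
    qed
    show "f ` slice n M E i = slice n M E (Suc i)"
    proof (intro equalityI subsetI)
      fix w assume "w \<in> f ` slice n M E i"
      then obtain z where z: "z \<in> slice n M E i" "w = f z" by auto
      have "((w, int i + 1), (w, int i + 1)) \<notin> E"
        using ul[OF fE(1)[OF z(1)], of "(w, int i + 1)"] z(2) by auto
      then show "w \<in> slice n M E (Suc i)" using fE(2)[OF z(1)] z(2) by (auto simp: sl lts_def)
    next
      fix w assume w: "w \<in> slice n M E (Suc i)"
      then have "(w, int i + 1) \<in> lts (int n) (int M)" by (auto simp: sl lts_def)
      then obtain a where a: "(a, (w, int i + 1)) \<in> E" using EE(3) by blast
      have "adj a (w, int i + 1)" "a \<in> rts (int n) (int M)" "a \<noteq> (w, int i + 1)"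
        using a EE(1) w by (auto simp: adjs_def sl)
      then obtain z where z: "a = (z, int i)" by (cases a) auto
      have "((z, int i), (z, int i)) \<notin> E"
        using ur[OF a[unfolded z], of "(z, int i)"] by auto
      then have zs: "z \<in> slice n M E i" using \<open>a \<in> rts _ _\<close> unfolding z by (auto simp: sl rts_def)
      then have "w = f z" using f[OF zs] a unfolding z by auto
      then show "w \<in> f ` slice n M E i" using zs by blast
    qed
  qed
  then show ?thesis using f by blast
qed

lemma finite_slice: "finite (slice n M E i)"
proof (rule finite_subset)
  show "slice n M E i \<subseteq> {0..int M + int n}" by (auto simp: slice_def edges_def Let_def)
qed simp

text \<open>On the first and on the last line one triangle at each vertical edge is outside the
  hexagon, so every edge there is a particle.\<close>

lemma slice_ends:
  assumes "E \<in> matchings (int n) (int M)"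
  shows "slice n M E 0 = {0..<int M}" "i \<ge> 2 * n \<Longrightarrow> slice n M E i = {int n..<int n + int M}"
proof -
  have "E \<subseteq> adjs (int n) (int M)" using assms by (auto simp: matchings_def)
  then have "((z, 0), (z, 0)) \<notin> E" "((z, 2 * int n), (z, 2 * int n)) \<notin> E" for z
    by (auto simp: adjs_def rts_def lts_def)
  then show "slice n M E 0 = {0..<int M}" "i \<ge> 2 * n \<Longrightarrow> slice n M E i = {int n..<int n + int M}"
    by (auto simp: slice_def edges_def min_def)
qed

lemma slice_walk:
  assumes E: "E \<in> matchings (int n) (int M)"
  shows "slice n M E \<in> walks step {0..<int M} {int n..<int n + int M} (2 * n)"
proof (rule walksI)
  fix i assume "i < 2 * n"
  from slice_bij[OF E this] show "step (slice n M E i) (slice n M E (Suc i))"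
    unfolding step_def using finite_slice by blast
qed (use slice_ends[OF E] in auto)

text \<open>The holes determine the tiles with vertical short diagonal; for the other tiles the
  positions on successive lines force the moves, by \<open>unit_shift_bij_unique\<close>.\<close>

lemma slice_inj: "inj_on (slice n M) (matchings (int n) (int M))"
proof (rule inj_onI)
  have sub: "E \<subseteq> E'" if E: "E \<in> matchings (int n) (int M)" and E': "E' \<in> matchings (int n) (int M)"
    and eq: "slice n M E = slice n M E'" for E E'
  proof
    fix x assume x: "x \<in> E"
    then have "x \<in> adjs (int n) (int M)" using E by (auto simp: matchings_def)
    then obtain z j b where xs: "x = ((z, j), b)" and a: "(z, j) \<in> rts (int n) (int M)" and adj: "adj (z, j) b"
      by (auto simp: adjs_def)
    define i where "i = nat j"
    have i: "j = int i" "i < 2 * n" using a by (auto simp: rts_def edges_def i_def)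
    have e: "(z, int i) \<in> edges (int n) (int M)" using a i by (auto simp: rts_def)
    have sl: "z \<in> slice n M F i \<longleftrightarrow> ((z, int i), (z, int i)) \<notin> F" for F
      using e i(2) by (simp add: slice_def min_def Let_def)
    show "x \<in> E'"
    proof (cases "b = (z, j)")
      case True
      then show ?thesis using x sl[of E] sl[of E'] eq unfolding xs i(1) by simp
    next
      case False
      obtain f where f: "bij_betw f (slice n M E i) (slice n M E (Suc i))"
        "\<And>z. z \<in> slice n M E i \<Longrightarrow> (f z = z \<or> f z = z + 1) \<and> (\<forall>b. ((z, int i), b) \<in> E \<longleftrightarrow> b = (f z, int i + 1))"
        using slice_bij[OF E i(2)] by blast
      obtain g where g: "bij_betw g (slice n M E' i) (slice n M E' (Suc i))"
        "\<And>z. z \<in> slice n M E' i \<Longrightarrow> (g z = z \<or> g z = z + 1) \<and> (\<forall>b. ((z, int i), b) \<in> E' \<longleftrightarrow> b = (g z, int i + 1))"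
        using slice_bij[OF E' i(2)] by blast
      have "\<exists>!b. ((z, j), b) \<in> E" using E a by (auto simp: matchings_def)
      then have "((z, j), (z, j)) \<notin> E" using x False unfolding xs by blast
      then have zs: "z \<in> slice n M E i" using sl[of E] i by simp
      have "f z = g z"
        by (rule unit_shift_bij_unique[OF finite_slice f(1) _ g(1)[folded eq] _ zs]) (use f(2) g(2) eq in auto)
      moreover have "b = (f z, int i + 1)" using f(2)[OF zs] x unfolding xs i(1) by blast
      ultimately show ?thesis using g(2)[of z] zs unfolding eq xs i(1) by simp
    qed
  qed
  fix E E' assume "E \<in> matchings (int n) (int M)" "E' \<in> matchings (int n) (int M)" "slice n M E = slice n M E'"
  then show "E = E'" using sub[of E E'] sub[of E' E] by auto
qed

text \<open>Two of the bounds defining the hexagon propagate forward from the initial configuration,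
  the other two backward from the final one; \<open>hi\<close> is therefore indexed by the distance
  to the end.\<close>

lemma walk_in_edges:
  assumes s: "s \<in> walks step {0..<int M} {int n..<int n + int M} (2 * n)" and i: "i \<le> 2 * n" and z: "z \<in> s i"
  shows "(z, int i) \<in> edges (int n) (int M)"
proof -
  have st: "step (s i) (s (Suc i))" if "i < 2 * n" for i using walksD(2)[OF s that] .
  have lo: "\<forall>z\<in>s i. 0 \<le> z \<and> z + 1 - int i \<le> int M" if "i \<le> 2 * n" for i
    using that
  proof (induction i)
    case 0
    then show ?case using walksD(1)[OF s] by auto
  next
    case (Suc i)
    obtain f where f: "bij_betw f (s i) (s (Suc i))" "\<forall>z\<in>s i. f z = z \<or> f z = z + 1"
      using st[of i] Suc.prems by (auto simp: step_def)
    show ?case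
    proof
      fix w assume "w \<in> s (Suc i)"
      then obtain z where "z \<in> s i" "w = f z" using f(1) by (auto simp: bij_betw_def)
      then show "0 \<le> w \<and> w + 1 - int (Suc i) \<le> int M" using f(2) Suc by force
    qed
  qed
  have hi: "\<forall>z\<in>s (2 * n - k). z + 1 \<le> int M + int n \<and> - int n \<le> z - int (2 * n - k)" if "k \<le> 2 * n" for k
    using that
  proof (induction k)
    case 0
    then show ?case using walksD(3)[OF s order_refl] by auto
  next
    case (Suc k)
    define i where "i = 2 * n - Suc k"
    have i: "2 * n - k = Suc i" "i < 2 * n" using Suc.prems by (auto simp: i_def)
    obtain f where f: "bij_betw f (s i) (s (Suc i))" "\<forall>z\<in>s i. f z = z \<or> f z = z + 1"
      using st[OF i(2)] by (auto simp: step_def)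
    show ?case unfolding i_def[symmetric]
    proof
      fix z assume z: "z \<in> s i"
      then have "f z \<in> s (Suc i)" using f(1) by (auto simp: bij_betw_def)
      then have "f z + 1 \<le> int M + int n \<and> - int n \<le> f z - int (Suc i)" using Suc i by auto
      then show "z + 1 \<le> int M + int n \<and> - int n \<le> z - int i" using f(2) z by force
    qed
  qed
  show ?thesis using lo[OF i] hi[of "2 * n - i"] i z by (auto simp: edges_def)
qed

text \<open>The matching joins the tiles \<open>L\<close> at the holes and the tiles
  \<open>S\<close> traced by the moves. A triangle is served by \<open>L\<close> if its vertical
  edge is a hole and by \<open>S\<close> if it is a particle.\<close>

lemma slice_surj:
  assumes s: "s \<in> walks step {0..<int M} {int n..<int n + int M} (2 * n)"
  shows "\<exists>E\<in>matchings (int n) (int M). slice n M E = s"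
proof -
  have "\<forall>i<2 * n. \<exists>f. bij_betw f (s i) (s (Suc i)) \<and> (\<forall>z\<in>s i. f z = z \<or> f z = z + 1)"
    using walksD(2)[OF s] by (auto simp: step_def)
  then obtain f where f: "\<And>i. i < 2 * n \<Longrightarrow> bij_betw (f i) (s i) (s (Suc i))"
    "\<And>i z. i < 2 * n \<Longrightarrow> z \<in> s i \<Longrightarrow> f i z = z \<or> f i z = z + 1" by metis
  let ?e = "edges (int n) (int M)"
  define L where "L = {((z, int i), (z, int i)) | z i. (z, int i) \<in> ?e \<and> 1 \<le> i \<and> i < 2 * n \<and> z \<notin> s i}"
  define S where "S = {((z, int i), (f i z, int i + 1)) | z i. i < 2 * n \<and> z \<in> s i}"
  have s0: "z \<in> s 0 \<longleftrightarrow> (z, 0) \<in> ?e" for z using walksD(1)[OF s] by (auto simp: edges_def)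
  have s1: "z \<in> s (2 * n) \<longleftrightarrow> (z, int (2 * n)) \<in> ?e" for z using walksD(3)[OF s order_refl] by (auto simp: edges_def)
  have sE: "(z, int i) \<in> ?e" if "i \<le> 2 * n" "z \<in> s i" for i z using walk_in_edges[OF s that] .
  have fs: "f i z \<in> s (Suc i)" if "i < 2 * n" "z \<in> s i" for i z using f(1)[OF that(1)] that(2) by (auto simp: bij_betw_def)
  have memL: "(a, (w, int i)) \<in> L \<longleftrightarrow> a = (w, int i) \<and> (w, int i) \<in> ?e \<and> 1 \<le> i \<and> i < 2 * n \<and> w \<notin> s i" for a w i
    by (auto simp: L_def)
  have memS: "(a, (w, int (Suc k))) \<in> S \<longleftrightarrow> k < 2 * n \<and> (\<exists>z\<in>s k. a = (z, int k) \<and> f k z = w)" for a w k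
    by (auto simp: S_def)
  have "L \<union> S \<in> matchings (int n) (int M)"
    unfolding matchings_def mem_Collect_eq
  proof (intro conjI ballI)
    show "L \<union> S \<subseteq> adjs (int n) (int M)"
    proof
      fix x assume "x \<in> L \<union> S"
      then show "x \<in> adjs (int n) (int M)"
      proof
        assume "x \<in> L"
        then show ?thesis by (auto simp: L_def adjs_def rts_def lts_def)
      next
        assume "x \<in> S"
        then obtain z i where x: "x = ((z, int i), (f i z, int i + 1))" and i: "i < 2 * n" "z \<in> s i" by (auto simp: S_def)
        have "(f i z, int (Suc i)) \<in> ?e" using sE[of "Suc i" "f i z"] fs[OF i] i(1) by simp
        moreover have "(z, int i) \<in> ?e" using sE[of i z] i by simp
        ultimately show ?thesis using f(2)[OF i] i(1) unfolding x by (auto simp: adjs_def rts_def lts_def add.commute)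
      qed
    qed
  next
    fix a assume a: "a \<in> rts (int n) (int M)"
    obtain z i where ai: "a = (z, int i)" "i < 2 * n" "(z, int i) \<in> ?e"
    proof -
      have "0 \<le> snd a" using a by (auto simp: rts_def edges_def)
      then show ?thesis using a that[of "fst a" "nat (snd a)"] by (auto simp: rts_def)
    qed
    show "\<exists>!b. (a, b) \<in> L \<union> S"
    proof (cases "z \<in> s i")
      case True
      show ?thesis
      proof (rule ex1I[of _ "(f i z, int i + 1)"])
        show "(a, (f i z, int i + 1)) \<in> L \<union> S" using True ai by (auto simp: S_def)
        show "b = (f i z, int i + 1)" if "(a, b) \<in> L \<union> S" for b using that True ai by (auto simp: S_def L_def)
      qed
    next
      case False
      then have "1 \<le> i" using s0[of z] ai by (cases i) auto
      show ?thesis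
      proof (rule ex1I[of _ "(z, int i)"])
        show "(a, (z, int i)) \<in> L \<union> S" using False ai \<open>1 \<le> i\<close> by (auto simp: L_def)
        show "b = (z, int i)" if "(a, b) \<in> L \<union> S" for b using that False ai by (auto simp: S_def L_def)
      qed
    qed
  next
    fix b assume b: "b \<in> lts (int n) (int M)"
    obtain w i where bi: "b = (w, int i)" "1 \<le> i" "i \<le> 2 * n" "(w, int i) \<in> ?e"
    proof -
      have "1 \<le> snd b" "snd b \<le> 2 * int n" using b by (auto simp: lts_def edges_def)
      then show ?thesis using b that[of "fst b" "nat (snd b)"] by (auto simp: lts_def)
    qed
    then obtain k where k: "i = Suc k" "k < 2 * n" by (cases i) auto
    show "\<exists>!a. (a, b) \<in> L \<union> S"
    proof (cases "w \<in> s i")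
      case True
      then have "w \<in> f k ` s k" using f(1)[OF k(2)] k(1) by (simp add: bij_betw_def)
      then obtain z where z: "z \<in> s k" "f k z = w" by blast
      have uniq: "z' = z" if "z' \<in> s k" "f k z' = w" for z'
        using f(1)[OF k(2)] z that by (auto simp: bij_betw_def dest: inj_onD)
      show ?thesis
      proof (rule ex1I[of _ "(z, int k)"])
        show "((z, int k), b) \<in> L \<union> S" unfolding bi(1) Un_iff memL unfolding k(1) memS using z k(2) by blast
        show "a = (z, int k)" if "(a, b) \<in> L \<union> S" for a
          using that True uniq unfolding bi(1) Un_iff memL unfolding k(1) memS by blast
      qed
    next
      case False
      then have "i < 2 * n" using s1[of w] bi by (cases "i = 2 * n") auto
      show ?thesis
      proof (rule ex1I[of _ "(w, int i)"])
        show "((w, int i), b) \<in> L \<union> S" using False bi \<open>i < 2 * n\<close> unfolding bi(1) Un_iff memL by simp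
        show "a = (w, int i)" if "(a, b) \<in> L \<union> S" for a
          using that False fs unfolding bi(1) Un_iff memL unfolding k(1) memS by blast
      qed
    qed
  qed
  moreover have "slice n M (L \<union> S) = s"
  proof
    fix i
    have *: "slice n M (L \<union> S) i = s i" if "i \<le> 2 * n" for i
    proof -
      have "((z, int i), (z, int i)) \<in> L \<union> S \<longleftrightarrow> (z, int i) \<in> ?e \<and> 1 \<le> i \<and> i < 2 * n \<and> z \<notin> s i" for z
        by (auto simp: L_def S_def)
      moreover have "1 \<le> i" if "(z, int i) \<in> ?e" "z \<notin> s i" for z using s0[of z] that by (cases i) auto
      moreover have "i < 2 * n" if "(z, int i) \<in> ?e" "z \<notin> s i" for z
        using s1[of z] that \<open>i \<le> 2 * n\<close> by (cases "i = 2 * n") auto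
      ultimately show ?thesis using sE[OF that] that unfolding slice_def Let_def min_absorb1[OF that] by blast
    qed
    show "slice n M (L \<union> S) i = s i"
    proof (cases "i \<le> 2 * n")
      case False
      then have "slice n M (L \<union> S) i = slice n M (L \<union> S) (2 * n)" by (simp add: slice_def)
      then show ?thesis using *[of "2 * n"] walksD(3)[OF s, of i] walksD(3)[OF s, of "2 * n"] False by simp
    qed (rule *)
  qed
  ultimately show ?thesis by blast
qed

lemma card_matchings:
  defines "S n M \<equiv> walks step {0..<int M} {int n..<int n + int M} (2 * n)"
  shows "card (matchings (int n) (int M)) = card (S n M)"
    and "t < 2 * n \<Longrightarrow> (K, int t) \<in> edges (int n) (int M) \<Longrightarrow>
      card {E \<in> matchings (int n) (int M). ((K, int t), (K, int t)) \<in> E} = card {f \<in> S n M. K \<notin> f t}"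
proof -
  have im: "slice n M ` matchings (int n) (int M) = S n M"
    unfolding S_def using slice_walk slice_surj by blast
  show "card (matchings (int n) (int M)) = card (S n M)"
    unfolding im[symmetric] by (rule card_image[OF slice_inj, symmetric])
  assume t: "t < 2 * n" and e: "(K, int t) \<in> edges (int n) (int M)"
  have "((K, int t), (K, int t)) \<in> E \<longleftrightarrow> K \<notin> slice n M E t" for E
    using t e by (simp add: slice_def min_def Let_def)
  then have im': "slice n M ` {E \<in> matchings (int n) (int M). ((K, int t), (K, int t)) \<in> E} = {f \<in> S n M. K \<notin> f t}"
    using im by auto
  have "inj_on (slice n M) {E \<in> matchings (int n) (int M). ((K, int t), (K, int t)) \<in> E}"
    by (rule inj_on_subset[OF slice_inj]) auto
  then show "card {E \<in> matchings (int n) (int M). ((K, int t), (K, int t)) \<in> E} = card {f \<in> S n M. K \<notin> f t}"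
    unfolding im'[symmetric] by (rule card_image[symmetric])
qed

subsection \<open>The limit\<close>

text \<open>The union of the two triangles is the intersection of two unit strips, in
  \<open>vcoord\<close> and in \<open>vcoord - ucoord\<close>, and is therefore convex.\<close>

lemma rhombus_hull:
  "convex hull (lpt M ` {(z, j - 1), (z + 1, j + 1), (z, j), (z + 1, j)}) = rhomb M ((z, j), (z, j))" (is "?C = ?R")
proof
  let ?H = "{p. of_int z \<le> vcoord M p} \<inter> {p. vcoord M p \<le> of_int (z + 1)} \<inter> {p. of_int (z - j) \<le> vcoord M p - ucoord p} \<inter> {p. vcoord M p - ucoord p \<le> of_int (z - j + 1)}"
  have "convex ?H" by (intro convex_Int convex_vcoord convex_vcoord_ucoord)
  then have "?C \<subseteq> ?H"
    by (rule hull_minimal[where S = convex, rotated]) (auto simp: lpt_def)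
  also have "\<dots> \<subseteq> ?R" by (auto simp: rhomb_def rtri_def ltri_def)
  finally show "?C \<subseteq> ?R" .
  have "rtri M (z, j) \<subseteq> ?C"
    unfolding rtri_hull[symmetric] by (intro hull_mono image_mono) auto
  moreover have "ltri M (z, j) \<subseteq> ?C"
    unfolding ltri_hull[symmetric] by (intro hull_mono image_mono) auto
  ultimately show "?R \<subseteq> ?C"
    by (simp add: rhomb_def)
qed

lemma axis_rhombus_even_eq:
  "axis_rhombus_even l = rhomb (2 * m) ((m + l - 1, 2 * l - 1), (m + l - 1, 2 * l - 1))"
proof -
  have "lpt (2 * m) ` {(m + l - 1, (2 * l - 1) - 1), ((m + l - 1) + 1, (2 * l - 1) + 1), (m + l - 1, 2 * l - 1), ((m + l - 1) + 1, 2 * l - 1)}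
    = {((of_int l - 1) * sqrt 3, 0), (of_int l * sqrt 3, 0),
      ((of_int l - 1 / 2) * sqrt 3, 1 / 2), ((of_int l - 1 / 2) * sqrt 3, - 1 / 2)}"
    by (simp add: lpt_def pt_def algebra_simps diff_divide_distrib add_divide_distrib)
  then show ?thesis unfolding rhombus_hull[symmetric] axis_rhombus_even_def by (rule arg_cong[symmetric])
qed

lemma axis_rhombus_odd_eq:
  "axis_rhombus_odd l = rhomb (2 * m - 1) ((m + l - 1, 2 * l), (m + l - 1, 2 * l))"
proof -
  have "lpt (2 * m - 1) ` {(m + l - 1, 2 * l - 1), ((m + l - 1) + 1, 2 * l + 1), (m + l - 1, 2 * l), ((m + l - 1) + 1, 2 * l)}
    = {((of_int l - 1 / 2) * sqrt 3, 0), ((of_int l + 1 / 2) * sqrt 3, 0),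
      (of_int l * sqrt 3, 1 / 2), (of_int l * sqrt 3, - 1 / 2)}"
    by (simp add: lpt_def pt_def algebra_simps diff_divide_distrib add_divide_distrib)
  then show ?thesis unfolding rhombus_hull[symmetric] axis_rhombus_odd_def by (rule arg_cong[symmetric])
qed

lemma tiling_proportion_axis:
  fixes M s t n K K' :: nat
  assumes "2 * K + 1 = M + t" "2 * K' + 1 = M + s" "s + t = 2 * n" "0 < s" "0 < t"
  shows "tiling_proportion (int n) (int M) (rhomb (int M) ((int K, int t), (int K, int t))) =
     1 - occupation K K' M"
proof -
  have n: "1 \<le> int n" "0 \<le> int M" using assms by auto
  have e: "(int K, int t) \<in> edges (int n) (int M)" "t < 2 * n" using assms by (auto simp: edges_def)
  show ?thesis
    unfolding tiling_proportion_def card_tilings[OF n] card_matchings(1) card_matchings(2)[OF e(2,1)]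
    by (rule occupation_probability[OF assms])
qed

text \<open>The half-angle formula \<open>cos (pi - 2 * p) = 2 * (sin p)^2 - 1\<close> with
  \<open>sin p = sqrt r\<close>.\<close>

lemma one_minus_arccos:
  assumes "0 \<le> r" "r \<le> 1"
  shows "1 - arccos (2 * r - 1) / pi = 2 / pi * arcsin (sqrt r)"
proof -
  let ?p = "arcsin (sqrt r)"
  have s: "0 \<le> sqrt r" "sqrt r \<le> 1" using assms by auto
  have m: "- 1 \<le> sqrt r" using s(1) by linarith
  have p: "0 \<le> ?p" "?p \<le> pi / 2" by (rule arcsin_nonneg, use s in simp, rule arcsin_ubound[OF m s(2)])
  have "cos (pi - 2 * ?p) = 2 * (sin ?p)\<^sup>2 - 1"
    by (simp add: cos_diff cos_double_sin)
  also have "\<dots> = 2 * r - 1" using assms by (simp add: sin_arcsin[OF m s(2)])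
  finally have "arccos (2 * r - 1) = pi - 2 * ?p"
    using arccos_cos[of "pi - 2 * ?p"] p by simp
  then show ?thesis by (simp add: diff_divide_distrib)
qed

text \<open>Both families of hexagons lead to the same \<open>K\<close> and \<open>K'\<close> and
  differ here in \<open>M\<close> alone, so one limit serves both. Minimum and maximum are taken
  because the order of \<open>K\<close> and \<open>K'\<close> may vary with
  \<open>N\<close>.\<close>

lemma axis_limit:
  fixes m l :: "nat \<Rightarrow> int" and M :: "nat \<Rightarrow> nat" and a b :: real
  assumes a: "0 \<le> a" and b: "0 < b" "b < 1"
    and l: "\<And>N. 1 \<le> N \<Longrightarrow> 1 \<le> l N \<and> l N \<le> int N"
    and m: "\<And>N. 1 \<le> N \<Longrightarrow> 0 \<le> m N"
    and mlim: "(\<lambda>N. real_of_int (m N) / real N) \<longlonglongrightarrow> a"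
    and llim: "(\<lambda>N. real_of_int (l N) / real N) \<longlonglongrightarrow> b"
    and M: "(\<lambda>N. real (M N) / real N) \<longlonglongrightarrow> 2 * a" "\<And>N. 1 \<le> N \<Longrightarrow> int (M N) \<le> 2 * m N"
  defines "K \<equiv> \<lambda>N. nat (m N + l N - 1)" and "K' \<equiv> \<lambda>N. nat (m N + int N - l N)"
  shows "(\<lambda>N. 1 - occupation (K N) (K' N) (M N))
     \<longlonglongrightarrow> 2 / pi * arcsin (sqrt (b * (1 - b)) / sqrt ((a + b) * (a - b + 1)))"
proof -
  have ev: "\<forall>\<^sub>F N in sequentially. 1 \<le> N" by (rule eventually_ge_at_top)
  have KN: "real (K N) = m N + l N - 1" "real (K' N) = m N + real N - l N" if "1 \<le> N" for N
    using l[OF that] m[OF that] by (auto simp: K_def K'_def)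
  have "(\<lambda>N. real_of_int (m N) / real N + real_of_int (l N) / real N - 1 / real N) \<longlonglongrightarrow> a + b - 0"
    by (intro tendsto_intros mlim llim lim_const_over_n)
  moreover have "\<forall>\<^sub>F N in sequentially. real_of_int (m N) / real N + real_of_int (l N) / real N - 1 / real N = real (K N) / real N"
    using ev by eventually_elim (simp add: KN add_divide_distrib diff_divide_distrib)
  ultimately have Klim: "(\<lambda>N. real (K N) / real N) \<longlonglongrightarrow> a + b"
    using Lim_transform_eventually by fastforce
  have "(\<lambda>N. real_of_int (m N) / real N + 1 - real_of_int (l N) / real N) \<longlonglongrightarrow> a + 1 - b"
    by (intro tendsto_intros mlim llim)
  moreover have "\<forall>\<^sub>F N in sequentially. real_of_int (m N) / real N + 1 - real_of_int (l N) / real N = real (K' N) / real N"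
    using ev by eventually_elim (simp add: KN add_divide_distrib diff_divide_distrib)
  ultimately have K'lim: "(\<lambda>N. real (K' N) / real N) \<longlonglongrightarrow> a + 1 - b"
    using Lim_transform_eventually by fastforce
  let ?A1 = "min (a + b) (a + 1 - b)" and ?A2 = "max (a + b) (a + 1 - b)"
  have sum: "?A1 + ?A2 = 2 * a + 1" and prod: "?A1 * ?A2 = (a + b) * (a + 1 - b)"
    by (auto simp: min_def max_def)
  have kap: "(a + b) * (a + 1 - b) > 0" using a b by simp
  \<comment> \<open>The numerator in the arccosine is \<open>4 * a * (a + 1)\<close>; this splitting
    of the denominator turns the argument into \<open>2 * r - 1\<close>.\<close>
  have id: "(a + b) * (a + 1 - b) = a * (a + 1) + b * (1 - b)" by (simp add: algebra_simps)
  have q: "2 * a * (2 * (?A1 + ?A2) - 2 * a) = 4 * (a * (a + 1))" unfolding sum by (simp add: algebra_simps)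
  have bb: "0 < b * (1 - b)" using b by simp
  have aa: "0 \<le> a * (a + 1)" using a by simp
  have lim: "(\<lambda>N. occupation (K N) (K' N) (M N)) \<longlonglongrightarrow>
     arccos (1 - 2 * a * (2 * (?A1 + ?A2) - 2 * a) / (2 * ?A1 * ?A2)) / pi"
  proof (rule hahn_occupation_tendsto)
    show "(\<lambda>N. real (min (K N) (K' N)) / real N) \<longlonglongrightarrow> ?A1"
      using tendsto_min[OF Klim K'lim] by (rule Lim_transform_eventually) (auto simp: min_def divide_le_cancel intro!: always_eventually)
    show "(\<lambda>N. real (max (K N) (K' N)) / real N) \<longlonglongrightarrow> ?A2"
      using tendsto_max[OF Klim K'lim] by (rule Lim_transform_eventually) (auto simp: max_def divide_le_cancel intro!: always_eventually)
    show "\<forall>\<^sub>F N in sequentially. M N \<le> 2 * min (K N) (K' N)"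
      using ev
    proof eventually_elim
      case (elim N)
      then show ?case using l[OF elim] m[OF elim] M(2)[OF elim] by (auto simp: K_def K'_def)
    qed
    show "0 < ?A1" "0 < ?A2" using a b by auto
    show "0 \<le> 2 * a * (2 * (?A1 + ?A2) - 2 * a)" unfolding q using aa by simp
    have "4 * (a * (a + 1)) \<le> 4 * (?A1 * ?A2)" unfolding prod id using bb by simp
    then show "2 * a * (2 * (?A1 + ?A2) - 2 * a) \<le> 4 * ?A1 * ?A2" unfolding q by (simp add: mult.assoc)
  qed (use M in auto)
  define r where "r = b * (1 - b) / ((a + b) * (a + 1 - b))"
  have r: "0 \<le> r" "r \<le> 1" using kap bb aa unfolding r_def id by (auto simp: divide_le_eq_1)
  have eq: "1 - 2 * a * (2 * (?A1 + ?A2) - 2 * a) / (2 * ?A1 * ?A2) = 2 * r - 1"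
  proof -
    have "2 * ?A1 * ?A2 = 2 * ((a + b) * (a + 1 - b))" using prod by (simp only: mult.assoc)
    moreover have "1 - 4 * (a * (a + 1)) / (2 * k) = 2 * (c / k) - 1" if "k > 0" "k = a * (a + 1) + c" for k c
      using that by (simp add: field_simps)
    ultimately show ?thesis unfolding q r_def using kap id by simp
  qed
  have "(\<lambda>N. 1 - occupation (K N) (K' N) (M N)) \<longlonglongrightarrow> 1 - arccos (2 * r - 1) / pi"
    using lim unfolding eq by (rule tendsto_diff[OF tendsto_const])
  then have "(\<lambda>N. 1 - occupation (K N) (K' N) (M N)) \<longlonglongrightarrow> 2 / pi * arcsin (sqrt r)"
    unfolding one_minus_arccos[OF r] .
  moreover have "sqrt r = sqrt (b * (1 - b)) / sqrt ((a + b) * (a - b + 1))"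
    unfolding r_def real_sqrt_divide by (simp add: algebra_simps)
  ultimately show ?thesis by simp
qed

theorem theorem4:
  fixes a b :: real and m l :: "nat \<Rightarrow> int"
  assumes "0 \<le> a" and "0 < b" and "b < 1"
    and "\<And>N. 1 \<le> N \<Longrightarrow> 1 \<le> l N \<and> l N \<le> int N"
    and "(\<lambda>N. real_of_int (m N) / real N) \<longlonglongrightarrow> a"
    and "(\<lambda>N. real_of_int (l N) / real N) \<longlonglongrightarrow> b"
  shows "((\<forall>N\<ge>1. 0 \<le> m N) \<longrightarrow>
            (\<lambda>N. tiling_proportion (int N) (2 * m N) (axis_rhombus_even (l N)))
              \<longlonglongrightarrow> 2 / pi * arcsin (sqrt (b * (1 - b)) / sqrt ((a + b) * (a - b + 1)))) \<and>
         ((\<forall>N\<ge>1. 1 \<le> m N) \<longrightarrow>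
            (\<lambda>N. tiling_proportion (int N + 1) (2 * m N - 1) (axis_rhombus_odd (l N)))
              \<longlonglongrightarrow> 2 / pi * arcsin (sqrt (b * (1 - b)) / sqrt ((a + b) * (a - b + 1))))"
proof (intro conjI impI)
  let ?L = "2 / pi * arcsin (sqrt (b * (1 - b)) / sqrt ((a + b) * (a - b + 1)))"
  let ?K = "\<lambda>N. nat (m N + l N - 1)" and ?K' = "\<lambda>N. nat (m N + int N - l N)"
  have ev: "\<forall>\<^sub>F N in sequentially. 1 \<le> N" by (rule eventually_ge_at_top)
  {
    assume m: "\<forall>N\<ge>1. 0 \<le> m N"
    let ?M = "\<lambda>N. nat (2 * m N)"
    have "\<forall>\<^sub>F N in sequentially. 2 * (real_of_int (m N) / real N) = real (?M N) / real N"
      using ev by eventually_elim (use m in auto)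
    then have "(\<lambda>N. real (?M N) / real N) \<longlonglongrightarrow> 2 * a"
      by (rule Lim_transform_eventually[OF tendsto_mult_left[OF assms(5)]])
    from axis_limit[OF assms(1-4) _ assms(5,6) this] m
    have "(\<lambda>N. 1 - occupation (?K N) (?K' N) (?M N))
     \<longlonglongrightarrow> ?L" by simp
    moreover have "\<forall>\<^sub>F N in sequentially. 1 - occupation (?K N) (?K' N) (?M N)
      = tiling_proportion (int N) (2 * m N) (axis_rhombus_even (l N))"
      using ev
    proof eventually_elim
      case (elim N)
      \<comment> \<open>The short diagonal is at abscissa \<open>(l - 1/2) * sqrt 3\<close>, which
        is line \<open>2 * l - 1\<close>; from there \<open>s\<close> steps lead to the last line
        \<open>2 * N\<close>.\<close>
      let ?t = "nat (2 * l N - 1)" and ?s = "nat (2 * int N - 2 * l N + 1)"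
      have m0: "0 \<le> m N" using m elim by simp
      have c: "int (?M N) = 2 * m N" "int (?K N) = m N + l N - 1" "int ?t = 2 * l N - 1"
        using m0 assms(4)[OF elim] by auto
      have "2 * ?K N + 1 = ?M N + ?t" "2 * ?K' N + 1 = ?M N + ?s" "?s + ?t = 2 * N" "0 < ?s" "0 < ?t"
        using m0 assms(4)[OF elim] by (auto simp: nat_eq_iff)
      from tiling_proportion_axis[OF this] show ?case
        unfolding axis_rhombus_even_eq[of "l N" "m N"] c by simp
    qed
    ultimately show "(\<lambda>N. tiling_proportion (int N) (2 * m N) (axis_rhombus_even (l N)))
              \<longlonglongrightarrow> ?L"
      by (rule Lim_transform_eventually)
  }
  {
    assume m: "\<forall>N\<ge>1. 1 \<le> m N"
    let ?M = "\<lambda>N. nat (2 * m N - 1)"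
    have "\<forall>\<^sub>F N in sequentially. 2 * (real_of_int (m N) / real N) - 1 / real N = real (?M N) / real N"
    proof (use ev in eventually_elim)
      case (elim N)
      then have "real (?M N) = 2 * m N - 1" using m by auto
      then show ?case by (simp add: diff_divide_distrib)
    qed
    moreover have "(\<lambda>N. 2 * (real_of_int (m N) / real N) - 1 / real N) \<longlonglongrightarrow> 2 * a - 0"
      by (intro tendsto_intros assms(5) lim_const_over_n)
    ultimately have "(\<lambda>N. real (?M N) / real N) \<longlonglongrightarrow> 2 * a"
      using Lim_transform_eventually by fastforce
    from axis_limit[OF assms(1-4) _ assms(5,6) this] m
    have "(\<lambda>N. 1 - occupation (?K N) (?K' N) (?M N))
     \<longlonglongrightarrow> ?L" by force
    moreover have "\<forall>\<^sub>F N in sequentially. 1 - occupation (?K N) (?K' N) (?M N)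
      = tiling_proportion (int N + 1) (2 * m N - 1) (axis_rhombus_odd (l N))"
      using ev
    proof eventually_elim
      case (elim N)
      \<comment> \<open>Here the short diagonal is at abscissa \<open>l * sqrt 3\<close>, which is
        line \<open>2 * l\<close>, and the last line is \<open>2 * (N + 1)\<close>.\<close>
      let ?t = "nat (2 * l N)" and ?s = "nat (2 * int N + 2 - 2 * l N)"
      have m1: "1 \<le> m N" using m elim by simp
      have c: "int (?M N) = 2 * m N - 1" "int (?K N) = m N + l N - 1" "int ?t = 2 * l N" "int (N + 1) = int N + 1"
        using m1 assms(4)[OF elim] by auto
      have "2 * ?K N + 1 = ?M N + ?t" "2 * ?K' N + 1 = ?M N + ?s" "?s + ?t = 2 * (N + 1)" "0 < ?s" "0 < ?t"
        using m1 assms(4)[OF elim] by (auto simp: nat_eq_iff)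
      from tiling_proportion_axis[OF this] show ?case
        unfolding axis_rhombus_odd_eq[of "l N" "m N"] c by simp
    qed
    ultimately show "(\<lambda>N. tiling_proportion (int N + 1) (2 * m N - 1) (axis_rhombus_odd (l N)))
              \<longlonglongrightarrow> ?L"
      by (rule Lim_transform_eventually)
  }
qed

end
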